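(* Let $A$ be a convex polytope in $\mathbb{R}^3$ and let $L$ be a lattice in $\mathbb{R}^3$. Then $A$ tiles at some level $k$ by translations with respect to $L$ (i.e. $\sum_{\lambda\in L}\chi_A(x-\lambda)=k$ a.e. for some positive integer $k$) if and only if $A$ is centrally symmetric, every facet of $A$ is centrally symmetric, and for each four-legged-frame $(e,e',e'',e''')$ of $A$, with associated facets $F,F'$ and vectors $\tau',\tau''$, the following three conditions hold: (i) for some $\lambda'\in L$, $F+\lambda'$ and $F'$ lie in the same plane; (ii) there is $\lambda\in L$ such that $e+\lambda$ lies on the same line as $e'$ or on the same line as $e''$; (iii) if none of the three vectors $\vec{e},\tau',\tau''$ belongs to $L$, then all four vectors $\vec{e}\pm\tau'\pm\tau''$ (all choices of signs) belong to $L$.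
   Context: A lattice in $\mathbb{R}^3$ is the subgroup generated by $3$ linearly independent vectors. A facet is a $2$-dimensional face. For an edge $e$, $\vec{e}$ denotes the vector joining its two endpoints. Four-legged-frame: assume $A\subset\mathbb{R}^3$ is a convex polytope which is centrally symmetric and has centrally symmetric facets. Let $F$ be a facet of $A$; then there is a parallel facet $F'=F+\tau'$ of $A$ which is a translate of $F$ (by the vector $\tau'$). Let $e$ be an edge of $A$ contained in $F$; by central symmetry of $F$ there is another edge $e''$ of $F$, parallel to $e$ and of the same length, with $e''=e+\tau''$. The four parallel edges $e$, $e'=e+\tau'$, $e''=e+\tau''$, $e'''=e+\tau'+\tau''$ of $A$ obtained this way form a four-legged-frame $(e,e',e'',e''')$, with associated facets $F,F'$ and vectors $\tau',\tau''$. *)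

theory Defs
  imports "HOL-Analysis.Analysis"
begin

definition is_lattice :: "(real^3) set \<Rightarrow> bool" where
  "is_lattice L \<longleftrightarrow>
     (\<exists>B. independent B \<and> card B = 3 \<and>
          L = {\<Sum>b\<in>B. of_int (c b) *\<^sub>R b | c :: real^3 \<Rightarrow> int. True})"

definition centrally_symmetric :: "(real^3) set \<Rightarrow> bool" where
  "centrally_symmetric S \<longleftrightarrow> (\<exists>c. (\<lambda>x. 2 *\<^sub>R c - x) ` S = S)"

definition tiles_at_level :: "(real^3) set \<Rightarrow> (real^3) set \<Rightarrow> nat \<Rightarrow> bool" where
  "tiles_at_level A L k \<longleftrightarrow>
     (AE x in lborel. ((\<lambda>l. indicat_real A (x - l)) has_sum real k) L)"

text \<open>
  Arguments: the polytope, the facets \<open>F\<close> and \<open>F'\<close>, the vectors \<open>t'\<close> and \<open>t''\<close>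
  joining \<open>F\<close> to \<open>F'\<close> and \<open>e\<close> to \<open>e''\<close>, and the four edges.  The conditions
  \<open>F' \<noteq> F\<close> and \<open>e'' \<noteq> e\<close> exclude the zero translations.  As \<open>F'\<close> is a translate
  of \<open>F\<close>, the sets \<open>e'\<close> and \<open>e'''\<close> are automatically edges of \<open>F'\<close>.
\<close>

definition four_legged_frame ::
  "(real^3) set \<Rightarrow> (real^3) set \<Rightarrow> (real^3) set \<Rightarrow> real^3 \<Rightarrow> real^3 \<Rightarrow>
   (real^3) set \<Rightarrow> (real^3) set \<Rightarrow> (real^3) set \<Rightarrow> (real^3) set \<Rightarrow> bool" where
  "four_legged_frame A F F' t' t'' e e' e'' e''' \<longleftrightarrow>
     F facet_of A \<and> F' facet_of A \<and> F' \<noteq> F \<and> F' = (+) t' ` F \<and>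
     e edge_of A \<and> e \<subseteq> F \<and>
     e'' edge_of F \<and> e'' \<noteq> e \<and> e'' = (+) t'' ` e \<and>
     e' = (+) t' ` e \<and> e''' = (+) (t' + t'') ` e"

text \<open>A vector joining the endpoints of a segment; it is determined only up to sign.\<close>

definition edge_vector :: "(real^3) set \<Rightarrow> real^3 \<Rightarrow> bool" where
  "edge_vector e v \<longleftrightarrow> (\<exists>p q. e = closed_segment p q \<and> v = q - p)"

end

theory Submission
  imports Defs
begin

text \<open>Tiling means that the multiplicity function of the translates of \<open>A\<close> is constant. It is locally
  constant off the translated facets, and its jump across a hyperplane with normal \<open>n\<close> is the signed
  count, within that hyperplane, of the translates of the facets with outer normals \<open>n\<close> and \<open>-n\<close>.
  Iterating, the jumps of facet counts are signed counts of edges, and those of edge counts are signed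
  counts of vertices. A signed count is constant iff all its jumps vanish.

  If \<open>A\<close> tiles, integrating the vanishing facet counts over a period gives opposite facets equal areas,
  and then, after translation, \<open>vol (A + t (-A)) \<le> vol A (1 + 3 t) + O(t^2)\<close>. This extremal growth
  makes \<open>A\<close> symmetric: the planar Brunn--Minkowski inequality applied along the transport of slice
  areas from \<open>A\<close> to \<open>-A\<close> forces the transport to be a translation, so the centroid of \<open>A\<close> is the
  midpoint of its support planes in every direction. Vanishing of the edge counts gives opposite
  edges of a facet equal length, which makes the facet symmetric.

  Conversely, constancy at one level improves to vanishing as soon as the two halves of a family differ
  by a lattice translation, up to a vector of the carrier space: the count is then \<open>G x - G (x - u)\<close>
  with \<open>G\<close> bounded. Conditions (i) and (ii) provide these translations for facets and edges. At the
  bottom, the eight signed vertices of a frame, the vertices of a parallelepiped with edges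
  \<open>e, \<tau>', \<tau>''\<close>, cancel modulo \<open>L\<close> exactly under (iii).\<close>

section \<open>Faces and local structure of polytopes\<close>

text \<open>Equal areas of opposite facets would give symmetry at once by Minkowski's uniqueness
  theorem; the growth estimate stands in for it. Equality of the areas turns the sum of h_{-A}(n)
  area(F_n) into the sum of h_A(n) area(F_n) = 3 vol A, so the mixed volume V(A,A,-A) is as small as
  Minkowski's first inequality allows; the factor 3 is the dimension. Instead of the full equality
  case, one number per direction is extracted, the height of the centroid, and that already fixes
  the centre. Two obstacles shape the counting part. Closed translates overlap on their walls, so
  the counts are meaningful only at \<open>good\<close> points, and the arguments move to a point,
  or to a segment, in general position within the coset at hand. Moreover a hyperplane need not meet
  \<open>L\<close> in a lattice of full rank, so there may be no period inside it over which to
  integrate; facets and edges are therefore thickened by a fixed set orthogonal to them, and the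
  averaging takes place in the whole space.\<close>

definition fc :: "'a::euclidean_space \<Rightarrow> 'a set \<Rightarrow> 'a set" where
  "fc m P = {x\<in>P. \<forall>y\<in>P. m \<bullet> y \<le> m \<bullet> x}"

text \<open>The interior of \<open>P\<close> relative to its coset of \<open>V\<close>: empty if \<open>P\<close> has lower dimension than \<open>V\<close>.\<close>

definition irint :: "'a::euclidean_space set \<Rightarrow> 'a set \<Rightarrow> 'a set" where
  "irint V P = {x\<in>P. \<exists>e>0. \<forall>v\<in>V. norm v < e \<longrightarrow> x + v \<in> P}"

text \<open>The dimension of \<open>P\<close> may be smaller than that of \<open>V\<close>. This
  keeps the class closed under \<open>fc m\<close> for every direction \<open>m\<close>, whether or
  not the face is a facet; members that are too flat are dealt with by \<open>good\<close>.\<close>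

definition vpoly :: "'a::euclidean_space set \<Rightarrow> 'a set \<Rightarrow> bool" where
  "vpoly V P \<longleftrightarrow> polytope P \<and> P \<noteq> {} \<and> (\<forall>x\<in>P. \<forall>y\<in>P. x - y \<in> V)"

text \<open>Applied with a nonzero \<open>m\<close> in \<open>V\<close>, so that the carriers run
  through space, planes, lines and the origin.\<close>

definition perp :: "'a::euclidean_space set \<Rightarrow> 'a \<Rightarrow> 'a set" where
  "perp V m = {v\<in>V. m \<bullet> v = 0}"

lemma subspace_perp: "subspace V \<Longrightarrow> subspace (perp V m)"
  unfolding perp_def subspace_def by (auto simp: inner_add_right)

lemma fc_subset: "fc m P \<subseteq> P"
  by (auto simp: fc_def)

lemma fc_face_of:
  assumes "convex P" shows "fc m P face_of P"
proof (cases "fc m P = {}")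
  case False
  then obtain x where x: "x \<in> P" "\<forall>y\<in>P. m \<bullet> y \<le> m \<bullet> x" by (auto simp: fc_def)
  have "fc m P = P \<inter> {y. m \<bullet> y = m \<bullet> x}"
    using x by (force simp: fc_def)
  then show ?thesis
    using face_of_Int_supporting_hyperplane_le[OF assms] x by metis
qed auto

lemma fc_nonempty:
  assumes "compact P" "P \<noteq> {}" shows "fc m P \<noteq> {}"
proof -
  have "continuous_on P (\<lambda>x. m \<bullet> x)" by (intro continuous_intros)
  then obtain x where "x\<in>P" "\<forall>y\<in>P. m \<bullet> y \<le> m \<bullet> x"
    using continuous_attains_sup assms by blast
  then show ?thesis by (auto simp: fc_def)
qed

lemma polytope_fc: "polytope P \<Longrightarrow> polytope (fc m P)"
  using face_of_polytope_polytope fc_face_of polytope_imp_convex by blast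

lemma vpoly_fc:
  assumes "vpoly V P" shows "vpoly (perp V m) (fc m P)"
proof -
  have 1: "polytope (fc m P)" "fc m P \<noteq> {}"
    using assms by (auto simp: vpoly_def polytope_fc fc_nonempty polytope_imp_compact)
  have "x - y \<in> perp V m" if "x \<in> fc m P" "y \<in> fc m P" for x y
  proof -
    have "m \<bullet> x = m \<bullet> y" using that by (intro antisym) (auto simp: fc_def)
    moreover have "x - y \<in> V" using that assms by (auto simp: fc_def vpoly_def)
    ultimately show ?thesis by (simp add: perp_def inner_diff_right)
  qed
  then show ?thesis using 1 by (auto simp: vpoly_def)
qed

lemma fc_scale: "k > 0 \<Longrightarrow> fc (k *\<^sub>R m) P = fc m P"
  by (auto simp: fc_def)

section \<open>Half-space descriptions inside a coset, and local walls\<close>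

definition hrep :: "'a::euclidean_space set \<Rightarrow> 'a set \<Rightarrow> ('a \<times> real) set \<Rightarrow> bool" where
  "hrep V P C \<longleftrightarrow> finite C \<and> (\<forall>(a,b)\<in>C. a \<in> V \<and> a \<noteq> 0) \<and>
    (\<exists>p. P = {x. x - p \<in> V \<and> (\<forall>(a,b)\<in>C. a \<bullet> x \<le> b)})"

text \<open>Split each normal into a part in \<open>V\<close> and a part orthogonal to
  \<open>V\<close>. On the coset \<open>p + V\<close> the orthogonal part contributes a constant,
  which moves to the right-hand side. Keeping the normals inside \<open>V\<close> matters later:
  every wall then cuts the coset properly and can be avoided by moving within
  \<open>V\<close>.\<close>

lemma hrep_exists:
  assumes "subspace V" "vpoly V P"
  shows "\<exists>C. hrep V P C"
proof -
  from assms obtain p where p: "p \<in> P" and sub: "\<forall>x\<in>P. x - p \<in> V" by (auto simp: vpoly_def)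
  have "polyhedron P" using assms by (auto simp: vpoly_def polytope_imp_polyhedron)
  then obtain F where F: "finite F" "P = \<Inter>F" "\<forall>h\<in>F. \<exists>a b. a \<noteq> 0 \<and> h = {x. a \<bullet> x \<le> b}"
    unfolding polyhedron_def by blast
  then obtain A B where AB: "\<And>h. h\<in>F \<Longrightarrow> h = {x. A h \<bullet> x \<le> B h}" by metis
  have "\<exists>y z. y \<in> V \<and> (\<forall>w\<in>V. z \<bullet> w = 0) \<and> a = y + z" for a
  proof -
    obtain y z where "y \<in> span V" "\<And>w. w \<in> span V \<Longrightarrow> orthogonal z w" "a = y + z"
      using orthogonal_subspace_decomp_exists by metis
    then show ?thesis using assms(1) by (metis orthogonal_def span_eq_iff)
  qed
  then obtain Y Z where YZ: "\<And>a. Y a \<in> V" "\<And>a w. w\<in>V \<Longrightarrow> Z a \<bullet> w = 0" "\<And>a. a = Y a + Z a" by metis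
  define C where "C = {(Y (A h), B h - Z (A h) \<bullet> p) | h. h \<in> F \<and> Y (A h) \<noteq> 0}"
  have key: "x \<in> h \<longleftrightarrow> Y (A h) \<bullet> x \<le> B h - Z (A h) \<bullet> p" if "h \<in> F" "x - p \<in> V" for h x
  proof -
    have "A h \<bullet> x = Y (A h) \<bullet> x + Z (A h) \<bullet> x" using YZ(3)[of "A h"] by (metis inner_add_left)
    moreover have "Z (A h) \<bullet> x = Z (A h) \<bullet> p" using YZ(2)[OF that(2), of "A h"] by (simp add: inner_diff_right)
    ultimately show ?thesis using AB[OF that(1)] by (metis (mono_tags, lifting) le_diff_eq mem_Collect_eq)
  qed
  have "P = {x. x - p \<in> V \<and> (\<forall>(a,b)\<in>C. a \<bullet> x \<le> b)}"
  proof (intro set_eqI iffI)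
    fix x assume x: "x \<in> P"
    then have xp: "x - p \<in> V" and xh: "\<And>h. h \<in> F \<Longrightarrow> x \<in> h" using sub F(2) by auto
    have "Y (A h) \<bullet> x \<le> B h - Z (A h) \<bullet> p" if "h \<in> F" for h using key[OF that xp] xh[OF that] by simp
    then show "x \<in> {x. x - p \<in> V \<and> (\<forall>(a,b)\<in>C. a \<bullet> x \<le> b)}"
      using xp unfolding C_def by auto
  next
    fix x assume "x \<in> {x. x - p \<in> V \<and> (\<forall>(a,b)\<in>C. a \<bullet> x \<le> b)}"
    then have x: "x - p \<in> V" "\<forall>(a,b)\<in>C. a \<bullet> x \<le> b" by auto
    have "x \<in> h" if h: "h \<in> F" for h
    proof (cases "Y (A h) = 0")
      \<comment> \<open>The constraint is constant on the coset and holds at \<open>p\<close>, so it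
        may be dropped.\<close>
      case True
      have "p \<in> h" using p F(2) h by auto
      then have "Y (A h) \<bullet> p \<le> B h - Z (A h) \<bullet> p" using key[OF h, of p] subspace_0[OF assms(1)] by simp
      then show ?thesis using key[OF h x(1)] True by simp
    next
      case False
      then show ?thesis using key[OF h x(1)] x(2) h unfolding C_def by fastforce
    qed
    then show "x \<in> P" using F(2) by auto
  qed
  moreover have "finite C"
  proof -
    have "C \<subseteq> (\<lambda>h. (Y (A h), B h - Z (A h) \<bullet> p)) ` F" by (auto simp: C_def)
    then show ?thesis using F(1) finite_subset by blast
  qed
  moreover have "\<forall>(a,b)\<in>C. a \<in> V \<and> a \<noteq> 0" using YZ(1) by (auto simp: C_def)
  ultimately show ?thesis unfolding hrep_def by blast
qed

text \<open>Locally at a point of \<open>P\<close>, only the walls orthogonal to \<open>m\<close> are visible.\<close>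

definition loc_wall :: "'a::euclidean_space set \<Rightarrow> 'a \<Rightarrow> 'a set \<Rightarrow> 'a \<Rightarrow> bool" where
  "loc_wall V m P z \<longleftrightarrow> (z \<in> P \<longrightarrow> (\<exists>e>0. \<forall>w\<in>V. norm w < e \<longrightarrow>
     (z + w \<in> P \<longleftrightarrow> (z \<in> fc m P \<longrightarrow> m \<bullet> w \<le> 0) \<and> (z \<in> fc (-m) P \<longrightarrow> 0 \<le> m \<bullet> w))))"

lemma finite_eps:
  assumes "finite C" "\<And>c. c \<in> C \<Longrightarrow> \<exists>e>0. \<forall>x::'a::real_normed_vector. norm x < e \<longrightarrow> Q c x"
  shows "\<exists>e>0. \<forall>x. norm x < e \<longrightarrow> (\<forall>c\<in>C. Q c x)"
  using assms
proof (induction C)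
  case empty then show ?case by (auto intro: exI[of _ 1])
next
  case (insert c C)
  then obtain e1 where "e1>0" "\<forall>x. norm x < e1 \<longrightarrow> (\<forall>c\<in>C. Q c x)" by auto
  moreover obtain e2 where "e2>0" "\<forall>x. norm x < e2 \<longrightarrow> Q c x" using insert.prems by blast
  ultimately show ?case by (intro exI[of _ "min e1 e2"]) auto
qed

lemma slack_eps:
  fixes a :: "'a::euclidean_space"
  assumes "a \<bullet> z < b"
  shows "\<exists>e>0. \<forall>w. norm w < e \<longrightarrow> a \<bullet> (z + w) < b"
proof (intro exI[of _ "(b - a \<bullet> z) / (norm a + 1)"] conjI allI impI)
  show "0 < (b - a \<bullet> z) / (norm a + 1)" using assms by (simp add: add_nonneg_pos)
  fix w :: 'a assume "norm w < (b - a \<bullet> z) / (norm a + 1)"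
  then have "norm w * (norm a + 1) < b - a \<bullet> z" by (simp add: pos_less_divide_eq add_nonneg_pos)
  moreover have "a \<bullet> w \<le> norm a * norm w" by (rule norm_cauchy_schwarz)
  ultimately show "a \<bullet> (z + w) < b" using norm_ge_zero[of w] unfolding inner_add_right distrib_left mult_1_right mult.commute[of "norm w" "norm a"] by linarith
qed

text \<open>Constraints that are slack at \<open>z\<close> stay slack nearby, so only the active
  ones decide. Their normals are multiples of \<open>m\<close> by assumption; a positive factor puts
  \<open>z\<close> on \<open>fc m P\<close>, a negative one on \<open>fc (-m) P\<close>, and these
  are the two cases distinguished in \<open>loc_wall\<close>.\<close>

lemma hrep_loc_wall:
  assumes V: "subspace V" and H: "hrep V P C"
    and gen: "\<And>a b. (a,b) \<in> C \<Longrightarrow> a \<bullet> z = b \<Longrightarrow> \<exists>k. a = k *\<^sub>R m"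
  shows "loc_wall V m P z"
  unfolding loc_wall_def
proof
  assume z: "z \<in> P"
  obtain p where P: "P = {x. x - p \<in> V \<and> (\<forall>(a,b)\<in>C. a \<bullet> x \<le> b)}" and fin: "finite C"
    and nz: "\<And>a b. (a,b) \<in> C \<Longrightarrow> a \<noteq> 0"
    using H unfolding hrep_def by auto
  define C0 where "C0 = {c\<in>C. fst c \<bullet> z < snd c}"
  have "finite C0" using fin by (simp add: C0_def)
  then have "\<exists>e>0. \<forall>w. norm w < e \<longrightarrow> (\<forall>c\<in>C0. fst c \<bullet> (z + w) < snd c)"
    by (rule finite_eps) (auto simp: C0_def intro: slack_eps)
  then obtain e where e: "e > 0" "\<And>w c. norm w < e \<Longrightarrow> c\<in>C0 \<Longrightarrow> fst c \<bullet> (z + w) < snd c" by blast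
  have "z + w \<in> P \<longleftrightarrow> (z \<in> fc m P \<longrightarrow> m \<bullet> w \<le> 0) \<and> (z \<in> fc (-m) P \<longrightarrow> 0 \<le> m \<bullet> w)"
    if w: "w \<in> V" "norm w < e" for w
  proof
    assume "z + w \<in> P"
    then show "(z \<in> fc m P \<longrightarrow> m \<bullet> w \<le> 0) \<and> (z \<in> fc (-m) P \<longrightarrow> 0 \<le> m \<bullet> w)"
      by (auto simp: fc_def inner_add_right dest: bspec[of _ _ "z + w"])
  next
    assume A: "(z \<in> fc m P \<longrightarrow> m \<bullet> w \<le> 0) \<and> (z \<in> fc (-m) P \<longrightarrow> 0 \<le> m \<bullet> w)"
    have "a \<bullet> (z + w) \<le> b" if c: "(a,b) \<in> C" for a b
    proof (cases "a \<bullet> z = b")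
      case False
      then have "(a,b) \<in> C0" using z c unfolding P C0_def by force
      then show ?thesis using e(2)[OF w(2)] by fastforce
    next
      case True
      then obtain k where k: "a = k *\<^sub>R m" using gen c by blast
      have all: "a \<bullet> y \<le> a \<bullet> z" if "y \<in> P" for y using that c True unfolding P by auto
      consider "k > 0" | "k < 0" using k nz[OF c] by (cases k "0::real" rule: linorder_cases) auto
      then have "a \<bullet> w \<le> 0"
      proof cases
        case 1
        then have "z \<in> fc m P" using all z by (auto simp: fc_def k)
        then show ?thesis using A 1 by (auto simp: k mult_nonneg_nonpos)
      next
        case 2
        then have "z \<in> fc (-m) P" using all z by (auto simp: fc_def k)
        then show ?thesis using A 2 by (auto simp: k mult_nonpos_nonneg)
      qed
      then show ?thesis using True by (simp add: inner_add_right)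
    qed
    moreover have "z + w - p \<in> V"
    proof -
      have "z - p \<in> V" using z unfolding P by auto
      then have "(z - p) + w \<in> V" using w(1) V subspace_add by blast
      then show ?thesis by (simp add: algebra_simps)
    qed
    ultimately show "z + w \<in> P" unfolding P by auto
  qed
  then show "\<exists>e>0. \<forall>w\<in>V. norm w < e \<longrightarrow> (z + w \<in> P \<longleftrightarrow> (z \<in> fc m P \<longrightarrow> m \<bullet> w \<le> 0) \<and> (z \<in> fc (-m) P \<longrightarrow> 0 \<le> m \<bullet> w))"
    using e(1) by blast
qed

text \<open>From \<open>z\<close> one can move both ways along \<open>m\<close> inside
  \<open>P\<close>, so \<open>z\<close> lies on neither of the two faces and both side conditions
  are void.\<close>

lemma irint_loc_wall:
  assumes V: "subspace V" "m \<in> V" "m \<noteq> 0" and z: "z \<in> irint V P"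
  shows "loc_wall V m P z"
proof -
  obtain e where e: "e > 0" "\<forall>v\<in>V. norm v < e \<longrightarrow> z + v \<in> P" using z by (auto simp: irint_def)
  define h where "h = e / (2 * norm m)"
  have h: "h > 0" using e V by (simp add: h_def)
  have n: "norm (h *\<^sub>R m) < e" using V e by (simp add: h_def)
  have "h *\<^sub>R m \<in> V" "-(h *\<^sub>R m) \<in> V" using subspace_scale[OF V(1,2), of h] subspace_neg[OF V(1)] by simp_all
  then have "z + h *\<^sub>R m \<in> P" "z - h *\<^sub>R m \<in> P" using e n by force+
  moreover have "m \<bullet> (z + h *\<^sub>R m) > m \<bullet> z" "(-m) \<bullet> (z - h *\<^sub>R m) > (-m) \<bullet> z"
    using V(3) h by (simp_all add: inner_add_right inner_diff_right)
  ultimately have "z \<notin> fc m P \<and> z \<notin> fc (-m) P"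
    unfolding fc_def by (metis (mono_tags, lifting) mem_Collect_eq not_le)
  then show ?thesis using e unfolding loc_wall_def by blast
qed

text \<open>The jump of one translate: from a point \<open>z\<close> of \<open>P\<close>, a small
  step along \<open>d\<close> leaves \<open>P\<close> exactly if \<open>z\<close> is on the exit
  face \<open>fc m P\<close>, and a small step back exactly if \<open>z\<close> is on the entry face
  \<open>fc (-m) P\<close>. That a new point still in \<open>P\<close> is relatively interior makes
  both sides good points.\<close>

lemma loc_wall_sides:
  assumes V: "subspace V" "d \<in> V" and d: "m \<bullet> d > 0" and P: "closed P" and lw: "loc_wall V m P z"
  shows "\<exists>e>0. \<forall>h. 0 < h \<and> h < e \<longrightarrow>
    (z + h *\<^sub>R d \<in> P \<longleftrightarrow> z \<in> P \<and> z \<notin> fc m P) \<and> (z - h *\<^sub>R d \<in> P \<longleftrightarrow> z \<in> P \<and> z \<notin> fc (-m) P) \<and>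
    (z + h *\<^sub>R d \<in> P \<longrightarrow> z + h *\<^sub>R d \<in> irint V P) \<and> (z - h *\<^sub>R d \<in> P \<longrightarrow> z - h *\<^sub>R d \<in> irint V P)"
proof (cases "z \<in> P")
  case False
  then have "z \<in> - P" "open (-P)" using P by auto
  then obtain e where e: "e > 0" "ball z e \<subseteq> - P" using openE by blast
  have nd: "norm d > 0" using d by auto
  have A: "z + h *\<^sub>R d \<notin> P \<and> z - h *\<^sub>R d \<notin> P" if "0 < h" "h < e / norm d" for h
  proof -
    have "norm (h *\<^sub>R d) < e" using that nd by (simp add: pos_less_divide_eq)
    then have "z + h *\<^sub>R d \<in> ball z e" "z - h *\<^sub>R d \<in> ball z e" by (simp_all add: dist_norm)
    then show ?thesis using e by blast
  qed
  show ?thesis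
    by (intro exI[of _ "e / norm d"]) (use A e nd False in auto)
next
  case True
  then obtain e where e: "e > 0" and K: "\<And>w. w \<in> V \<Longrightarrow> norm w < e \<Longrightarrow>
     (z + w \<in> P \<longleftrightarrow> (z \<in> fc m P \<longrightarrow> m \<bullet> w \<le> 0) \<and> (z \<in> fc (-m) P \<longrightarrow> 0 \<le> m \<bullet> w))"
    using lw unfolding loc_wall_def by blast
  have nd: "norm d > 0" using d by auto
  \<comment> \<open>Off the wall the side conditions are strict, hence open, and so persist for all
    small displacements \<open>v\<close> in \<open>V\<close>.\<close>
  have inr: "z + w \<in> irint V P" if w: "w \<in> V" "norm w < e" "z \<in> fc m P \<Longrightarrow> m \<bullet> w < 0" "z \<in> fc (-m) P \<Longrightarrow> 0 < m \<bullet> w" for w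
  proof -
    have zw: "z + w \<in> P" using K[OF w(1,2)] w(3,4) by fastforce
    have o: "open {v. norm (w + v) < e \<and> (z \<in> fc m P \<longrightarrow> m \<bullet> (w + v) < 0) \<and> (z \<in> fc (-m) P \<longrightarrow> 0 < m \<bullet> (w + v))}"
      (is "open ?O")
    proof -
      have "?O = {v. norm (w + v) < e} \<inter> (if z \<in> fc m P then {v. m \<bullet> (w+v) < 0} else UNIV) \<inter> (if z \<in> fc (-m) P then {v. 0 < m \<bullet> (w+v)} else UNIV)"
        by auto
      then show ?thesis by (auto intro!: open_Int open_Collect_less continuous_intros)
    qed
    have "0 \<in> ?O" using w by auto
    with o obtain r where r: "r > 0" "ball 0 r \<subseteq> ?O" using openE by blast
    have "z + w + v \<in> P" if v: "v \<in> V" "norm v < r" for v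
    proof -
      have "v \<in> ?O" using r v by auto
      moreover have "w + v \<in> V" using w v V subspace_add by blast
      ultimately have "z + (w + v) \<in> P" using K[of "w + v"] by fastforce
      then show ?thesis by (simp add: algebra_simps)
    qed
    then show ?thesis using zw r(1) unfolding irint_def by blast
  qed
  show ?thesis
  proof (intro exI[of _ "e / norm d"] conjI allI impI)
    show "e / norm d > 0" using e nd by simp
    fix h assume h: "0 < h \<and> h < e / norm d"
    have n: "norm (h *\<^sub>R d) < e" "norm (- (h *\<^sub>R d)) < e" using h nd by (auto simp: pos_less_divide_eq)
    have v: "h *\<^sub>R d \<in> V" "- (h *\<^sub>R d) \<in> V" using subspace_scale[OF V(1,2), of h] subspace_neg[OF V(1)] by simp_all
    have s: "m \<bullet> (h *\<^sub>R d) > 0" "m \<bullet> (- (h *\<^sub>R d)) < 0" using h d by auto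
    show 1: "(z + h *\<^sub>R d \<in> P) = (z \<in> P \<and> z \<notin> fc m P)"
      using K[OF v(1) n(1)] s True by auto
    show 2: "(z - h *\<^sub>R d \<in> P) = (z \<in> P \<and> z \<notin> fc (-m) P)"
      using K[OF v(2) n(2)] s True by auto
    show "z + h *\<^sub>R d \<in> irint V P" if "z + h *\<^sub>R d \<in> P"
      using inr[OF v(1) n(1)] that 1 s by auto
    show "z - h *\<^sub>R d \<in> irint V P" if "z - h *\<^sub>R d \<in> P"
      using inr[OF v(2) n(2)] that 2 s by auto
  qed
qed

text \<open>Displacements in \<open>V\<close> orthogonal to \<open>m\<close> satisfy both side
  conditions, so small ones stay in \<open>P\<close> and on the face.\<close>

lemma loc_wall_irint_fc:
  assumes lw: "loc_wall V m P z" and z: "z \<in> fc m P"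
  shows "z \<in> irint (perp V m) (fc m P)"
proof -
  have zP: "z \<in> P" using z by (auto simp: fc_def)
  then obtain e where e: "e > 0" and K: "\<And>w. w \<in> V \<Longrightarrow> norm w < e \<Longrightarrow>
     (z + w \<in> P \<longleftrightarrow> (z \<in> fc m P \<longrightarrow> m \<bullet> w \<le> 0) \<and> (z \<in> fc (-m) P \<longrightarrow> 0 \<le> m \<bullet> w))"
    using lw unfolding loc_wall_def by blast
  have "z + w \<in> fc m P" if "w \<in> perp V m" "norm w < e" for w
  proof -
    have "z + w \<in> P" using K[of w] that by (auto simp: perp_def)
    then show ?thesis using z that by (auto simp: fc_def perp_def inner_add_right)
  qed
  then show ?thesis using e z unfolding irint_def by blast
qed

lemma loc_wall_uminus: "loc_wall V (-m) P z \<longleftrightarrow> loc_wall V m P z"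
  by (auto simp: loc_wall_def)

text \<open>The subspace is closed, hence a Baire space, and each condition removes a relatively
  closed, nowhere dense set because \<open>w\<close> is not orthogonal to \<open>V\<close>. Category
  works in every carrier space alike, without choosing a measure on it.\<close>

lemma generic_in_subspace:
  fixes V :: "'a::euclidean_space set"
  assumes V: "subspace V" and Q: "countable Q"
    and nt: "\<And>w \<gamma>. (w,\<gamma>) \<in> Q \<Longrightarrow> \<exists>u\<in>V. w \<bullet> u \<noteq> 0"
    and v: "v \<in> V" and e: "e > 0"
  shows "\<exists>v'\<in>V. norm (v' - v) < e \<and> (\<forall>(w,\<gamma>)\<in>Q. w \<bullet> v' \<noteq> \<gamma>)"
proof -
  define G where "G = (\<lambda>(w,\<gamma>). {x\<in>V. w \<bullet> x \<noteq> \<gamma>}) ` Q"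
  have cl: "closed V" by (rule closed_subspace[OF V])
  have "V \<subseteq> closure (\<Inter>G)"
  proof (rule Baire[OF cl])
    show "countable G" unfolding G_def using Q by simp
    fix T assume "T \<in> G"
    then obtain w \<gamma> where q: "(w,\<gamma>) \<in> Q" and T: "T = {x\<in>V. w \<bullet> x \<noteq> \<gamma>}" by (auto simp: G_def)
    have "T = V \<inter> {x. w \<bullet> x \<noteq> \<gamma>}" using T by auto
    moreover have "open {x. w \<bullet> x \<noteq> \<gamma>}" by (intro open_Collect_neq continuous_intros)
    ultimately have 1: "openin (top_of_set V) T" by (simp add: openin_open_Int)
    obtain u where u: "u \<in> V" "w \<bullet> u \<noteq> 0" using nt q by blast
    have "x \<in> closure T" if x: "x \<in> V" for x
      unfolding closure_approachable
    proof (intro allI impI)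
      fix d :: real assume d: "d > 0"
      define h where "h = d / (2 * (norm u + 1))"
      have h: "h > 0" "h * norm u < d"
      proof -
        have np: "2 * (norm u + 1) > 0" by (simp add: add_nonneg_pos)
        then show "h > 0" using d by (simp add: h_def)
        have "norm u < 2 * (norm u + 1)" using norm_ge_zero[of u] by (smt (verit))
        then have "d * norm u < d * (2 * (norm u + 1))" using d by (rule mult_strict_left_mono)
        then show "h * norm u < d" using np unfolding h_def by (simp add: pos_divide_less_eq)
      qed
      show "\<exists>y\<in>T. dist y x < d"
      proof (cases "w \<bullet> x = \<gamma>")
        case False
        then show ?thesis using x d T by (intro bexI[of _ x]) auto
      next
        case True
        have "x + h *\<^sub>R u \<in> V" using x u V by (simp add: subspace_add subspace_scale)
        moreover have "w \<bullet> (x + h *\<^sub>R u) \<noteq> \<gamma>" using True u h by (simp add: inner_add_right)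
        moreover have "dist (x + h *\<^sub>R u) x < d" using h by (simp add: dist_norm)
        ultimately show ?thesis using T by blast
      qed
    qed
    then show "openin (top_of_set V) T \<and> V \<subseteq> closure T" using 1 by blast
  qed
  then have "v \<in> closure (\<Inter>G \<inter> V)"
  proof (cases "G = {}")
    case True then show ?thesis using v closure_subset by auto
  next
    case False
    then have "\<Inter>G \<subseteq> V" by (auto simp: G_def)
    then show ?thesis using \<open>V \<subseteq> closure (\<Inter>G)\<close> v by (auto simp: Int_absorb2)
  qed
  then obtain v' where "v' \<in> \<Inter>G \<inter> V" "dist v' v < e" using e unfolding closure_approachable by blast
  then show ?thesis by (auto simp: G_def dist_norm intro!: bexI[of _ v'])
qed

text \<open>The sign is that of minus the jump: a point moving in direction \<open>m\<close> leaves
  \<open>P\<close> through \<open>fc m P\<close> and enters it through \<open>fc (-m) P\<close>. A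
  list, not a set, because coinciding faces must be counted with multiplicity.\<close>

definition bdry :: "'a::euclidean_space \<Rightarrow> (int \<times> 'a set) list \<Rightarrow> (int \<times> 'a set) list" where
  "bdry m fam = concat (map (\<lambda>(c,P). [(c, fc m P), (-c, fc (-m) P)]) fam)"

definition vfam :: "'a::euclidean_space set \<Rightarrow> (int \<times> 'a set) list \<Rightarrow> bool" where
  "vfam V fam \<longleftrightarrow> (\<forall>(c,P)\<in>set fam. vpoly V P)"

lemma bdry_Nil [simp]: "bdry m [] = []" and
  bdry_Cons [simp]: "bdry m ((c,P) # fam) = (c, fc m P) # (-c, fc (-m) P) # bdry m fam"
  by (auto simp: bdry_def)

lemma vfam_Cons: "vfam V ((c,P) # fam) \<longleftrightarrow> vpoly V P \<and> vfam V fam" and vfam_Nil [simp]: "vfam V []"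
  by (auto simp: vfam_def)

lemma perp_uminus [simp]: "perp V (-m) = perp V m"
  by (auto simp: perp_def)

lemma vfam_bdry: "vfam V fam \<Longrightarrow> vfam (perp V m) (bdry m fam)"
proof (induction fam)
  case (Cons a fam)
  then show ?case using vpoly_fc[of V "snd a" m] vpoly_fc[of V "snd a" "-m"]
    by (cases a) (auto simp: vfam_Cons)
qed simp

section \<open>Signed counts of translates and their jumps\<close>

text \<open>Discreteness in this form makes all counts of bounded sets finite and the collection of
  translated walls countable.\<close>

locale discrete_subgroup =
  fixes L :: "'a::euclidean_space set"
  assumes zero_mem: "0 \<in> L" and diff_mem: "x \<in> L \<Longrightarrow> y \<in> L \<Longrightarrow> x - y \<in> L"
    and finite_cball: "finite (L \<inter> cball 0 r)"
begin

lemma uminus_mem: "x \<in> L \<Longrightarrow> - x \<in> L"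
  using diff_mem[OF zero_mem] by force

lemma add_mem: "x \<in> L \<Longrightarrow> y \<in> L \<Longrightarrow> x + y \<in> L"
  using diff_mem[of x "-y"] uminus_mem by auto

lemma countable_L: "countable L"
proof -
  have "L = (\<Union>n. L \<inter> cball 0 (real n))"
    using real_arch_simple by (auto simp: set_eq_iff)
  also have "countable \<dots>" by (intro countable_UN countable_finite finite_cball countableI_type)
  finally show ?thesis .
qed

lemma finite_bounded: assumes "bounded S" shows "finite {l\<in>L. x - l \<in> S}"
proof -
  obtain b where b: "\<And>s. s\<in>S \<Longrightarrow> norm s \<le> b" using assms bounded_iff by metis
  have "{l\<in>L. x - l \<in> S} \<subseteq> L \<inter> cball 0 (norm x + b)"
  proof clarsimp
    fix l assume "l\<in>L" "x - l \<in> S"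
    then have "norm (x - l) \<le> b" using b by blast
    moreover have "norm l \<le> norm x + norm (x - l)" using norm_triangle_ineq4[of x "x - l"] by simp
    ultimately show "norm l \<le> norm x + b" by simp
  qed
  then show ?thesis using finite_cball finite_subset by blast
qed

definition cnt :: "'a set \<Rightarrow> 'a \<Rightarrow> nat" where
  "cnt P x = card {l\<in>L. x - l \<in> P}"

definition mult :: "(int \<times> 'a set) list \<Rightarrow> 'a \<Rightarrow> int" where
  "mult fam x = (\<Sum>(c,P)\<leftarrow>fam. c * int (cnt P x))"

text \<open>The points avoiding the relative boundaries of all translates; translates of members of lower
  dimension than \<open>V\<close> are avoided altogether.\<close>

definition good :: "'a set \<Rightarrow> (int \<times> 'a set) list \<Rightarrow> 'a set" where
  "good V fam = {x. \<forall>(c,P)\<in>set fam. \<forall>l\<in>L. x - l \<in> P \<longrightarrow> x - l \<in> irint V P}"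

lemma mult_Nil [simp]: "mult [] x = 0" and
  mult_Cons [simp]: "mult ((c,P) # fam) x = c * int (cnt P x) + mult fam x"
  by (auto simp: mult_def)

lemma good_Nil [simp]: "good V [] = UNIV" and
  good_Cons: "good V ((c,P) # fam) = {x. \<forall>l\<in>L. x - l \<in> P \<longrightarrow> x - l \<in> irint V P} \<inter> good V fam"
  by (auto simp: good_def)

text \<open>A single finite index set that serves all points within distance 1 of \<open>z\<close>,
  so that counts at \<open>z\<close> and at nearby points become sums over the same
  translations.\<close>

definition near :: "'a \<Rightarrow> 'a set \<Rightarrow> 'a set" where
  "near z P = {l\<in>L. \<exists>y. dist z y \<le> 1 \<and> y - l \<in> P}"

lemma finite_near: assumes "bounded P" shows "finite (near z P)"
proof -
  obtain b where b: "\<And>s. s\<in>P \<Longrightarrow> norm s \<le> b" using assms bounded_iff by metis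
  have "near z P \<subseteq> {l\<in>L. z - l \<in> cball 0 (b+1)}"
  proof (clarsimp simp: near_def)
    fix l y assume A: "dist z y \<le> 1" "y - l \<in> P"
    have "norm (z - l) \<le> norm (z - y) + norm (y - l)" using norm_triangle_ineq[of "z - y" "y - l"] by simp
    then show "norm (z - l) \<le> b + 1" using b[OF A(2)] A(1) by (simp add: dist_norm)
  qed
  then show ?thesis using finite_bounded[of "cball 0 (b+1)" z] finite_subset by blast
qed

lemma cnt_near: assumes "bounded P" "dist z y \<le> 1"
  shows "int (cnt P y) = (\<Sum>l\<in>near z P. of_bool (y - l \<in> P))"
proof -
  have "{l\<in>L. y - l \<in> P} = {l\<in>near z P. y - l \<in> P}" using assms(2) by (auto simp: near_def)
  then show ?thesis unfolding cnt_def using finite_near[OF assms(1)] by (simp add: sum.If_cases of_bool_def Int_def)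
qed

text \<open>Any two translations whose copies of \<open>P\<close> contain \<open>x\<close> differ by
  a lattice vector of norm at most \<open>2 * b\<close>; fixing one of them bounds their number
  independently of \<open>x\<close>.\<close>

lemma cnt_bound: assumes "bounded P" shows "\<exists>N. \<forall>x. cnt P x \<le> N"
proof -
  obtain b where b: "\<And>s. s\<in>P \<Longrightarrow> norm s \<le> b" using assms bounded_iff by metis
  have "cnt P x \<le> card (L \<inter> cball 0 (2*b))" for x
  proof (cases "{l\<in>L. x - l \<in> P} = {}")
    case True then show ?thesis by (simp only: cnt_def card.empty)
  next
    case False
    then obtain l0 where l0: "l0\<in>L" "x - l0\<in>P" by blast
    have "(\<lambda>l. l - l0) ` {l\<in>L. x - l \<in> P} \<subseteq> L \<inter> cball 0 (2*b)"
    proof (rule image_subsetI)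
      fix l assume "l \<in> {l\<in>L. x - l \<in> P}"
      then have l: "l\<in>L" "x - l \<in> P" by auto
      have "norm ((x - l0) - (x - l)) \<le> norm (x - l0) + norm (x - l)" by (rule norm_triangle_ineq4)
      then have "norm (l - l0) \<le> 2*b" using b[OF l(2)] b[OF l0(2)] by simp
      then show "l - l0 \<in> L \<inter> cball 0 (2*b)" using diff_mem l l0 by auto
    qed
    then have "card ((\<lambda>l. l - l0) ` {l\<in>L. x - l \<in> P}) \<le> card (L \<inter> cball 0 (2*b))"
      by (intro card_mono finite_cball)
    moreover have "card ((\<lambda>l. l - l0) ` {l\<in>L. x - l \<in> P}) = cnt P x"
      unfolding cnt_def by (intro card_image) (auto simp: inj_on_def)
    ultimately show ?thesis by simp
  qed
  then show ?thesis by blast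
qed

lemma cnt_translate_L: assumes "l \<in> L" shows "cnt P (x - l) = cnt P x"
proof -
  have "bij_betw (\<lambda>k. k + l) {k\<in>L. x - l - k \<in> P} {k\<in>L. x - k \<in> P}"
    by (rule bij_betw_byWitness[where f'="\<lambda>k. k - l"])
      (use assms add_mem diff_mem in \<open>auto simp: algebra_simps diff_diff_eq\<close>)
  then show ?thesis unfolding cnt_def by (rule bij_betw_same_card)
qed

lemma cnt_translate: "cnt ((+) t ` P) x = cnt P (x - t)"
proof -
  have "x - l \<in> (+) t ` P \<longleftrightarrow> x - t - l \<in> P" for l
    by (auto simp: image_iff algebra_simps intro!: bexI[of _ "x - t - l"])
  then show ?thesis by (simp add: cnt_def)
qed

text \<open>Only finitely many translates come near \<open>x\<close>; those containing
  \<open>x\<close> contain a neighbourhood of it relative to \<open>V\<close>, the others stay away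
  by closedness.\<close>

lemma good_local:
  assumes V: "subspace V" and fam: "vfam V fam" and x: "x \<in> good V fam"
  shows "\<exists>e>0. \<forall>v. norm v < e \<longrightarrow> v\<in>V \<longrightarrow> x + v \<in> good V fam \<and> mult fam (x + v) = mult fam x"
  using fam x
proof (induction fam)
  case Nil then show ?case by (auto intro: exI[of _ 1])
next
  case (Cons cP fam)
  obtain c P where cP: "cP = (c,P)" by force
  have vp: "vpoly V P" and fam: "vfam V fam" using Cons.prems by (auto simp: cP vfam_Cons)
  have xg: "x \<in> good V fam" and xP: "\<And>l. l \<in>L \<Longrightarrow> x - l \<in> P \<Longrightarrow> x - l \<in> irint V P" using Cons.prems by (auto simp: cP good_Cons)
  have bP: "bounded P" and cl: "closed P" using vp by (auto simp: vpoly_def polytope_imp_bounded polytope_imp_closed)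
  obtain e1 where e1: "e1>0" "\<And>v. norm v < e1 \<Longrightarrow> v\<in>V \<Longrightarrow> x + v \<in> good V fam \<and> mult fam (x + v) = mult fam x"
    using Cons.IH[OF fam xg] by blast
  have "\<exists>e>0. \<forall>v. norm v < e \<longrightarrow> (\<forall>l\<in>near x P. v\<in>V \<longrightarrow> (x + v - l \<in> P \<longleftrightarrow> x - l \<in> P) \<and> (x - l \<in> P \<longrightarrow> x + v - l \<in> irint V P))"
  proof (rule finite_eps[OF finite_near[OF bP]])
    fix l assume "l \<in> near x P"
    then have l: "l\<in>L" by (simp add: near_def)
    show "\<exists>e>0. \<forall>v. norm v < e \<longrightarrow> v\<in>V \<longrightarrow> (x + v - l \<in> P \<longleftrightarrow> x - l \<in> P) \<and> (x - l \<in> P \<longrightarrow> x + v - l \<in> irint V P)"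
    proof (cases "x - l \<in> P")
      case True
      then obtain e where e: "e>0" "\<And>v. v\<in>V \<Longrightarrow> norm v < e \<Longrightarrow> x - l + v \<in> P" using xP[OF l] unfolding irint_def by blast
      have "x + v - l \<in> irint V P" if v: "norm v < e/2" "v\<in>V" for v
      proof -
        have "x + v - l + w \<in> P" if "w\<in>V" "norm w < e/2" for w
        proof -
          have "norm (v + w) < e" using norm_triangle_ineq[of v w] v that by linarith
          moreover have "v + w \<in> V" using v that V subspace_add by blast
          ultimately show ?thesis using e(2)[of "v+w"] by (simp add: algebra_simps)
        qed
        moreover have "x + v - l \<in> P" using e(2)[of v] v e(1) by (simp add: algebra_simps)
        ultimately show ?thesis unfolding irint_def using e(1) by (auto intro!: exI[of _ "e/2"])
      qed
      then show ?thesis using e(1) True by (intro exI[of _ "e/2"]) (auto simp: irint_def)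
    next
      case False
      then have "x - l \<in> - P" "open (-P)" using cl by auto
      then obtain e where e: "e > 0" "ball (x - l) e \<subseteq> - P" using openE by blast
      have "x + v - l \<notin> P" if "norm v < e" for v
      proof -
        have "x + v - l \<in> ball (x - l) e" using that by (simp add: dist_norm)
        then show ?thesis using e by blast
      qed
      then show ?thesis using e(1) False by blast
    qed
  qed
  then obtain e2 where e2: "e2>0" "\<And>v l. norm v < e2 \<Longrightarrow> l\<in>near x P \<Longrightarrow> v\<in>V \<Longrightarrow> (x + v - l \<in> P \<longleftrightarrow> x - l \<in> P) \<and> (x - l \<in> P \<longrightarrow> x + v - l \<in> irint V P)"
    by blast
  show ?case
  proof (intro exI[of _ "min (min e1 e2) 1"] conjI allI impI)
    show "min (min e1 e2) 1 > 0" using e1(1) e2(1) by simp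
    fix v assume v: "norm v < min (min e1 e2) 1" "v\<in>V"
    have d: "dist x (x+v) \<le> 1" using v by (simp add: dist_norm)
    have d0: "dist x x \<le> 1" by simp
    have "int (cnt P (x+v)) = int (cnt P x)"
      unfolding cnt_near[OF bP d] cnt_near[OF bP d0] using e2(2)[of v] v by (intro sum.cong) auto
    then show "mult (cP # fam) (x + v) = mult (cP # fam) x"
      using e1(2)[of v] v by (simp add: cP)
    have "x + v - l \<in> irint V P" if "l\<in>L" "x + v - l \<in> P" for l
    proof -
      have "l \<in> near x P" using that d by (auto simp: near_def)
      then show ?thesis using e2(2)[of v l] v that by auto
    qed
    then show "x + v \<in> good V (cP # fam)" using e1(2)[of v] v by (auto simp: cP good_Cons)
  qed
qed

definition walled :: "'a set \<Rightarrow> 'a \<Rightarrow> (int \<times> 'a set) list \<Rightarrow> 'a \<Rightarrow> bool" where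
  "walled V m fam z \<longleftrightarrow> (\<forall>(c,P)\<in>set fam. \<forall>l\<in>L. loc_wall V m P (z - l))"

text \<open>The one-translate jumps summed over the family: the count beyond \<open>z\<close>
  differs from the count before \<open>z\<close> by minus the boundary count, whatever transversal
  direction \<open>d\<close> is used. This freedom lets one formula serve both steps along the
  normal and steps along a generic segment.\<close>

lemma walled_sides:
  assumes V: "subspace V" "d \<in> V" and d: "m \<bullet> d > 0" and fam: "vfam V fam" and w: "walled V m fam z"
  shows "\<exists>e>0. \<exists>a b. a - b = - mult (bdry m fam) z \<and> (\<forall>h. 0 < h \<and> h < e \<longrightarrow>
      mult fam (z + h *\<^sub>R d) = a \<and> mult fam (z - h *\<^sub>R d) = b \<and>
      z + h *\<^sub>R d \<in> good V fam \<and> z - h *\<^sub>R d \<in> good V fam)"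
  using fam w
proof (induction fam)
  case Nil then show ?case by (auto intro!: exI[of _ 1])
next
  case (Cons cP fam)
  obtain c P where cP: "cP = (c,P)" by force
  have vp: "vpoly V P" and fam: "vfam V fam" using Cons.prems by (auto simp: cP vfam_Cons)
  have wf: "walled V m fam z" and wP: "\<And>l. l\<in>L \<Longrightarrow> loc_wall V m P (z - l)" using Cons.prems by (auto simp: walled_def cP)
  have bP: "bounded P" and cl: "closed P" using vp by (auto simp: vpoly_def polytope_imp_bounded polytope_imp_closed)
  have nd: "norm d > 0" using d by auto
  obtain e1 a b where e1: "e1>0" "a - b = - mult (bdry m fam) z" "\<And>h. 0 < h \<Longrightarrow> h < e1 \<Longrightarrow>
      mult fam (z + h *\<^sub>R d) = a \<and> mult fam (z - h *\<^sub>R d) = b \<and>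
      z + h *\<^sub>R d \<in> good V fam \<and> z - h *\<^sub>R d \<in> good V fam"
    using Cons.IH[OF fam wf] by blast
  define Q where "Q l h \<longleftrightarrow> (0 < h \<longrightarrow>
    (z + h *\<^sub>R d - l \<in> P \<longleftrightarrow> z - l \<in> P \<and> z - l \<notin> fc m P) \<and> (z - h *\<^sub>R d - l \<in> P \<longleftrightarrow> z - l \<in> P \<and> z - l \<notin> fc (-m) P) \<and>
    (z + h *\<^sub>R d - l \<in> P \<longrightarrow> z + h *\<^sub>R d - l \<in> irint V P) \<and> (z - h *\<^sub>R d - l \<in> P \<longrightarrow> z - h *\<^sub>R d - l \<in> irint V P))" for l and h::real
  have "\<exists>e>0. \<forall>h::real. norm h < e \<longrightarrow> (\<forall>l\<in>near z P. Q l h)"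
  proof (rule finite_eps[OF finite_near[OF bP]])
    fix l assume "l \<in> near z P"
    then have l: "l\<in>L" by (simp add: near_def)
    have e: "z - l + h *\<^sub>R d = z + h *\<^sub>R d - l" "z - l - h *\<^sub>R d = z - h *\<^sub>R d - l" for h by auto
    obtain e where "e>0" and "\<And>h. 0 < h \<and> h < e \<Longrightarrow> Q l h"
      using loc_wall_sides[OF V d cl wP[OF l]] unfolding e Q_def by blast
    then show "\<exists>e>0. \<forall>h::real. norm h < e \<longrightarrow> Q l h"
      by (intro exI[of _ e]) (force simp: Q_def)
  qed
  then obtain e2 where e2: "e2>0" "\<And>h l. norm h < e2 \<Longrightarrow> l\<in>near z P \<Longrightarrow> Q l h" by blast
  \<comment> \<open>Number of translates containing the points just beyond \<open>z\<close>: those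
    containing \<open>z\<close>, except where \<open>z\<close> is on the exit face. In the same way
    \<open>b'\<close> counts those containing the points just before \<open>z\<close>.\<close>
  define a' where "a' = (\<Sum>l\<in>near z P. (of_bool (z - l \<in> P \<and> z - l \<notin> fc m P)::int))"
  define b' where "b' = (\<Sum>l\<in>near z P. (of_bool (z - l \<in> P \<and> z - l \<notin> fc (-m) P)::int))"
  have bf: "bounded (fc m P)" for m using bP fc_subset bounded_subset by blast
  have cf: "int (cnt (fc m P) z) = (\<Sum>l\<in>near z P. of_bool (z - l \<in> fc m P))" for m
  proof -
    have "int (cnt (fc m P) z) = (\<Sum>l\<in>near z (fc m P). of_bool (z - l \<in> fc m P))" using cnt_near[OF bf, of z z] by simp
    also have "\<dots> = (\<Sum>l\<in>near z P. of_bool (z - l \<in> fc m P))"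
      by (rule sum.mono_neutral_left) (use finite_near[OF bP] in \<open>auto simp: near_def fc_def intro: exI[of _ z]\<close>)
    finally show ?thesis .
  qed
  have ab': "a' - b' = int (cnt (fc (-m) P) z) - int (cnt (fc m P) z)"
    unfolding a'_def b'_def cf sum_subtractf[symmetric] by (intro sum.cong) (auto simp: fc_def)
  have "\<exists>e>0. c*a' + a - (c*b' + b) = - mult (bdry m (cP # fam)) z \<and> (\<forall>h. 0 < h \<and> h < e \<longrightarrow>
      mult (cP # fam) (z + h *\<^sub>R d) = c*a' + a \<and> mult (cP # fam) (z - h *\<^sub>R d) = c*b' + b \<and>
      z + h *\<^sub>R d \<in> good V (cP # fam) \<and> z - h *\<^sub>R d \<in> good V (cP # fam))"
  proof (intro exI[of _ "Min {e1,e2,1/norm d}"] conjI allI impI)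
    show "Min {e1,e2,1/norm d} > 0" using e1(1) e2(1) nd by simp
    have "c * a' + a - (c * b' + b) = c * (a' - b') + (a - b)" by (simp add: algebra_simps)
    then show "c * a' + a - (c * b' + b) = - mult (bdry m (cP # fam)) z"
      unfolding ab' e1(2) by (simp add: cP algebra_simps)
    fix h assume h: "0 < h \<and> h < Min {e1,e2,1/norm d}"
    have hh: "norm (h *\<^sub>R d) < 1" using h nd by (simp add: pos_less_divide_eq)
    then have d1: "dist z (z + h *\<^sub>R d) \<le> 1" "dist z (z - h *\<^sub>R d) \<le> 1" by (auto simp: dist_norm)
    have Q: "Q l h" if "l\<in>near z P" for l using e2(2)[of h l] h that by simp
    have "int (cnt P (z + h *\<^sub>R d)) = a'"
      unfolding cnt_near[OF bP d1(1)] a'_def using Q h by (intro sum.cong) (auto simp: Q_def)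
    then show "mult (cP # fam) (z + h *\<^sub>R d) = c*a' + a" using e1(3)[of h] h by (simp add: cP)
    have "int (cnt P (z - h *\<^sub>R d)) = b'"
      unfolding cnt_near[OF bP d1(2)] b'_def using Q h by (intro sum.cong) (auto simp: Q_def)
    then show "mult (cP # fam) (z - h *\<^sub>R d) = c*b' + b" using e1(3)[of h] h by (simp add: cP)
    have "z + h *\<^sub>R d - l \<in> irint V P" if "l\<in>L" "z + h *\<^sub>R d - l \<in> P" for l
    proof -
      have "l \<in> near z P" using that d1 unfolding near_def by blast
      then show ?thesis using Q[of l] h that by (auto simp: Q_def)
    qed
    then show "z + h *\<^sub>R d \<in> good V (cP # fam)" using e1(3)[of h] h by (auto simp: cP good_Cons)
    have "z - h *\<^sub>R d - l \<in> irint V P" if "l\<in>L" "z - h *\<^sub>R d - l \<in> P" for l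
    proof -
      have "l \<in> near z P" using that d1 unfolding near_def by blast
      then show ?thesis using Q[of l] h that by (auto simp: Q_def)
    qed
    then show "z - h *\<^sub>R d \<in> good V (cP # fam)" using e1(3)[of h] h by (auto simp: cP good_Cons)
  qed
  then show ?case by blast
qed

text \<open>Where the jump formula applies, the point is good for the boundary family, so that
  assumptions of the form \<open>null_on\<close> can be used there.\<close>

lemma walled_good_bdry:
  assumes "walled V m fam z" shows "z \<in> good (perp V m) (bdry m fam)"
proof -
  have "z - l \<in> irint (perp V m) (fc m P)" if "(c,P)\<in>set fam" "l\<in>L" "z - l \<in> fc m P" for c P l
    using that assms loc_wall_irint_fc unfolding walled_def by blast
  moreover have "z - l \<in> irint (perp V m) (fc (-m) P)" if "(c,P)\<in>set fam" "l\<in>L" "z - l \<in> fc (-m) P" for c P l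
  proof -
    have "loc_wall V (-m) P (z - l)" using that assms unfolding walled_def loc_wall_uminus by blast
    then show ?thesis using loc_wall_irint_fc[of V "-m" P "z - l"] that by simp
  qed
  ultimately show ?thesis by (auto simp: good_def bdry_def)
qed

text \<open>The walls of all translates as seen from the base point \<open>x\<close>: the displaced
  point \<open>x + w\<close> lies on the hyperplane of the wall encoded by
  \<open>(a,\<beta>)\<close> iff \<open>a \<bullet> w = \<beta>\<close>. In this form avoiding walls
  is a countable list of linear conditions on the displacement.\<close>

definition walls :: "'a set \<Rightarrow> ('a set \<Rightarrow> ('a \<times> real) set) \<Rightarrow> (int \<times> 'a set) list \<Rightarrow> 'a \<Rightarrow> ('a \<times> real) set" where
  "walls V C fam x = (\<Union>(c,P)\<in>set fam. \<Union>l\<in>L. (\<lambda>(a,b). (a, b - a \<bullet> (x - l))) ` C P)"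

definition hreps :: "'a set \<Rightarrow> ('a set \<Rightarrow> ('a \<times> real) set) \<Rightarrow> (int \<times> 'a set) list \<Rightarrow> bool" where
  "hreps V C fam \<longleftrightarrow> (\<forall>(c,P)\<in>set fam. hrep V P (C P))"

lemma walls_ex:
  assumes "subspace V" "vfam V fam"
  obtains C where "hreps V C fam"
proof -
  have "\<forall>P. \<exists>C. vpoly V P \<longrightarrow> hrep V P C" using hrep_exists[OF assms(1)] by blast
  then obtain C where "\<And>P. vpoly V P \<Longrightarrow> hrep V P (C P)" by metis
  then show ?thesis using assms(2) that[of C] unfolding vfam_def hreps_def by blast
qed

lemma walls_props:
  assumes "hreps V C fam"
  shows "countable (walls V C fam x)" "(a,\<beta>) \<in> walls V C fam x \<Longrightarrow> a \<in> V \<and> a \<noteq> 0"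
proof -
  have "finite (C P)" if "(c,P)\<in>set fam" for c P using assms that by (auto simp: hrep_def hreps_def)
  then show "countable (walls V C fam x)"
  proof -
    assume f: "\<And>c P. (c,P)\<in>set fam \<Longrightarrow> finite (C P)"
    have "walls V C fam x = (\<Union>cP\<in>set fam. \<Union>l\<in>L. (\<lambda>(a,b). (a, b - a \<bullet> (x - l))) ` C (snd cP))"
      by (auto simp: walls_def case_prod_beta)
    also have "countable \<dots>"
      by (intro countable_UN countable_L countable_image countable_finite finite_set) (use f in auto)
    finally show ?thesis .
  qed
  show "(a,\<beta>) \<in> walls V C fam x \<Longrightarrow> a \<in> V \<and> a \<noteq> 0"
    using assms unfolding walls_def hrep_def hreps_def by fastforce
qed

lemma walls_walled:
  assumes V: "subspace V" and C: "hreps V C fam"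
    and gen: "\<And>a \<beta>. (a,\<beta>) \<in> walls V C fam x \<Longrightarrow> a \<bullet> w = \<beta> \<Longrightarrow> \<exists>k. a = k *\<^sub>R m"
  shows "walled V m fam (x + w)"
  unfolding walled_def
proof clarify
  fix c P l assume cP: "(c,P) \<in> set fam" and l: "l\<in>L"
  show "loc_wall V m P (x + w - l)"
  proof (rule hrep_loc_wall[OF V])
    show "hrep V P (C P)" using C cP by (auto simp: hreps_def)
    fix a b assume ab: "(a,b) \<in> C P" "a \<bullet> (x + w - l) = b"
    have "(a, b - a \<bullet> (x - l)) \<in> walls V C fam x" using cP l ab(1) unfolding walls_def by fastforce
    moreover have "a \<bullet> w = b - a \<bullet> (x - l)" using ab(2) by (simp add: inner_add_right inner_diff_right algebra_simps)
    ultimately show "\<exists>k. a = k *\<^sub>R m" using gen by blast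
  qed
qed

lemma walls_good:
  assumes V: "subspace V" and C: "hreps V C fam"
    and gen: "\<And>a \<beta>. (a,\<beta>) \<in> walls V C fam x \<Longrightarrow> a \<bullet> w \<noteq> \<beta>"
  shows "x + w \<in> good V fam"
  unfolding good_def
proof clarsimp
  fix c P l assume cP: "(c,P) \<in> set fam" and l: "l\<in>L" and xw: "x + w - l \<in> P"
  \<comment> \<open>For \<open>m = 0\<close> the side conditions of \<open>loc_wall\<close> hold
    trivially, so at a point of \<open>P\<close> it just says that a neighbourhood relative to
    \<open>V\<close> stays in \<open>P\<close>.\<close>
  have lw: "loc_wall V 0 P (x + w - l)"
    using walls_walled[OF V C, where x=x and w=w and m=0] gen cP l unfolding walled_def by blast
  show "x + w - l \<in> irint V P"
    using lw xw unfolding loc_wall_def irint_def by auto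
qed

text \<open>Walls with a normal parallel to \<open>m\<close> cannot be escaped by moving
  orthogonally to \<open>m\<close>, but all others can. After a generic move within
  \<open>perp V m\<close> only walls with normal along \<open>m\<close> remain visible.\<close>

lemma walled_near:
  assumes V: "subspace V" "m \<in> V" "m \<noteq> 0" and fam: "vfam V fam" and e: "e > 0"
  shows "\<exists>w\<in>perp V m. norm w < e \<and> walled V m fam (x + w)"
proof -
  obtain C where C: "hreps V C fam" by (rule walls_ex[OF V(1) fam]) blast
  define Q where "Q = {(a,\<beta>) \<in> walls V C fam x. \<nexists>k. a = k *\<^sub>R m}"
  have "\<exists>w\<in>perp V m. norm (w - 0) < e \<and> (\<forall>(a,\<beta>)\<in>Q. a \<bullet> w \<noteq> \<beta>)"
  proof (rule generic_in_subspace[OF subspace_perp[OF V(1)] _ _ _ e])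
    show "countable Q" unfolding Q_def by (rule countable_subset[OF _ walls_props(1)[OF C]]) auto
    show "0 \<in> perp V m" using V by (simp add: perp_def subspace_0)
    fix a \<beta> assume aq: "(a,\<beta>)\<in>Q"
    then have a: "a \<in> V" "\<And>k. a \<noteq> k *\<^sub>R m" using walls_props(2)[OF C] by (auto simp: Q_def)
    \<comment> \<open>The part of the normal within \<open>perp V m\<close>. It is nonzero as
      \<open>a\<close> is not a multiple of \<open>m\<close>, and \<open>a \<bullet> u\<close> is
      its squared norm.\<close>
    define u where "u = a - ((a \<bullet> m)/(m \<bullet> m)) *\<^sub>R m"
    have "u \<in> V" unfolding u_def using V a by (simp add: subspace_diff subspace_scale)
    moreover have mu: "m \<bullet> u = 0" unfolding u_def using V(3) by (simp add: inner_diff_right inner_commute)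
    moreover have "u \<noteq> 0" using a(2)[of "(a \<bullet> m)/(m \<bullet> m)"] by (simp add: u_def)
    moreover have "a \<bullet> u = u \<bullet> u"
    proof -
      have "a = u + ((a \<bullet> m)/(m \<bullet> m)) *\<^sub>R m" by (simp add: u_def)
      then have "a \<bullet> u = (u + ((a \<bullet> m)/(m \<bullet> m)) *\<^sub>R m) \<bullet> u" by simp
      then show ?thesis using mu by (simp add: inner_add_left)
    qed
    ultimately show "\<exists>u\<in>perp V m. a \<bullet> u \<noteq> 0" by (intro bexI[of _ u]) (auto simp: perp_def)
  qed
  then obtain w where w: "w\<in>perp V m" "norm w < e" "\<And>a \<beta>. (a,\<beta>)\<in>Q \<Longrightarrow> a \<bullet> w \<noteq> \<beta>" by auto
  have "walled V m fam (x + w)" by (rule walls_walled[OF V(1) C]) (use w(3) Q_def in auto)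
  then show ?thesis using w by blast
qed

text \<open>Values are compared only within a coset of \<open>V\<close>; different cosets may carry
  different constants. In contrast, \<open>null_on\<close> fixes the value on all cosets at
  once.\<close>

definition const_on :: "'a set \<Rightarrow> (int \<times> 'a set) list \<Rightarrow> bool" where
  "const_on V fam \<longleftrightarrow> (\<forall>x\<in>good V fam. \<forall>v\<in>V. x + v \<in> good V fam \<longrightarrow> mult fam (x + v) = mult fam x)"

definition null_on :: "'a set \<Rightarrow> (int \<times> 'a set) list \<Rightarrow> bool" where
  "null_on V fam \<longleftrightarrow> (\<forall>x\<in>good V fam. mult fam x = 0)"

lemma null_imp_const: "null_on V fam \<Longrightarrow> const_on V fam"
  by (simp add: null_on_def const_on_def)

text \<open>A small move inside \<open>perp V m\<close> reaches a point with a clean wall and does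
  not alter the boundary count, which is locally constant. The two points slightly beyond and before
  it along \<open>m\<close> lie in one coset of \<open>V\<close>, so the jump there is zero.\<close>

theorem const_imp_null_bdry:
  assumes V: "subspace V" "m \<in> V" "m \<noteq> 0" and fam: "vfam V fam" and const: "const_on V fam"
  shows "null_on (perp V m) (bdry m fam)"
  unfolding null_on_def
proof
  fix x assume x: "x \<in> good (perp V m) (bdry m fam)"
  obtain e where e: "e>0" "\<And>v. norm v < e \<Longrightarrow> v \<in> perp V m \<Longrightarrow> mult (bdry m fam) (x + v) = mult (bdry m fam) x"
    using good_local[OF subspace_perp[OF V(1)] vfam_bdry[OF fam] x] by blast
  obtain w where w: "w \<in> perp V m" "norm w < e" "walled V m fam (x + w)" using walled_near[OF V fam e(1)] by blast
  have "m \<bullet> m > 0" using V by simp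
  then obtain e2 a b where e2: "e2>0" "a - b = - mult (bdry m fam) (x + w)" "\<And>h. 0 < h \<and> h < e2 \<Longrightarrow>
      mult fam (x + w + h *\<^sub>R m) = a \<and> mult fam (x + w - h *\<^sub>R m) = b \<and>
      x + w + h *\<^sub>R m \<in> good V fam \<and> x + w - h *\<^sub>R m \<in> good V fam"
    using walled_sides[OF V(1,2) _ fam w(3)] by blast
  define h where "h = e2/2"
  have h: "0 < h \<and> h < e2" using e2(1) by (simp add: h_def)
  have "x + w + h *\<^sub>R m = (x + w - h *\<^sub>R m) + (2*h) *\<^sub>R m" by (simp add: algebra_simps flip: scaleR_left_distrib)
  moreover have "(2*h) *\<^sub>R m \<in> V" using V by (simp add: subspace_scale)
  ultimately have "a = b" using const e2(3)[OF h] unfolding const_on_def by metis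
  then show "mult (bdry m fam) x = 0" using e2(2) e(2)[OF w(2,1)] by simp
qed

text \<open>Walk from \<open>x\<close> to a good point near \<open>x + v\<close> along a segment in
  general position. At any time it meets walls of one normal direction only, and the crossing
  changes the count by a boundary count, which is zero.\<close>

theorem null_bdry_imp_const:
  assumes V: "subspace V" and fam: "vfam V fam"
    and null: "\<And>m. m \<in> V \<Longrightarrow> m \<noteq> 0 \<Longrightarrow> null_on (perp V m) (bdry m fam)"
  shows "const_on V fam"
  unfolding const_on_def
proof (intro ballI impI)
  fix x v assume x: "x \<in> good V fam" and v: "v \<in> V" and xv: "x + v \<in> good V fam"
  show "mult fam (x + v) = mult fam x"
  proof (cases "v = 0")
    case False
    obtain C where C: "hreps V C fam" by (rule walls_ex[OF V fam]) blast
    let ?W = "walls V C fam x"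
    obtain e where e: "e>0" "\<And>u. norm u < e \<Longrightarrow> u\<in>V \<Longrightarrow> x + v + u \<in> good V fam \<and> mult fam (x + v + u) = mult fam (x + v)"
      using good_local[OF V fam xv] by blast
    \<comment> \<open>Conditions on the end point \<open>v'\<close>: a nonzero product with
      \<open>v\<close> makes it nonzero; nonzero products with all normals make the segment
      transversal to every wall; the third kind says that two walls met at the same nonzero time
      have parallel normals.\<close>
    define Q where "Q = insert (v,0::real) ((\<lambda>(a,\<beta>). (a,0)) ` ?W \<union>
       (\<lambda>((a,\<beta>),(a',\<beta>')). (\<beta>' *\<^sub>R a - \<beta> *\<^sub>R a', 0)) ` {((a,\<beta>),(a',\<beta>')) \<in> ?W \<times> ?W. \<beta>' *\<^sub>R a - \<beta> *\<^sub>R a' \<noteq> 0})"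
    have "\<exists>v'\<in>V. norm (v' - v) < e \<and> (\<forall>(w,\<gamma>)\<in>Q. w \<bullet> v' \<noteq> \<gamma>)"
    proof (rule generic_in_subspace[OF V _ _ v e(1)])
      have "countable {((a,\<beta>),(a',\<beta>')) \<in> ?W \<times> ?W. \<beta>' *\<^sub>R a - \<beta> *\<^sub>R a' \<noteq> 0}"
        by (rule countable_subset[of _ "?W \<times> ?W"]) (use walls_props(1)[OF C] in auto)
      then show "countable Q" unfolding Q_def using walls_props(1)[OF C] by auto
      fix w \<gamma> assume "(w,\<gamma>) \<in> Q"
      then have "w \<in> V \<and> w \<noteq> 0"
        unfolding Q_def using walls_props(2)[OF C] v False by (auto intro!: subspace_diff[OF V] subspace_scale[OF V])
      then show "\<exists>u\<in>V. w \<bullet> u \<noteq> 0" by (intro bexI[of _ w]) auto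
    qed
    then obtain v' where v': "v'\<in>V" "norm (v' - v) < e" and Q: "\<And>w \<gamma>. (w,\<gamma>)\<in>Q \<Longrightarrow> w \<bullet> v' \<noteq> \<gamma>" by blast
    have Q1: "v \<bullet> v' \<noteq> 0" using Q by (auto simp: Q_def)
    have Q2: "a \<bullet> v' \<noteq> 0" if "(a,\<beta>) \<in> ?W" for a \<beta> using Q[of a 0] that by (force simp: Q_def)
    have Q3: "(\<beta>' *\<^sub>R a - \<beta> *\<^sub>R a') \<bullet> v' \<noteq> 0" if "(a,\<beta>) \<in> ?W" "(a',\<beta>') \<in> ?W" "\<beta>' *\<^sub>R a - \<beta> *\<^sub>R a' \<noteq> 0" for a \<beta> a' \<beta>'
      using Q[of "\<beta>' *\<^sub>R a - \<beta> *\<^sub>R a'" 0] that unfolding Q_def by force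
    have v'0: "v' \<bullet> v' > 0" using Q1 by auto
    \<comment> \<open>At each time the walls met share one normal direction. Time 0 is special, as
      the separation of walls says nothing there, but \<open>x\<close> is good, so \<open>v'\<close>
      itself can serve as normal.\<close>
    have dir: "\<exists>m\<in>V. m \<bullet> v' > 0 \<and> walled V m fam (x + t *\<^sub>R v')" for t
    proof (cases "\<exists>a \<beta>. (a,\<beta>) \<in> ?W \<and> t * (a \<bullet> v') = \<beta> \<and> t \<noteq> 0")
      case False
      show ?thesis
      proof (cases "t = 0")
        case True
        have "walled V v' fam x" unfolding walled_def
        proof clarify
          fix c P l assume cP: "(c,P)\<in>set fam" and l: "l\<in>L"
          show "loc_wall V v' P (x - l)"
          proof (cases "x - l \<in> P")
            case True
            then have "x - l \<in> irint V P" using x cP l by (auto simp: good_def)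
            then show ?thesis using irint_loc_wall[OF V v'(1)] v'0 by auto
          qed (simp add: loc_wall_def)
        qed
        then show ?thesis using True v'(1) v'0 by (intro bexI[of _ v']) (simp_all del: inner_gt_zero_iff)
      next
        case t: False
        have "walled V v' fam (x + t *\<^sub>R v')"
          by (rule walls_walled[OF V C]) (use False t in auto)
        then show ?thesis using v'(1) v'0 by blast
      qed
    next
      case True
      then obtain a \<beta> where ab: "(a,\<beta>) \<in> ?W" "t * (a \<bullet> v') = \<beta>" "t \<noteq> 0" by blast
      have "walled V a fam (x + t *\<^sub>R v')"
      proof (rule walls_walled[OF V C])
        fix a' \<beta>' assume ab': "(a',\<beta>') \<in> ?W" "a' \<bullet> (t *\<^sub>R v') = \<beta>'"
        have "(\<beta>' *\<^sub>R a - \<beta> *\<^sub>R a') \<bullet> v' = 0" using ab ab' by (auto simp: inner_diff_left)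
        then have "\<beta> *\<^sub>R a' = \<beta>' *\<^sub>R a" using Q3[OF ab(1) ab'(1)] by (metis eq_iff_diff_eq_0)
        moreover have "\<beta> \<noteq> 0" using ab Q2[OF ab(1)] by auto
        ultimately have "a' = (\<beta>'/\<beta>) *\<^sub>R a" by (metis divide_inverse_commute scaleR_left_imp_eq scaleR_scaleR right_inverse mult.assoc mult_1 real_scaleR_def)
        then show "\<exists>k. a' = k *\<^sub>R a" by blast
      qed
      moreover from this have "walled V (-a) fam (x + t *\<^sub>R v')" by (simp add: walled_def loc_wall_uminus)
      moreover have "a \<in> V" "-a \<in> V" using walls_props(2)[OF C ab(1)] subspace_neg[OF V] by auto
      moreover have "a \<bullet> v' > 0 \<or> (-a) \<bullet> v' > 0" using Q2[OF ab(1)] by auto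
      ultimately show ?thesis by blast
    qed
    define \<phi> where "\<phi> t = mult fam (x + t *\<^sub>R v')" for t
    \<comment> \<open>At \<open>t\<close> itself the value may differ, as closed translates overlap
      on a wall; it is the two sides that agree.\<close>
    have loc: "\<exists>c. \<exists>\<delta>>0. \<forall>s. s \<noteq> t \<and> \<bar>s - t\<bar> < \<delta> \<longrightarrow> \<phi> s = c" for t
    proof -
      obtain m where m: "m\<in>V" "m \<bullet> v' > 0" "walled V m fam (x + t *\<^sub>R v')" using dir by blast
      have "m \<noteq> 0" using m by auto
      then have z: "mult (bdry m fam) (x + t *\<^sub>R v') = 0"
        using null[OF m(1)] walled_good_bdry[OF m(3)] by (simp add: null_on_def)
      obtain \<delta> a b where \<delta>: "\<delta>>0" "a - b = - mult (bdry m fam) (x + t *\<^sub>R v')" "\<And>h. 0 < h \<and> h < \<delta> \<Longrightarrow>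
        mult fam (x + t *\<^sub>R v' + h *\<^sub>R v') = a \<and> mult fam (x + t *\<^sub>R v' - h *\<^sub>R v') = b"
        using walled_sides[OF V v'(1) m(2) fam m(3)] by blast
      have "\<phi> s = a" if "s \<noteq> t \<and> \<bar>s - t\<bar> < \<delta>" for s
      proof (cases "s > t")
        case True
        have "x + s *\<^sub>R v' = x + t *\<^sub>R v' + (s - t) *\<^sub>R v'" by (simp add: algebra_simps)
        then show ?thesis using \<delta>(3)[of "s - t"] True that unfolding \<phi>_def by (metis abs_of_pos diff_gt_0_iff_gt)
      next
        case False
        have "x + s *\<^sub>R v' = x + t *\<^sub>R v' - (t - s) *\<^sub>R v'" by (simp add: algebra_simps)
        then have "\<phi> s = b" using \<delta>(3)[of "t - s"] False that unfolding \<phi>_def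
          by (metis abs_minus_commute abs_of_pos diff_gt_0_iff_gt linorder_neqE_linordered_idom)
        then show ?thesis using \<delta>(2) z by simp
      qed
      then show ?thesis using \<delta>(1) by blast
    qed
    then obtain \<psi> D where \<psi>: "\<And>t. D t > 0" "\<And>s t. s \<noteq> t \<Longrightarrow> \<bar>s - t\<bar> < D t \<Longrightarrow> \<phi> s = \<psi> t" by metis
    \<comment> \<open>A point common to two punctured neighbourhoods. It shows that the limit value
      \<open>\<psi>\<close> is locally constant, to which connectedness of the line applies.\<close>
    have pick: "\<exists>r. r \<noteq> s \<and> r \<noteq> t \<and> \<bar>r - s\<bar> < d1 \<and> \<bar>r - t\<bar> < d2" if "\<bar>s - t\<bar> < d2" "d1 > 0" for s t d1 d2 :: real
    proof -
      have "infinite {s <..< s + min d1 (d2 - \<bar>s - t\<bar>)}" using that by (intro infinite_Ioo) auto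
      then obtain r where "r \<in> {s <..< s + min d1 (d2 - \<bar>s - t\<bar>)} - {t}"
        by (metis finite.emptyI finite_insert finite_Diff2 infinite_imp_nonempty ex_in_conv finite_Diff_insert Diff_empty)
      then show ?thesis by (intro exI[of _ r]) auto
    qed
    have "eventually (\<lambda>s. \<psi> t = \<psi> s) (at t within UNIV)" for t
      unfolding eventually_at
    proof (intro exI[of _ "D t"] conjI ballI impI)
      show "D t > 0" by (rule \<psi>)
      fix s assume "s \<noteq> t \<and> dist s t < D t"
      then obtain r where "r \<noteq> s" "r \<noteq> t" "\<bar>r - s\<bar> < D s" "\<bar>r - t\<bar> < D t" using pick[of s t "D t" "D s"] \<psi>(1) by (auto simp: dist_real_def)
      then show "\<psi> t = \<psi> s" using \<psi>(2) by metis
    qed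
    then have eq: "\<psi> 0 = \<psi> 1" using connected_local_const[of UNIV "0::real" 1 \<psi>] by auto
    \<comment> \<open>At good points the value equals the limit value; both ends of the segment are
      good.\<close>
    have endp: "\<phi> t = \<psi> t" if g: "x + t *\<^sub>R v' \<in> good V fam" for t
    proof -
      obtain d where d: "d > 0" "\<And>u. norm u < d \<Longrightarrow> u\<in>V \<Longrightarrow> mult fam (x + t *\<^sub>R v' + u) = mult fam (x + t *\<^sub>R v')"
        using good_local[OF V fam g] by blast
      define r where "r = min (D t) (d / norm v') / 2"
      have r: "r > 0" "r < D t" "r * norm v' < d"
      proof -
        have nv: "norm v' > 0" using v'0 by auto
        show "r > 0" "r < D t" using \<psi>(1)[of t] d(1) nv by (auto simp: r_def min_def)
        have "r < d / norm v'" using \<psi>(1)[of t] d(1) nv by (auto simp: r_def min_def field_simps)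
        then show "r * norm v' < d" using nv by (simp add: pos_less_divide_eq)
      qed
      have "\<phi> (t + r) = \<phi> t" using d(2)[of "r *\<^sub>R v'"] r v'(1) subspace_scale[OF V] by (simp add: \<phi>_def scaleR_left_distrib add.assoc)
      moreover have "\<phi> (t + r) = \<psi> t" using \<psi>(2)[of "t+r" t] r by simp
      ultimately show ?thesis by simp
    qed
    have x1: "x + v + (v' - v) \<in> good V fam \<and> mult fam (x + v + (v' - v)) = mult fam (x + v)"
      using e(2)[of "v' - v"] v' v V by (simp add: subspace_diff)
    have "\<phi> 1 = \<phi> 0" using endp[of 0] endp[of 1] x x1 eq by simp
    then show ?thesis using x1 by (simp add: \<phi>_def)
  qed simp
qed

text \<open>If the value on the coset is \<open>c\<close>, summing the differences of
  \<open>G\<close> along \<open>x\<close>, \<open>x - u\<close>, \<open>x - 2u\<close> and so on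
  changes \<open>G\<close> by \<open>c\<close> at every step, which a bounded function allows only
  for \<open>c = 0\<close>.\<close>

theorem const_diff_imp_null:
  assumes V: "subspace V" and fam: "vfam V fam" and const: "const_on V fam"
    and u: "u \<in> V" and G: "\<And>x. mult fam x = G x - G (x - u)" and N: "\<And>x. \<bar>G x\<bar> \<le> (N::int)"
  shows "null_on V fam"
  unfolding null_on_def
proof
  fix x assume x: "x \<in> good V fam"
  obtain C where C: "hreps V C fam" by (rule walls_ex[OF V fam]) blast
  obtain e where e: "e>0" "\<And>v. norm v < e \<Longrightarrow> v \<in> V \<Longrightarrow> x + v \<in> good V fam \<and> mult fam (x + v) = mult fam x"
    using good_local[OF V fam x] by blast
  \<comment> \<open>One perturbation is to make all points of the progression good simultaneously,
    so the walls seen from all of them are collected; they are still countably many.\<close>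
  define Q where "Q = (\<Union>j::nat. walls V C fam (x - real j *\<^sub>R u))"
  have "\<exists>w\<in>V. norm (w - 0) < e \<and> (\<forall>(a,\<beta>)\<in>Q. a \<bullet> w \<noteq> \<beta>)"
  proof (rule generic_in_subspace[OF V _ _ subspace_0[OF V] e(1)])
    show "countable Q" unfolding Q_def by (intro countable_UN walls_props(1)[OF C] countableI_type)
    show "\<exists>u\<in>V. a \<bullet> u \<noteq> 0" if "(a,\<beta>)\<in>Q" for a \<beta>
      using that walls_props(2)[OF C] unfolding Q_def by (intro bexI[of _ a]) auto
  qed
  then obtain w where w: "w\<in>V" "norm w < e" "\<And>a \<beta>. (a,\<beta>)\<in>Q \<Longrightarrow> a \<bullet> w \<noteq> \<beta>" by auto
  have g: "x - real j *\<^sub>R u + w \<in> good V fam" for j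
    by (rule walls_good[OF V C]) (use w(3) Q_def in auto)
  have xw: "x + w \<in> good V fam" "mult fam (x + w) = mult fam x" using e(2)[OF w(2,1)] by auto
  define c where "c = mult fam x"
  have m: "mult fam (x - real j *\<^sub>R u + w) = c" for j
  proof -
    have "x + w + (- (real j *\<^sub>R u)) = x - real j *\<^sub>R u + w" by simp
    moreover have "- (real j *\<^sub>R u) \<in> V" using u V by (simp add: subspace_neg subspace_scale)
    ultimately show ?thesis using const xw g[of j] unfolding const_on_def c_def by metis
  qed
  have step: "G (x - real j *\<^sub>R u + w) - G (x - real (Suc j) *\<^sub>R u + w) = c" for j
  proof -
    have "x - real (Suc j) *\<^sub>R u + w = x - real j *\<^sub>R u + w - u" by (simp add: algebra_simps)
    then show ?thesis using G m[of j] by metis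
  qed
  have tele: "G (x + w) - G (x - real j *\<^sub>R u + w) = int j * c" for j
  proof (induction j)
    case (Suc j) then show ?case using step[of j] by (simp add: algebra_simps)
  qed simp
  have "\<bar>int j * c\<bar> \<le> 2 * N" for j
    using N[of "x + w"] N[of "x - real j *\<^sub>R u + w"] unfolding tele[of j, symmetric] by linarith
  \<comment> \<open>With \<open>2 * N + 1\<close> steps a nonzero integer \<open>c\<close> would
    already exceed the bound \<open>2 * N\<close>.\<close>
  from this[of "nat (2 * N + 1)"] have "\<bar>(2*N+1) * c\<bar> \<le> 2 * N" using N[of x] by simp
  moreover have "N \<ge> 0" using N[of x] by linarith
  ultimately have "c = 0"
  proof -
    have "(2*N+1) * \<bar>c\<bar> \<le> 2 * N" using \<open>\<bar>(2*N+1) * c\<bar> \<le> 2 * N\<close> \<open>N \<ge> 0\<close> by (simp add: abs_mult)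
    moreover have "(2*N+1) * \<bar>c\<bar> \<ge> (2*N+1) * 1" if "c \<noteq> 0" using that \<open>N \<ge> 0\<close> by (intro mult_left_mono) auto
    ultimately show ?thesis by (metis linorder_not_less mult.right_neutral order_trans zless_add1_eq order_less_irrefl)
  qed
  then show "mult fam x = 0" by (simp add: c_def)
qed

section \<open>Averaging over the group: vanishing counts give balanced volumes\<close>

lemma sum_cnt:
  assumes "finite L0" "L0 \<subseteq> L" "\<And>l. l\<in>L \<Longrightarrow> x - l \<in> K \<Longrightarrow> l \<in> L0"
  shows "(\<Sum>l\<in>L0. indicat_real K (x - l)) = real (cnt K x)"
proof -
  have "{l\<in>L. x - l \<in> K} = {l\<in>L0. x - l \<in> K}" using assms by auto
  then show ?thesis unfolding cnt_def using assms(1) by (simp add: sum.If_cases indicator_def of_bool_def Int_def)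
qed

text \<open>As \<open>L\<close> need not have full rank, there may be no bounded fundamental domain. Its role is played
  by the weight \<open>W\<close>, whose translates sum to 1 on the union \<open>U\<close> of the sets.\<close>

lemma mult_null_imp_measure:
  assumes K: "\<And>c K. (c,K) \<in> set fam \<Longrightarrow> compact K"
    and null: "AE x in lborel. mult fam x = 0"
  shows "(\<Sum>(c,K)\<leftarrow>fam. of_int c * measure lborel K) = 0"
proof -
  define U where "U = (\<Union>(c,K)\<in>set fam. K)"
  have "bounded U" unfolding U_def by (rule bounded_UN) (auto dest: K compact_imp_bounded)
  then obtain R where R: "\<And>x. x \<in> U \<Longrightarrow> norm x \<le> R" unfolding bounded_iff by blast
  \<comment> \<open>Contains every translation by which two points of \<open>U\<close> can differ;
    this finite set replaces \<open>L\<close> in the sums below.\<close>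
  define L0 where "L0 = L \<inter> cball 0 (2*R)"
  have L0: "finite L0" "L0 \<subseteq> L" unfolding L0_def using finite_cball by auto
  have L0I: "l \<in> L0" if "l\<in>L" "x \<in> U" "x - l \<in> U" for x l
  proof -
    have "norm (x - (x - l)) \<le> norm x + norm (x - l)" by (rule norm_triangle_ineq4)
    then show ?thesis using that R[OF that(2)] R[OF that(3)] by (simp add: L0_def)
  qed
  have KU: "x \<in> U" if "(c,K) \<in> set fam" "x\<in>K" for c K x using that by (auto simp: U_def)
  \<comment> \<open>\<open>w\<close> counts the members covering \<open>x\<close>, and
    \<open>S\<close> sums its translates. On \<open>U\<close> the sum \<open>S\<close> equals the
    periodic function \<open>F\<close>, so dividing \<open>w\<close> by it gives a partition of
    unity there.\<close>
  define w where "w x = (\<Sum>(c,K)\<leftarrow>fam. indicat_real K x)" for x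
  define S where "S x = (\<Sum>l\<in>L0. w (x - l))" for x
  define F where "F x = (\<Sum>(c,K)\<leftarrow>fam. real (cnt K x))" for x
  have wb: "w \<in> borel_measurable borel"
  proof -
    have "(\<lambda>x. \<Sum>(c,K)\<leftarrow>f. indicat_real K x) \<in> borel_measurable borel" if "set f \<subseteq> set fam" for f
      using that by (induction f) (auto intro!: borel_measurable_add borel_measurable_indicator dest!: K compact_imp_closed borel_closed)
    then show ?thesis unfolding w_def[abs_def] by blast
  qed
  have Sb: "S \<in> borel_measurable borel" unfolding S_def[abs_def]
    by (intro borel_measurable_sum measurable_compose[OF _ wb]) measurable
  have w0: "w x \<ge> 0" for x unfolding w_def by (rule sum_list_nonneg) auto
  have wU: "w x = 0" if "x \<notin> U" for x
  proof -
    have "(\<Sum>(c,K)\<leftarrow>f. indicat_real K x) = 0" if "set f \<subseteq> set fam" for f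
      using that
    proof (induction f)
      case (Cons a f)
      then show ?case using KU[of "fst a" "snd a" x] \<open>x \<notin> U\<close> by (cases a) (auto simp: indicator_def)
    qed simp
    then show ?thesis unfolding w_def by blast
  qed
  have SF: "S x = F x" if "x \<in> U" for x
  proof -
    have sw: "(\<Sum>l\<in>L0. (\<Sum>(c,K)\<leftarrow>f. indicat_real K (x-l))) = (\<Sum>(c,K)\<leftarrow>f. real (cnt K x))" if "set f \<subseteq> set fam" for f
      using that
    proof (induction f)
      case (Cons a f)
      obtain c K where a: "a = (c,K)" by force
      have "(\<Sum>l\<in>L0. indicat_real K (x - l)) = real (cnt K x)"
        by (rule sum_cnt[OF L0]) (use L0I \<open>x\<in>U\<close> KU Cons.prems a in auto)
      then show ?case using Cons by (simp add: a sum.distrib)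
    qed simp
    then show ?thesis unfolding S_def F_def w_def by blast
  qed
  have Fper: "F (x - l) = F x" if "l\<in>L" for x l unfolding F_def using cnt_translate_L[OF that] by simp
  define W where "W x = w x / S x" for x
  have Wb: "W \<in> borel_measurable borel" unfolding W_def[abs_def] using wb Sb by measurable
  have L00: "0 \<in> L0 \<or> U = {}" using L0I zero_mem by auto
  have W01: "0 \<le> W x \<and> W x \<le> 1" for x
  proof (cases "x \<in> U")
    case True
    then have "0 \<in> L0" using L00 by auto
    then have "w x \<le> S x" unfolding S_def using member_le_sum[of 0 L0 "\<lambda>l. w (x - l)"] w0 L0 by simp
    then show ?thesis unfolding W_def using w0[of x] by (auto simp: divide_le_eq)
  next
    case False then show ?thesis by (simp add: W_def wU)
  qed
  have part: "(\<Sum>l\<in>L0. W (x - l)) = 1" if c: "(c,K) \<in> set fam" "x\<in>K" for c K x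
  proof -
    have xU: "x\<in>U" using KU that by blast
    have "W (x - l) = w (x - l) / F x" if "l\<in>L0" for l
    proof (cases "x - l \<in> U")
      case True
      then show ?thesis unfolding W_def using SF[OF True] Fper that L0(2) by auto
    qed (simp add: W_def wU)
    then have "(\<Sum>l\<in>L0. W (x - l)) = S x / F x" by (simp add: S_def sum_divide_distrib)
    moreover have "F x > 0"
    proof -
      have "finite {l\<in>L. x - l \<in> K}" using K[OF c(1)] by (intro finite_bounded compact_imp_bounded)
      moreover have "0 \<in> {l\<in>L. x - l \<in> K}" using c zero_mem by simp
      ultimately have "cnt K x > 0" unfolding cnt_def by (auto simp: card_gt_0_iff)
      moreover have "(c,K) \<in> set f \<Longrightarrow> real (cnt K x) \<le> (\<Sum>(c,K)\<leftarrow>f. real (cnt K x))" for f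
      proof (induction f)
        case (Cons a f)
        have "0 \<le> (\<Sum>(c,K)\<leftarrow>f. real (cnt K x))" by (rule sum_list_nonneg) auto
        then show ?case using Cons by (cases a) force
      qed simp
      then have "real (cnt K x) \<le> F x" unfolding F_def using c by blast
      ultimately show ?thesis by linarith
    qed
    ultimately show ?thesis using SF[OF xU] by simp
  qed
  have int1: "integrable lborel (indicat_real K)" if "compact K" for K :: "'a set"
    using fmeasurable_compact[OF that] by (intro integrable_real_indicator) (auto simp: fmeasurable_def)
  have int2: "integrable lborel (\<lambda>x. indicat_real K x * W (x - l))" if "compact K" for K :: "'a set" and l
  proof (rule Bochner_Integration.integrable_bound[OF int1[OF that]])
    have "(\<lambda>x. W (x - l)) \<in> borel_measurable borel" by (rule measurable_compose[OF _ Wb]) measurable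
    then show "(\<lambda>x. indicat_real K x * W (x - l)) \<in> borel_measurable lborel"
      using that by (intro borel_measurable_times borel_measurable_indicator) (auto simp: compact_imp_closed borel_closed)
    show "AE x in lborel. norm (indicat_real K x * W (x - l)) \<le> norm (indicat_real K x)"
      using W01 by (auto simp: indicator_def)
  qed
  have trans: "(\<integral>x. f (x + l) \<partial>lborel) = (\<integral>x. f x \<partial>lborel)" "integrable lborel f \<Longrightarrow> integrable lborel (\<lambda>x. f (x + l))"
    if "f \<in> borel_measurable borel" for f :: "'a \<Rightarrow> real" and l
  proof -
    have d: "distr lborel borel ((+) l) = (lborel :: 'a measure)" by (rule lborel_distr_plus)
    have "(\<integral>x. f x \<partial>lborel) = (\<integral>x. f x \<partial>(distr lborel borel ((+) l)))" by (simp only: d)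
    also have "\<dots> = (\<integral>x. f (l + x) \<partial>lborel)" by (rule integral_distr) (use that in auto)
    finally show "(\<integral>x. f (x + l) \<partial>lborel) = (\<integral>x. f x \<partial>lborel)" by (simp add: add.commute)
    assume "integrable lborel f"
    then have "integrable (distr lborel borel ((+) l)) f" by (simp only: d)
    then show "integrable lborel (\<lambda>x. f (x + l))" by (subst (asm) integrable_distr_eq) (use that in \<open>auto simp: add.commute\<close>)
  qed
  have KI: "measure lborel K = (\<integral>x. W x * real (cnt K x) \<partial>lborel) \<and> integrable lborel (\<lambda>x. W x * real (cnt K x))"
    if c: "(c,K) \<in> set fam" for c K
  proof -
    have cK: "compact K" by (rule K[OF c])
    have mb: "(\<lambda>x. indicat_real K x * W (x - l)) \<in> borel_measurable borel" for l
      using borel_measurable_integrable[OF int2[OF cK, of l]] by simp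
    have neg: "bij_betw uminus L0 L0"
      by (rule bij_betw_byWitness[where f'=uminus]) (auto simp: L0_def uminus_mem)
    have eqf: "(\<lambda>x. (\<Sum>l\<in>L0. indicat_real K (x + l) * W x)) = (\<lambda>x. W x * real (cnt K x))"
    proof
      fix x
      show "(\<Sum>l\<in>L0. indicat_real K (x + l) * W x) = W x * real (cnt K x)"
      proof (cases "x \<in> U")
        case True
        have "(\<Sum>l\<in>L0. indicat_real K (x + l)) = (\<Sum>l\<in>L0. indicat_real K (x - l))"
          using sum.reindex_bij_betw[OF neg, of "\<lambda>l. indicat_real K (x + l)"] by simp
        also have "\<dots> = real (cnt K x)"
          by (rule sum_cnt[OF L0]) (use L0I True KU c in auto)
        finally show ?thesis by (simp add: sum_distrib_right[symmetric])
      qed (simp add: W_def wU)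
    qed
    \<comment> \<open>Unfolding: insert the partition of unity, then shift each term by
      \<open>l\<close>. The translates of the indicator of \<open>K\<close> add up to the count, so
      the volume of \<open>K\<close> is its count integrated against \<open>W\<close>.\<close>
    have "measure lborel K = (\<integral>x. indicat_real K x \<partial>lborel)" by simp
    also have "\<dots> = (\<integral>x. (\<Sum>l\<in>L0. indicat_real K x * W (x - l)) \<partial>lborel)"
      by (intro Bochner_Integration.integral_cong) (use part[OF c] in \<open>auto simp: indicator_def\<close>)
    also have "\<dots> = (\<Sum>l\<in>L0. \<integral>x. indicat_real K x * W (x - l) \<partial>lborel)"
      by (rule Bochner_Integration.integral_sum) (rule int2[OF cK])
    also have "\<dots> = (\<Sum>l\<in>L0. \<integral>x. indicat_real K (x + l) * W x \<partial>lborel)"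
    proof (intro sum.cong refl)
      fix l
      show "(\<integral>x. indicat_real K x * W (x - l) \<partial>lborel) = (\<integral>x. indicat_real K (x + l) * W x \<partial>lborel)"
        using trans(1)[OF mb, of l l] by simp
    qed
    also have "\<dots> = (\<integral>x. (\<Sum>l\<in>L0. indicat_real K (x + l) * W x) \<partial>lborel)"
    proof (rule Bochner_Integration.integral_sum[symmetric])
      fix l show "integrable lborel (\<lambda>x. indicat_real K (x + l) * W x)"
        using trans(2)[OF mb int2[OF cK], of l l] by simp
    qed
    also have "\<dots> = (\<integral>x. W x * real (cnt K x) \<partial>lborel)" unfolding eqf ..
    finally have 1: "measure lborel K = (\<integral>x. W x * real (cnt K x) \<partial>lborel)" .
    have "integrable lborel (\<lambda>x. (\<Sum>l\<in>L0. indicat_real K (x + l) * W x))"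
    proof (intro Bochner_Integration.integrable_sum)
      fix l show "integrable lborel (\<lambda>x. indicat_real K (x + l) * W x)"
        using trans(2)[OF mb int2[OF cK], of l l] by simp
    qed
    then have "integrable lborel (\<lambda>x. W x * real (cnt K x))" unfolding eqf .
    then show ?thesis using 1 by simp
  qed
  have "(\<Sum>(c,K)\<leftarrow>f. of_int c * measure lborel K) = (\<integral>x. W x * of_int (mult f x) \<partial>lborel) \<and> integrable lborel (\<lambda>x. W x * of_int (mult f x))"
    if "set f \<subseteq> set fam" for f
    using that
  proof (induction f)
    case (Cons a f)
    obtain c K where a: "a = (c,K)" by force
    have k: "measure lborel K = (\<integral>x. W x * real (cnt K x) \<partial>lborel)" "integrable lborel (\<lambda>x. W x * real (cnt K x))"
      using KI[of c K] Cons.prems a by auto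
    have e: "(\<lambda>x. W x * of_int (mult (a # f) x)) = (\<lambda>x. of_int c * (W x * real (cnt K x)) + W x * of_int (mult f x))"
      by (auto simp: a algebra_simps)
    show ?case unfolding e using Cons k by (simp add: a)
  qed simp
  then have "(\<Sum>(c,K)\<leftarrow>fam. of_int c * measure lborel K) = (\<integral>x. W x * of_int (mult fam x) \<partial>lborel)" by blast
  also have "\<dots> = 0"
    by (rule integral_eq_zero_AE) (use null in \<open>auto elim: eventually_mono\<close>)
  finally show ?thesis .
qed

lemma AE_walls:
  assumes V: "subspace V" and C: "hreps V C fam"
  shows "AE x in lborel. \<forall>(a,\<beta>)\<in>walls V C fam 0. a \<bullet> x \<noteq> \<beta>"
proof -
  have "AE x in lborel. a \<bullet> x \<noteq> \<beta>" if "(a,\<beta>) \<in> walls V C fam 0" for a \<beta>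
  proof -
    have "negligible {x. a \<bullet> x = \<beta>}" using walls_props(2)[OF C that] by (intro negligible_hyperplane) auto
    then have "AE x in lebesgue. x \<notin> {x. a \<bullet> x = \<beta>}" using AE_not_in negligible_iff_null_sets by blast
    then show ?thesis unfolding AE_completion_iff by simp
  qed
  then show ?thesis using walls_props(1)[OF C, of 0] by (subst AE_ball_countable) auto
qed

text \<open>The translates of a thickened set through \<open>x\<close> are sorted by their component
  \<open>t\<close> in \<open>T\<close>: as \<open>T\<close> is orthogonal to \<open>V\<close>, each
  lattice translation belongs to at most one \<open>t\<close>. The spatial count at \<open>x\<close>
  is then a finite sum of counts of the original family at points \<open>x - t\<close>, and these
  are zero for almost every \<open>x\<close>.\<close>

lemma null_imp_prism_measure:
  assumes V: "subspace V" and fam: "vfam V fam" and null: "null_on V fam"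
    and T: "compact T" and TV: "\<And>t v. t\<in>T \<Longrightarrow> v\<in>V \<Longrightarrow> t \<bullet> v = 0"
  shows "(\<Sum>(c,P)\<leftarrow>fam. of_int c * measure lborel {p + t |p t. p\<in>P \<and> t\<in>T}) = 0"
proof -
  define tk where "tk P = {p + t |p t. p\<in>P \<and> t\<in>T}" for P
  define famT where "famT = map (\<lambda>(c,P). (c, tk P)) fam"
  obtain C where C: "hreps V C fam" by (rule walls_ex[OF V fam]) blast
  have cP: "compact P" if "(c,P)\<in>set fam" for c P
    using fam that by (auto simp: vfam_def vpoly_def polytope_imp_compact)
  have cK: "compact K" if "(c,K)\<in>set famT" for c K
    using that cP T unfolding famT_def tk_def by (auto intro!: compact_sums)
  have zero: "mult famT x = 0" if gen: "\<forall>(a,\<beta>)\<in>walls V C fam 0. a \<bullet> x \<noteq> \<beta>" for x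
  proof -
    \<comment> \<open>Moving by \<open>t\<close> does not change the position relative to walls
      whose normals lie in \<open>V\<close>.\<close>
    have g: "x - t \<in> good V fam" if t: "t\<in>T" for t
    proof -
      have "0 + (x - t) \<in> good V fam"
      proof (rule walls_good[OF V C])
        fix a \<beta> assume ab: "(a,\<beta>) \<in> walls V C fam 0"
        then have "t \<bullet> a = 0" using walls_props(2)[OF C ab] TV[OF t] by blast
        then show "a \<bullet> (x - t) \<noteq> \<beta>" using gen ab by (auto simp: inner_diff_right inner_commute)
      qed
      then show ?thesis by simp
    qed
    define A where "A P t = {l\<in>L. x - t - l \<in> P}" for P t
    \<comment> \<open>The finitely many \<open>t\<close> that contribute for at least one member, so
      that all members are summed over one index set.\<close>
    define T0 where "T0 = (\<Union>(c,P)\<in>set fam. {t\<in>T. A P t \<noteq> {}})"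
    have uniq: "t = t'" if "(c,P)\<in>set fam" "t\<in>T" "t'\<in>T" "l \<in> A P t" "l \<in> A P t'" for c P t t' l
    proof -
      have "(x - t - l) - (x - t' - l) \<in> V" using that fam unfolding A_def vfam_def vpoly_def by blast
      then have "t' - t \<in> V" by simp
      then have "(t' - t) \<bullet> (t' - t) = 0" using TV[OF that(2)] TV[OF that(3)] by (simp add: inner_diff_left)
      then show ?thesis by simp
    qed
    have A: "{l\<in>L. x - l \<in> tk P} = (\<Union>t\<in>T. A P t)" for P
    proof -
      have "x - l \<in> tk P \<longleftrightarrow> (\<exists>t\<in>T. x - t - l \<in> P)" for l
      proof
        assume "x - l \<in> tk P"
        then obtain p t where pt: "p\<in>P" "t\<in>T" "x - l = p + t" unfolding tk_def by blast
        then have "(x - l) - t = p" by simp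
        moreover have "(x - l) - t = x - t - l" by simp
        ultimately show "\<exists>t\<in>T. x - t - l \<in> P" using pt by metis
      next
        assume "\<exists>t\<in>T. x - t - l \<in> P"
        then obtain t where t: "t\<in>T" "x - t - l \<in> P" by blast
        have "x - l = (x - t - l) + t" by simp
        then show "x - l \<in> tk P" using t unfolding tk_def by blast
      qed
      then show ?thesis unfolding A_def by blast
    qed
    have finA: "finite (\<Union>t\<in>T. A P t)" if "(c,P)\<in>set fam" for c P
      using finite_bounded[of "tk P" x] cK[of c "tk P"] that unfolding A by (force simp: famT_def compact_imp_bounded)
    have finT: "finite {t\<in>T. A P t \<noteq> {}}" if c: "(c,P)\<in>set fam" for c P
    proof -
      define f where "f t = (SOME l. l \<in> A P t)" for t
      have f: "f t \<in> A P t" if "A P t \<noteq> {}" for t using that unfolding f_def by (meson ex_in_conv someI)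
      have "inj_on f {t\<in>T. A P t \<noteq> {}}" unfolding inj_on_def using f uniq[OF c] by (metis (mono_tags, lifting) mem_Collect_eq)
      moreover have "f ` {t\<in>T. A P t \<noteq> {}} \<subseteq> (\<Union>t\<in>T. A P t)" using f by auto
      ultimately show ?thesis using finA[OF c] inj_on_finite by blast
    qed
    have fT0: "finite T0" unfolding T0_def using finT by auto
    have T0T: "T0 \<subseteq> T" by (auto simp: T0_def)
    have cn: "int (cnt (tk P) x) = (\<Sum>t\<in>T0. int (cnt P (x - t)))" if c: "(c,P)\<in>set fam" for c P
    proof -
      have "(\<Union>t\<in>T. A P t) = (\<Union>t\<in>T0. A P t)" using c by (auto simp: T0_def)
      then have "cnt (tk P) x = card (\<Union>t\<in>T0. A P t)" unfolding cnt_def A by simp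
      also have "\<dots> = (\<Sum>t\<in>T0. card (A P t))"
      proof (rule card_UN_disjoint[OF fT0])
        show "\<forall>i\<in>T0. finite (A P i)" using finA[OF c] T0T finite_subset by (metis (no_types, lifting) UN_upper subset_iff)
        show "\<forall>i\<in>T0. \<forall>j\<in>T0. i \<noteq> j \<longrightarrow> A P i \<inter> A P j = {}" using uniq[OF c] T0T by blast
      qed
      finally show ?thesis by (simp add: cnt_def A_def)
    qed
    have "mult (map (\<lambda>(c,P). (c, tk P)) f) x = (\<Sum>t\<in>T0. mult f (x - t))" if "set f \<subseteq> set fam" for f
      using that
    proof (induction f)
      case (Cons a f)
      then show ?case using cn[of "fst a" "snd a"] by (cases a) (auto simp: sum.distrib sum_distrib_left)
    qed simp
    then have "mult famT x = (\<Sum>t\<in>T0. mult fam (x - t))" unfolding famT_def by blast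
    also have "\<dots> = 0" using null g T0T by (intro sum.neutral) (auto simp: null_on_def)
    finally show ?thesis .
  qed
  have "AE x in lborel. mult famT x = 0"
    using AE_walls[OF V C] zero by (auto elim: eventually_mono)
  from mult_null_imp_measure[OF cK this]
  show ?thesis by (simp add: famT_def tk_def o_def case_prod_beta')
qed

end

lemma irint_UNIV: "irint UNIV P = interior P"
proof (intro set_eqI iffI)
  fix x assume "x \<in> irint UNIV P"
  then obtain e where e: "e>0" "\<And>v. norm v < e \<Longrightarrow> x + v \<in> P" by (auto simp: irint_def)
  have "ball x e \<subseteq> P"
  proof
    fix y assume "y \<in> ball x e"
    then show "y \<in> P" using e(2)[of "y - x"] by (simp add: dist_norm norm_minus_commute)
  qed
  then show "x \<in> interior P" using e(1) mem_interior by blast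
next
  fix x assume "x \<in> interior P"
  then obtain e where e: "e>0" "ball x e \<subseteq> P" using mem_interior by blast
  then have "x + v \<in> P" if "norm v < e" for v using that by (auto simp: dist_norm subset_iff)
  then show "x \<in> irint UNIV P" using e interior_subset \<open>x \<in> interior P\<close> by (auto simp: irint_def)
qed

section \<open>Tiling as constancy of the count\<close>

locale lattice3 = discrete_subgroup L for L :: "(real^3) set"
begin

lemma has_sum_cnt:
  assumes "bounded A"
  shows "((\<lambda>l. indicat_real A (x - l)) has_sum real k) L \<longleftrightarrow> cnt A x = k"
proof -
  let ?S = "{l\<in>L. x - l \<in> A}"
  have f: "finite ?S" by (rule finite_bounded[OF assms])
  have "((\<lambda>l. indicat_real A (x - l)) has_sum (\<Sum>l\<in>?S. indicat_real A (x - l))) ?S"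
    by (rule has_sum_finite[OF f])
  moreover have "(\<Sum>l\<in>?S. indicat_real A (x - l)) = real (cnt A x)"
    using f by (simp add: cnt_def)
  ultimately have "((\<lambda>l. indicat_real A (x - l)) has_sum real (cnt A x)) ?S" by simp
  then have *: "((\<lambda>l. indicat_real A (x - l)) has_sum real (cnt A x)) L"
    by (subst has_sum_cong_neutral[where T="?S" and g="\<lambda>l. indicat_real A (x - l)"]) auto
  show ?thesis using has_sum_unique[OF *, of "real k"] * by auto
qed

text \<open>Tiling is an almost everywhere statement about the count. The count is locally constant
  at good points, which upgrades it to every good point. Conversely almost all points are good, and
  the level is read off at a good point inside \<open>A\<close>, where the zero translation makes it
  positive.\<close>

lemma tiles_iff_const:
  assumes A: "polytope A" "interior A \<noteq> {}"
  shows "(\<exists>k::nat. k > 0 \<and> tiles_at_level A L k) \<longleftrightarrow> const_on UNIV [(1,A)]"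
proof -
  have bA: "bounded A" using A(1) by (rule polytope_imp_bounded)
  have Ane: "A \<noteq> {}" using A(2) by auto
  have fam: "vfam UNIV [(1,A)]" using A(1) Ane by (simp add: vfam_Cons vpoly_def)
  obtain C where C: "hreps UNIV C [(1,A)]" by (rule walls_ex[OF subspace_UNIV fam]) blast
  have AEg: "AE x in lborel. x \<in> good UNIV [(1,A)]"
    using AE_walls[OF subspace_UNIV C]
  proof (rule eventually_mono)
    fix x assume "\<forall>(a,\<beta>)\<in>walls UNIV C [(1,A)] 0. a \<bullet> x \<noteq> \<beta>"
    then show "x \<in> good UNIV [(1,A)]" using walls_good[OF subspace_UNIV C, of 0 x] by force
  qed
  have til: "tiles_at_level A L k \<longleftrightarrow> (AE x in lborel. mult [(1,A)] x = int k)" for k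
    unfolding tiles_at_level_def has_sum_cnt[OF bA] by simp
  have ex: "\<exists>x\<in>S. P x" if P: "AE x in lborel. P x" and S: "open S" "S \<noteq> {}" for P and S :: "(real^3) set"
  proof (rule ccontr)
    assume "\<not> (\<exists>x\<in>S. P x)"
    then have "AE x in lborel. x \<notin> S" using P by (auto elim: eventually_mono)
    then have "S \<in> null_sets lborel" using S(1) by (subst AE_iff_null_sets) auto
    then have "negligible S" by (simp add: negligible_iff_null_sets null_sets_completionI)
    then show False using open_not_negligible S by blast
  qed
  show ?thesis
  proof
    assume "\<exists>k::nat. k > 0 \<and> tiles_at_level A L k"
    then obtain k where k: "AE x in lborel. mult [(1,A)] x = int k" using til by blast
    have "mult [(1,A)] x = int k" if x: "x \<in> good UNIV [(1,A)]" for x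
    proof -
      obtain e where e: "e>0" "\<And>v. norm v < e \<Longrightarrow> mult [(1,A)] (x + v) = mult [(1,A)] x"
        using good_local[OF subspace_UNIV fam x] by auto
      obtain y where y: "y \<in> ball x e" "mult [(1,A)] y = int k" using ex[OF k, of "ball x e"] e(1) by auto
      then show ?thesis using e(2)[of "y - x"] by (simp add: dist_norm norm_minus_commute)
    qed
    then show "const_on UNIV [(1,A)]" by (simp add: const_on_def)
  next
    assume c: "const_on UNIV [(1,A)]"
    obtain x where x: "x \<in> interior A" "x \<in> good UNIV [(1,A)]" using ex[OF AEg, of "interior A"] A(2) by auto
    define k where "k = cnt A x"
    have "x - 0 \<in> A" using x interior_subset by auto
    then have "0 \<in> {l\<in>L. x - l \<in> A}" using zero_mem by blast
    then have "k > 0" unfolding k_def cnt_def using finite_bounded[OF bA, of x] by (auto simp: card_gt_0_iff)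
    moreover have "mult [(1,A)] y = int k" if "y \<in> good UNIV [(1,A)]" for y
    proof -
      have "mult [(1,A)] (x + (y - x)) = mult [(1,A)] x" using c x(2) that unfolding const_on_def by (metis UNIV_I add.commute diff_add_cancel)
      then show ?thesis by (simp add: k_def)
    qed
    then have "tiles_at_level A L k" unfolding til using AEg by (auto elim: eventually_mono)
    ultimately show "\<exists>k::nat. k > 0 \<and> tiles_at_level A L k" by blast
  qed
qed
end

section \<open>Brunn--Minkowski inequality and extremal growth\<close>

lemma primitive_of_density:
  fixes a :: "real \<Rightarrow> real"
  assumes lt: "\<alpha> < \<alpha>'" and cont: "continuous_on {\<alpha><..<\<alpha>'} a" and pos: "\<And>s. \<alpha> < s \<Longrightarrow> s < \<alpha>' \<Longrightarrow> a s > 0"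
    and int: "a integrable_on {\<alpha>..\<alpha>'}"
  defines "F \<equiv> \<lambda>s. integral {\<alpha>..s} a"
  shows "continuous_on {\<alpha>..\<alpha>'} F" "F \<alpha> = 0" "\<And>s. \<alpha> < s \<Longrightarrow> s < \<alpha>' \<Longrightarrow> (F has_real_derivative a s) (at s)"
    "\<And>s t. \<alpha> \<le> s \<Longrightarrow> s < t \<Longrightarrow> t \<le> \<alpha>' \<Longrightarrow> F s < F t"
proof -
  show c: "continuous_on {\<alpha>..\<alpha>'} F" unfolding F_def by (rule indefinite_integral_continuous_1[OF int])
  show "F \<alpha> = 0" by (simp add: F_def)
  show d: "(F has_real_derivative a s) (at s)" if s: "\<alpha> < s" "s < \<alpha>'" for s
  proof -
    have "isCont a s" using cont s by (simp add: continuous_on_eq_continuous_at)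
    then have "continuous (at s within ({\<alpha>..\<alpha>'} - {})) a" by (simp add: continuous_at_imp_continuous_at_within)
    then have "((\<lambda>u. integral {\<alpha>..u} a) has_vector_derivative a s) (at s within ({\<alpha>..\<alpha>'} - {}))"
      using s by (intro integral_has_vector_derivative_continuous_at[OF int]) auto
    then have "(F has_vector_derivative a s) (at s within {\<alpha><..<\<alpha>'})"
      unfolding F_def by (rule has_vector_derivative_within_subset) auto
    moreover have "at s within {\<alpha><..<\<alpha>'} = at s" using s by (intro at_within_open) auto
    ultimately show ?thesis by (simp add: has_real_derivative_iff_has_vector_derivative)
  qed
  show "F s < F t" if "\<alpha> \<le> s" "s < t" "t \<le> \<alpha>'" for s t
  proof (rule DERIV_pos_imp_increasing_open[OF that(2)])
    show "\<exists>y. (F has_real_derivative y) (at x) \<and> 0 < y" if "s < x" "x < t" for x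
      using d[of x] pos[of x] that \<open>\<alpha> \<le> s\<close> \<open>t \<le> \<alpha>'\<close> by auto
    show "continuous_on {s..t} F" using c by (rule continuous_on_subset) (use that in auto)
  qed
qed

text \<open>Match equal proportions of mass: \<open>T\<close> is the inverse of the second
  distribution function applied to the rescaled first one. Continuity is asked only inside the
  intervals, which is what concavity of the roots of the slice sizes provides.\<close>

lemma transport_map:
  fixes a b :: "real \<Rightarrow> real"
  assumes lt: "\<alpha> < \<alpha>'" and cont: "continuous_on {\<alpha><..<\<alpha>'} a" and pos: "\<And>s. \<alpha> < s \<Longrightarrow> s < \<alpha>' \<Longrightarrow> a s > 0"
    and int: "a integrable_on {\<alpha>..\<alpha>'}"
    and lt': "\<beta> < \<beta>'" and cont': "continuous_on {\<beta><..<\<beta>'} b" and pos': "\<And>s. \<beta> < s \<Longrightarrow> s < \<beta>' \<Longrightarrow> b s > 0"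
    and int': "b integrable_on {\<beta>..\<beta>'}"
  defines "V \<equiv> integral {\<alpha>..\<alpha>'} a" and "W \<equiv> integral {\<beta>..\<beta>'} b"
  shows "\<exists>T. (\<forall>s\<in>{\<alpha><..<\<alpha>'}. T s \<in> {\<beta><..<\<beta>'} \<and> (T has_real_derivative (W * a s) / (V * b (T s))) (at s))"
proof -
  define F where "F s = integral {\<alpha>..s} a" for s
  define G where "G s = integral {\<beta>..s} b" for s
  note Fp = primitive_of_density[OF lt cont pos int, folded F_def]
  note Gp = primitive_of_density[OF lt' cont' pos' int', folded G_def]
  have FV: "F \<alpha>' = V" "G \<beta>' = W" by (auto simp: F_def G_def V_def W_def)
  have "F \<alpha> < F \<alpha>'" "G \<beta> < G \<beta>'" using Fp(4)[of \<alpha> \<alpha>'] Gp(4)[of \<beta> \<beta>'] lt lt' by auto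
  moreover have F0: "F \<alpha> = 0" "G \<beta> = 0" by (auto simp: F_def G_def)
  ultimately have VW: "V > 0" "W > 0" using FV by auto
  have Ginj: "z = z'" if "G z = G z'" "z \<in> {\<beta>..\<beta>'}" "z' \<in> {\<beta>..\<beta>'}" for z z'
    using Gp(4)[of z z'] Gp(4)[of z' z] that by (cases z z' rule: linorder_cases) auto
  define H where "H y = (THE z. z \<in> {\<beta>..\<beta>'} \<and> G z = y)" for y
  have HG: "H (G z) = z" if "z \<in> {\<beta>..\<beta>'}" for z
    unfolding H_def using that Ginj by (intro the_equality) auto
  have Hin: "H y \<in> {\<beta><..<\<beta>'} \<and> G (H y) = y" if y: "0 < y" "y < W" for y
  proof -
    have "\<exists>z\<ge>\<beta>. z \<le> \<beta>' \<and> G z = y"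
      by (rule IVT') (use Gp(1) F0 FV y lt' in auto)
    then obtain z where z: "z \<in> {\<beta>..\<beta>'}" "G z = y" by auto
    then have "z \<noteq> \<beta>" "z \<noteq> \<beta>'" using F0 FV y by auto
    then show ?thesis using HG[OF z(1)] z by auto
  qed
  have Hc: "isCont H (G z)" if z: "z \<in> {\<beta><..<\<beta>'}" for z
  proof (rule isCont_inverse_function2[where f=G and a="(\<beta>+z)/2" and b="(z+\<beta>')/2"])
    show "(\<beta>+z)/2 < z" "z < (z+\<beta>')/2" using z by auto
    fix w assume w: "(\<beta>+z)/2 \<le> w" "w \<le> (z+\<beta>')/2"
    then have wi: "w \<in> {\<beta><..<\<beta>'}" using z by auto
    then show "H (G w) = w" using HG by auto
    show "isCont G w" using Gp(3)[of w] wi by (auto intro: DERIV_isCont)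
  qed
  have Hd: "(H has_real_derivative inverse (b (H y))) (at y)" if y: "0 < y" "y < W" for y
  proof (rule DERIV_inverse_function[where f=G and a=0 and b=W])
    show "(G has_real_derivative b (H y)) (at (H y))" using Gp(3) Hin[OF y] by auto
    show "b (H y) \<noteq> 0" using pos'[of "H y"] Hin[OF y] by auto
    show "isCont H y" using Hc[of "H y"] Hin[OF y] by auto
  qed (use y Hin in auto)
  define T where "T s = H (W / V * F s)" for s
  have "T s \<in> {\<beta><..<\<beta>'} \<and> (T has_real_derivative (W * a s) / (V * b (T s))) (at s)" if s: "s \<in> {\<alpha><..<\<alpha>'}" for s
  proof -
    have F1: "0 < F s" "F s < V" using Fp(4)[of \<alpha> s] Fp(4)[of s \<alpha>'] F0 FV s by auto
    then have y: "0 < W / V * F s" "W / V * F s < W" using VW by (auto simp: field_simps)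
    have "((\<lambda>s. W / V * F s) has_real_derivative W / V * a s) (at s)"
      using Fp(3)[of s] s by (intro derivative_eq_intros) auto
    from DERIV_chain2[where f=H and g="\<lambda>s. W / V * F s", OF Hd[OF y] this]
    have "((\<lambda>s. H (W / V * F s)) has_real_derivative inverse (b (H (W / V * F s))) * (W / V * a s)) (at s)"
      .
    moreover have "inverse (b (H (W / V * F s))) * (W / V * a s) = (W * a s) / (V * b (T s))"
      by (simp add: T_def field_simps)
    ultimately show ?thesis using Hin[OF y] unfolding T_def by metis
  qed
  then show ?thesis by blast
qed

text \<open>Substitute \<open>s + t * T s\<close>, which is increasing in \<open>s\<close>. With
  \<open>c\<close> the slice sizes of a Minkowski sum, a pointwise lower bound over matched slices
  becomes a lower bound for the volume of the sum; levels not hit by the substitution only add to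
  the right-hand side.\<close>

lemma transport_bound:
  fixes T a' c h :: "real \<Rightarrow> real"
  assumes T: "\<And>s. s \<in> {\<alpha><..<\<alpha>'} \<Longrightarrow> T s \<in> {\<beta><..<\<beta>'} \<and> (T has_real_derivative a' s) (at s) \<and> a' s > 0"
    and c: "integrable lborel c" "\<And>x. c x \<ge> 0" and t: "t > 0"
    and h: "h integrable_on {\<alpha><..<\<alpha>'}"
    and le: "\<And>s. s \<in> {\<alpha><..<\<alpha>'} \<Longrightarrow> h s \<le> c (s + t * T s) * (1 + t * a' s)"
  shows "integral {\<alpha><..<\<alpha>'} h \<le> integral\<^sup>L lborel c"
proof -
  let ?S = "{\<alpha><..<\<alpha>'}"
  define g where "g s = s + t * T s" for s
  have gd: "(g has_real_derivative 1 + t * a' s) (at s)" if "s \<in> ?S" for s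
    unfolding g_def using T[OF that] by (auto intro!: derivative_eq_intros)
  have gp: "1 + t * a' s > 0" if "s \<in> ?S" for s using T[OF that] t by (simp add: add_pos_pos)
  have mono: "g s < g s'" if "s \<in> ?S" "s' \<in> ?S" "s < s'" for s s'
  proof (rule DERIV_pos_imp_increasing_open[OF that(3)])
    show "\<exists>y. (g has_real_derivative y) (at x) \<and> 0 < y" if "s < x" "x < s'" for x
      using gd[of x] gp[of x] that \<open>s \<in> ?S\<close> \<open>s' \<in> ?S\<close> by auto
    show "continuous_on {s..s'} g"
      using gd that by (intro continuous_at_imp_continuous_on ballI DERIV_isCont[OF gd]) auto
  qed
  have inj: "inj_on g ?S" unfolding inj_on_def using mono by (metis linorder_neqE_linordered_idom order_less_irrefl)
  have gcont: "continuous_on ?S g" by (intro continuous_at_imp_continuous_on ballI DERIV_isCont[OF gd])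
  have "convex (g ` ?S)" using connected_continuous_image[OF gcont] by (simp add: convex_connected is_interval_connected_1 flip: is_interval_convex_1)
  moreover have "bounded (g ` ?S)"
  proof (rule bounded_subset)
    show "g ` ?S \<subseteq> {\<alpha> + t*\<beta>..\<alpha>' + t*\<beta>'}"
    proof (rule image_subsetI)
      fix s assume s: "s \<in> ?S"
      have "t*\<beta> \<le> t*T s" "t*T s \<le> t*\<beta>'" using T[OF s] t by auto
      then show "g s \<in> {\<alpha> + t*\<beta>..\<alpha>' + t*\<beta>'}" using s by (auto simp: g_def)
    qed
  qed auto
  ultimately have meas: "g ` ?S \<in> sets lebesgue" using measurable_convex fmeasurableD by blast
  have cU: "c absolutely_integrable_on UNIV"
    using c(1) unfolding set_integrable_def by (simp add: integrable_completion)
  then have cS: "c absolutely_integrable_on (g ` ?S)" by (rule set_integrable_subset) (use meas in auto)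
  have cv: "(\<lambda>x. \<bar>1 + t * a' x\<bar> * c (g x)) absolutely_integrable_on ?S \<and>
           integral ?S (\<lambda>x. \<bar>1 + t * a' x\<bar> * c (g x)) = integral (g ` ?S) c"
    by (subst has_absolute_integral_change_of_variables_1'[where g=g])
      (use gd inj cS in \<open>auto intro: has_field_derivative_at_within\<close>)
  have "integral ?S h \<le> integral ?S (\<lambda>x. \<bar>1 + t * a' x\<bar> * c (g x))"
  proof (rule integral_le[OF h])
    show "(\<lambda>x. \<bar>1 + t * a' x\<bar> * c (g x)) integrable_on ?S" using cv set_lebesgue_integral_eq_integral(1) by blast
    fix s assume s: "s \<in> ?S"
    show "h s \<le> \<bar>1 + t * a' s\<bar> * c (g s)" using le[OF s] gp[OF s] by (simp add: g_def mult.commute)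
  qed
  also have "\<dots> = integral (g ` ?S) c" using cv by blast
  also have "\<dots> \<le> integral UNIV c"
    by (rule integral_subset_le) (use cS cU c(2) set_lebesgue_integral_eq_integral(1) in auto)
  also have "\<dots> = integral\<^sup>L lborel c" using integral_lborel[OF c(1)] by simp
  finally show ?thesis .
qed

section \<open>Convex bodies, Minkowski sums and slices\<close>

definition convex_body :: "'a::euclidean_space set \<Rightarrow> bool" where
  "convex_body K \<longleftrightarrow> convex K \<and> compact K \<and> interior K \<noteq> {}"

definition msum :: "'a::real_vector set \<Rightarrow> 'a set \<Rightarrow> 'a set" where
  "msum K L = {x + y |x y. x \<in> K \<and> y \<in> L}"

definition slice :: "('a \<times> 'b) set \<Rightarrow> 'a \<Rightarrow> 'b set" where
  "slice X s = {y. (s,y) \<in> X}"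

text \<open>Parametrised by the type, so that the inequality for the type of the slices can be
  assumed when bodies one dimension higher are treated.\<close>

definition brunn_minkowski :: "'e::euclidean_space itself \<Rightarrow> bool" where
  "brunn_minkowski _ \<longleftrightarrow> (\<forall>K L::'e set. convex_body K \<longrightarrow> convex_body L \<longrightarrow>
     root DIM('e) (measure lborel K) + root DIM('e) (measure lborel L) \<le> root DIM('e) (measure lborel (msum K L)))"

lemma compact_msum: "compact K \<Longrightarrow> compact L \<Longrightarrow> compact (msum K L)" for K L :: "'a::real_normed_vector set"
  unfolding msum_def by (rule compact_sums)

lemma convex_msum: "convex K \<Longrightarrow> convex L \<Longrightarrow> convex (msum K L)"
proof -
  assume "convex K" "convex L"
  then have "convex (\<Union>x\<in>K. \<Union>y\<in>L. {x + y})" by (rule convex_sums)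
  moreover have "(\<Union>x\<in>K. \<Union>y\<in>L. {x + y}) = msum K L" by (auto simp: msum_def)
  ultimately show ?thesis by simp
qed

lemma measure_lborel_compact: "compact K \<Longrightarrow> measure lebesgue K = measure lborel K" for K :: "'a::euclidean_space set"
  by (simp add: compact_imp_closed borel_closed)

lemma measure_scale:
  fixes K :: "'a::euclidean_space set"
  assumes "compact K" "u > 0"
  shows "measure lborel ((*\<^sub>R) u ` K) = u ^ DIM('a) * measure lborel K"
proof -
  have "compact ((*\<^sub>R) u ` K)" using assms compact_scaling by blast
  then show ?thesis using measure_lebesgue_affine[of u 0 K] assms by (simp add: measure_lborel_compact)
qed

lemma measure_mono_compact:
  fixes K :: "'a::euclidean_space set"
  assumes "compact K" "compact L" "K \<subseteq> L"
  shows "measure lborel K \<le> measure lborel L"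
  using assms fmeasurable_compact[of L] by (intro measure_mono_fmeasurable) (auto simp: compact_imp_closed borel_closed)

lemma measure_body_pos: "convex_body K \<Longrightarrow> measure lborel K > 0"
proof -
  assume K: "convex_body K"
  then have "\<not> negligible K" using negligible_convex_interior[of K] by (simp add: convex_body_def)
  moreover have "K \<in> lmeasurable" using K by (simp add: convex_body_def lmeasurable_compact)
  ultimately have "measure lebesgue K \<noteq> 0" using negligible_iff_measure by blast
  then show ?thesis using K by (simp add: convex_body_def measure_lborel_compact zero_less_measure_iff)
qed

lemma convex_body_scale: "convex_body K \<Longrightarrow> u > 0 \<Longrightarrow> convex_body ((*\<^sub>R) u ` K)"
proof -
  assume K: "convex_body K" and u: "u > 0"
  have "open ((*\<^sub>R) u ` interior K)" using u by (intro open_scaling) auto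
  then have "(*\<^sub>R) u ` interior K \<subseteq> interior ((*\<^sub>R) u ` K)" by (intro interior_maximal image_mono interior_subset)
  then show ?thesis using K by (auto simp: convex_body_def convex_scaling compact_scaling)
qed

lemma slice_compact:
  fixes X :: "(real \<times> 'e::euclidean_space) set"
  assumes "compact X" shows "compact (slice X s)"
proof -
  have "slice X s = snd ` (X \<inter> ({s} \<times> UNIV))" by (force simp: slice_def)
  moreover have "compact (X \<inter> ({s} \<times> UNIV))" by (intro compact_Int_closed assms closed_Times) auto
  ultimately show ?thesis using compact_continuous_image[OF continuous_on_snd[OF continuous_on_id]] by metis
qed

lemma slice_convex:
  fixes X :: "(real \<times> 'e::euclidean_space) set"
  assumes "convex X" "0 \<le> u" "0 \<le> v" "u + v = 1" "y \<in> slice X s" "y' \<in> slice X s'"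
  shows "u *\<^sub>R y + v *\<^sub>R y' \<in> slice X (u * s + v * s')"
proof -
  have "u *\<^sub>R (s,y) + v *\<^sub>R (s',y') \<in> X" using assms unfolding slice_def by (intro convexD) auto
  then show ?thesis by (simp add: slice_def)
qed

text \<open>A level strictly between the extremes is reached by shrinking an extreme point towards
  an interior point of \<open>X\<close>; the result is interior to \<open>X\<close>, hence interior
  to its slice.\<close>

lemma fst_body:
  fixes X :: "(real \<times> 'e::euclidean_space) set"
  assumes X: "convex_body X"
  obtains \<alpha> \<alpha>' where "\<alpha> < \<alpha>'" "fst ` X = {\<alpha>..\<alpha>'}" "\<And>s. s \<in> {\<alpha><..<\<alpha>'} \<Longrightarrow> convex_body (slice X s)"
proof -
  have cX: "convex X" "compact X" using X by (auto simp: convex_body_def)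
  obtain p0 where p0: "p0 \<in> interior X" using X by (auto simp: convex_body_def)
  have "compact (fst ` X)" using cX by (intro compact_continuous_image continuous_intros)
  moreover have "connected (fst ` X)" using cX by (intro connected_continuous_image convex_connected continuous_intros)
  ultimately obtain \<alpha> \<alpha>' where ab: "fst ` X = {\<alpha>..\<alpha>'}" using connected_compact_interval_1 by metis
  obtain e where e: "e>0" "ball p0 e \<subseteq> X" using p0 mem_interior by blast
  have in1: "p0 + (d,0) \<in> X" if "\<bar>d\<bar> < e" for d
  proof -
    have "p0 + (d,0) \<in> ball p0 e" using that by (simp add: dist_norm norm_Pair)
    then show ?thesis using e by blast
  qed
  have "fst p0 + e/2 \<in> fst ` X" "fst p0 - e/2 \<in> fst ` X"
    using imageI[OF in1[of "e/2"], of fst] imageI[OF in1[of "-e/2"], of fst] e(1) by simp_all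
  then have s0: "\<alpha> < fst p0" "fst p0 < \<alpha>'" using e(1) unfolding ab by auto
  have body: "convex_body (slice X s)" if s: "s \<in> {\<alpha><..<\<alpha>'}" for s
  proof -
    obtain p1 l where p1: "p1 \<in> X" "0 < l" "l \<le> 1" "s = fst p1 - l * (fst p1 - fst p0)"
    proof (cases "s \<le> fst p0")
      case True
      have "\<alpha> \<in> fst ` X" using ab s by auto
      then obtain p1 where p1: "p1 \<in> X" "fst p1 = \<alpha>" by auto
      show ?thesis by (rule that[OF p1(1), of "(s - \<alpha>) / (fst p0 - \<alpha>)"]) (use s s0 True p1 in \<open>auto simp: field_simps\<close>)
    next
      case False
      have "\<alpha>' \<in> fst ` X" using ab s by auto
      then obtain p1 where p1: "p1 \<in> X" "fst p1 = \<alpha>'" by auto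
      show ?thesis by (rule that[OF p1(1), of "(\<alpha>' - s) / (\<alpha>' - fst p0)"]) (use s s0 False p1 in \<open>auto simp: field_simps\<close>)
    qed
    then have "p1 - l *\<^sub>R (p1 - p0) \<in> interior X" using mem_interior_convex_shrink[OF cX(1) p0 p1(1-3)] by simp
    moreover obtain y where "p1 - l *\<^sub>R (p1 - p0) = (s,y)" using p1(4) by (cases "p1 - l *\<^sub>R (p1 - p0)") (auto simp: prod_eq_iff)
    ultimately have "(s,y) \<in> interior X" by simp
    then obtain d where d: "d>0" "ball (s,y) d \<subseteq> X" using mem_interior by blast
    have "ball y d \<subseteq> slice X s" using d by (auto simp: slice_def dist_Pair_Pair subset_iff)
    then have "interior (slice X s) \<noteq> {}" using d(1) mem_interior by blast
    moreover have "convex (slice X s)"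
    proof (rule convexI)
      fix x y and u v :: real assume xy: "x \<in> slice X s" "y \<in> slice X s" and uv: "0 \<le> u" "0 \<le> v" "u + v = 1"
      have "u * s + v * s = s" using uv(3) by (metis distrib_right mult_1)
      then show "u *\<^sub>R x + v *\<^sub>R y \<in> slice X s" using slice_convex[OF cX(1) uv xy] by simp
    qed
    ultimately show ?thesis using slice_compact[OF cX(2)] by (simp add: convex_body_def)
  qed
  show ?thesis using that[OF _ ab body] s0 by linarith
qed

text \<open>Fubini with a weight depending on the level: weight 1 yields the volume, weight
  \<open>s\<close> the first moment from which the centroid is computed.\<close>

lemma slice_integral:
  fixes X :: "(real \<times> 'e::euclidean_space) set"
  assumes "compact X" and f: "continuous_on UNIV f"
  shows "integrable lborel (\<lambda>s. f s * measure lborel (slice X s))"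
    "(\<integral>s. f s * measure lborel (slice X s) \<partial>lborel) = (\<integral>p. f (fst p) * indicat_real X p \<partial>lborel)"
    "integrable lborel (\<lambda>p. f (fst p) * indicat_real X p)"
proof -
  have cont: "continuous_on X (\<lambda>p. f (fst p))"
    using continuous_on_compose2[OF f continuous_on_fst[OF continuous_on_id]] by auto
  have "integrable lborel (\<lambda>p. indicator X p *\<^sub>R f (fst p))" by (rule borel_integrable_compact[OF assms(1) cont])
  then show i: "integrable lborel (\<lambda>p. f (fst p) * indicat_real X p)" by (simp add: mult.commute)
  then have i2: "integrable (lborel \<Otimes>\<^sub>M lborel) (\<lambda>p. f (fst p) * indicat_real X p)" by (simp add: lborel_prod)
  have e: "(\<integral>y. f (fst (s,y)) * indicat_real X (s,y) \<partial>lborel) = f s * measure lborel (slice X s)" for s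
  proof -
    have "indicat_real X (s,y) = indicat_real (slice X s) y" for y by (simp add: slice_def indicator_def)
    then show ?thesis using slice_compact[OF assms(1), of s] by simp
  qed
  show "integrable lborel (\<lambda>s. f s * measure lborel (slice X s))"
    using lborel_pair.integrable_fst'[OF i2] unfolding e .
  show "(\<integral>s. f s * measure lborel (slice X s) \<partial>lborel) = (\<integral>p. f (fst p) * indicat_real X p \<partial>lborel)"
    using lborel_pair.integral_fst'[OF i2] unfolding e lborel_prod .
qed

lemma slice_area:
  fixes X :: "(real \<times> 'e::euclidean_space) set"
  assumes X: "compact X" and "fst ` X = {\<alpha>..\<alpha>'}"
  defines "a \<equiv> \<lambda>s. measure lborel (slice X s)"
  shows "integrable lborel a" "(\<integral>s. a s \<partial>lborel) = measure lborel X" "\<And>s. s \<notin> {\<alpha>..\<alpha>'} \<Longrightarrow> a s = 0"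
    "a integrable_on {\<alpha>..\<alpha>'}" "integral {\<alpha>..\<alpha>'} a = measure lborel X"
proof -
  show i: "integrable lborel a" and e: "(\<integral>s. a s \<partial>lborel) = measure lborel X"
    using slice_integral[OF X, of "\<lambda>_. 1"] X by (auto simp: a_def)
  show z: "a s = 0" if "s \<notin> {\<alpha>..\<alpha>'}" for s
  proof -
    have "slice X s = {}" using that assms(2) by (force simp: slice_def)
    then show ?thesis by (simp add: a_def)
  qed
  have "(a has_integral measure lborel X) UNIV" using has_integral_integral_lborel[OF i] e by simp
  moreover have "(\<lambda>s. if s \<in> {\<alpha>..\<alpha>'} then a s else 0) = a" using z by auto
  ultimately have "(a has_integral measure lborel X) {\<alpha>..\<alpha>'}"
    using has_integral_restrict_UNIV[of "{\<alpha>..\<alpha>'}" a "measure lborel X"] by simp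
  then show "a integrable_on {\<alpha>..\<alpha>'}" "integral {\<alpha>..\<alpha>'} a = measure lborel X" by (auto simp: integrable_on_def)
qed

text \<open>Brunn's theorem: the root of the slice size, of degree the dimension of the slice, is
  concave in the level, and concave functions are continuous on open intervals.\<close>

lemma slice_continuous:
  fixes X :: "(real \<times> 'e::euclidean_space) set"
  assumes BM: "brunn_minkowski TYPE('e)" and X: "convex_body X"
    and body: "\<And>s. s \<in> {\<alpha><..<\<alpha>'} \<Longrightarrow> convex_body (slice X s)"
  shows "continuous_on {\<alpha><..<\<alpha>'} (\<lambda>s. measure lborel (slice X s))"
proof -
  let ?d = "DIM('e)"
  have cX: "convex X" "compact X" using X by (auto simp: convex_body_def)
  define f where "f s = root ?d (measure lborel (slice X s))" for s
  have "concave_on {\<alpha><..<\<alpha>'} f"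
    unfolding concave_on_def
  proof (rule convex_onI)
    fix t x y :: real assume t: "0 < t" "t < 1" and xy: "x \<in> {\<alpha><..<\<alpha>'}" "y \<in> {\<alpha><..<\<alpha>'}"
    let ?K = "(*\<^sub>R) (1-t) ` slice X x" and ?L = "(*\<^sub>R) t ` slice X y"
    have sub: "msum ?K ?L \<subseteq> slice X ((1-t) * x + t * y)"
      using slice_convex[OF cX(1), of "1-t" t] t by (auto simp: msum_def)
    have "f x * (1-t) + f y * t = root ?d (measure lborel ?K) + root ?d (measure lborel ?L)"
      using t slice_compact[OF cX(2)] by (simp add: measure_scale real_root_mult real_root_power_cancel f_def)
    also have "\<dots> \<le> root ?d (measure lborel (msum ?K ?L))"
      using BM convex_body_scale[OF body[OF xy(1)], of "1-t"] convex_body_scale[OF body[OF xy(2)], of t] t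
      unfolding brunn_minkowski_def by auto
    also have "\<dots> \<le> f ((1-t) * x + t * y)"
      unfolding f_def by (intro real_root_le_mono measure_mono_compact sub compact_msum compact_scaling slice_compact cX) auto
    finally show "- f ((1 - t) *\<^sub>R x + t *\<^sub>R y) \<le> (1 - t) * - f x + t * - f y" by (simp add: algebra_simps)
  qed auto
  then have "continuous_on {\<alpha><..<\<alpha>'} (\<lambda>s. - f s)" unfolding concave_on_def by (intro convex_on_continuous) auto
  then have "continuous_on {\<alpha><..<\<alpha>'} (\<lambda>s. - (- f s))" by (rule continuous_on_minus)
  then have "continuous_on {\<alpha><..<\<alpha>'} f" unfolding minus_minus .
  then have "continuous_on {\<alpha><..<\<alpha>'} (\<lambda>s. f s ^ ?d)" by (rule continuous_on_power)
  moreover have "f s ^ ?d = measure lborel (slice X s)" for s by (simp add: f_def real_root_pow_pos2)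
  ultimately show ?thesis by simp
qed

lemma slice_msum:
  fixes X Y :: "(real \<times> 'e::euclidean_space) set"
  shows "msum (slice X s) (slice Y r) \<subseteq> slice (msum X Y) (s + r)"
proof
  fix z assume "z \<in> msum (slice X s) (slice Y r)"
  then obtain x y where "z = x + y" "(s,x) \<in> X" "(r,y) \<in> Y" by (auto simp: msum_def slice_def)
  then have "(s + r, z) = (s,x) + (r,y)" "(s,x) \<in> X" "(r,y) \<in> Y" by auto
  then show "z \<in> slice (msum X Y) (s + r)" unfolding slice_def msum_def by blast
qed

section \<open>The Brunn--Minkowski inequality on the line and in the plane\<close>

lemma brunn_minkowski_real: "brunn_minkowski TYPE(real)"
  unfolding brunn_minkowski_def
proof (intro allI impI)
  fix K L :: "real set" assume K: "convex_body K" and L: "convex_body L"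
  have iv: "\<exists>a b. S = {a..b} \<and> a \<le> b" if S: "convex_body S" for S :: "real set"
  proof -
    have "S \<noteq> {}" using that interior_subset[of S] by (auto simp: convex_body_def)
    moreover obtain a b where "S = {a..b}" using S connected_compact_interval_1[of S] convex_connected[of S] unfolding convex_body_def by blast
    ultimately show ?thesis by force
  qed
  obtain a b c d where KL: "K = {a..b}" "a \<le> b" "L = {c..d}" "c \<le> d" using iv[OF K] iv[OF L] by blast
  have "{a+c..b+d} \<subseteq> msum K L"
  proof
    fix x assume x: "x \<in> {a+c..b+d}"
    have "x = (min b (x - c)) + (x - min b (x - c))" by simp
    moreover have "min b (x - c) \<in> K" "x - min b (x - c) \<in> L" using x KL by (auto simp: min_def)
    ultimately show "x \<in> msum K L" unfolding msum_def by blast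
  qed
  then have "measure lborel {a+c..b+d} \<le> measure lborel (msum K L)"
    using KL by (intro measure_mono_compact compact_msum) auto
  then show "root DIM(real) (measure lborel K) + root DIM(real) (measure lborel L) \<le> root DIM(real) (measure lborel (msum K L))"
    using KL by simp
qed

text \<open>Slices are intervals, so matched slices add in length, while the transport stretches the
  levels by \<open>1 + T'\<close>. As the transport matches proportions of area, bodies of different
  areas are treated directly.\<close>

lemma brunn_minkowski_plane: "brunn_minkowski TYPE(real \<times> real)"
  unfolding brunn_minkowski_def
proof (intro allI impI)
  fix K L :: "(real \<times> real) set" assume K: "convex_body K" and L: "convex_body L"
  have cK: "compact K" and cL: "compact L" using K L by (auto simp: convex_body_def)
  obtain \<alpha> \<alpha>' where A: "\<alpha> < \<alpha>'" "fst ` K = {\<alpha>..\<alpha>'}" "\<And>s. s \<in> {\<alpha><..<\<alpha>'} \<Longrightarrow> convex_body (slice K s)" using fst_body[OF K] by metis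
  obtain \<beta> \<beta>' where B: "\<beta> < \<beta>'" "fst ` L = {\<beta>..\<beta>'}" "\<And>s. s \<in> {\<beta><..<\<beta>'} \<Longrightarrow> convex_body (slice L s)" using fst_body[OF L] by metis
  define a where "a s = measure lborel (slice K s)" for s
  define b where "b s = measure lborel (slice L s)" for s
  define c where "c s = measure lborel (slice (msum K L) s)" for s
  define V where "V = measure lborel K"
  define W where "W = measure lborel L"
  have V: "V > 0" "W > 0" using measure_body_pos K L by (auto simp: V_def W_def)
  note ap = slice_area[OF cK A(2), folded a_def V_def]
  note bp = slice_area[OF cL B(2), folded b_def W_def]
  have apos: "a s > 0" if "\<alpha> < s" "s < \<alpha>'" for s using A(3)[of s] measure_body_pos that by (simp add: a_def)
  have bpos: "b s > 0" if "\<beta> < s" "s < \<beta>'" for s using B(3)[of s] measure_body_pos that by (simp add: b_def)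
  have ac: "continuous_on {\<alpha><..<\<alpha>'} a" unfolding a_def[abs_def] by (rule slice_continuous[OF brunn_minkowski_real K A(3)])
  have bc: "continuous_on {\<beta><..<\<beta>'} b" unfolding b_def[abs_def] by (rule slice_continuous[OF brunn_minkowski_real L B(3)])
  obtain T where T: "\<And>s. s \<in> {\<alpha><..<\<alpha>'} \<Longrightarrow> T s \<in> {\<beta><..<\<beta>'} \<and> (T has_real_derivative (W * a s) / (V * b (T s))) (at s)"
    using transport_map[OF A(1) ac apos ap(4) B(1) bc bpos bp(4)] unfolding ap(5) bp(5) by blast
  have Tb: "b (T s) > 0" "a s > 0" if "s \<in> {\<alpha><..<\<alpha>'}" for s using T[OF that] bpos apos that by auto
  have ci: "integrable lborel c" "(\<integral>s. c s \<partial>lborel) = measure lborel (msum K L)" "c s \<ge> 0" for s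
    using slice_integral[OF compact_msum[OF cK cL], of "\<lambda>_. 1"] compact_msum[OF cK cL] by (auto simp: c_def[abs_def])
  \<comment> \<open>Chosen so that the integral of \<open>q * a\<close> is the square of
    \<open>sqrt V + sqrt W\<close>.\<close>
  define q where "q = (sqrt V + sqrt W)\<^sup>2 / V"
  have "integral {\<alpha><..<\<alpha>'} (\<lambda>s. q * a s) \<le> integral\<^sup>L lborel c"
  proof (rule transport_bound[where T=T and a'="\<lambda>s. (W * a s) / (V * b (T s))" and t=1 and \<beta>=\<beta> and \<beta>'=\<beta>'])
    show "T s \<in> {\<beta><..<\<beta>'} \<and> (T has_real_derivative W * a s / (V * b (T s))) (at s) \<and> 0 < W * a s / (V * b (T s))" if "s \<in> {\<alpha><..<\<alpha>'}" for s
      using T[OF that] Tb[OF that] V by auto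
    show "(\<lambda>s. q * a s) integrable_on {\<alpha><..<\<alpha>'}" using integrable_on_cmult_left[of a "{\<alpha><..<\<alpha>'}" q] ap(4) by (simp add: integrable_on_Icc_iff_Ioo)
    fix s assume s: "s \<in> {\<alpha><..<\<alpha>'}"
    have "a s + b (T s) \<le> measure lborel (msum (slice K s) (slice L (T s)))"
      using brunn_minkowski_real A(3)[OF s] B(3)[of "T s"] T[OF s] unfolding brunn_minkowski_def a_def b_def by simp
    also have "\<dots> \<le> c (s + T s)" unfolding c_def
      by (intro measure_mono_compact slice_msum compact_msum slice_compact cK cL)
    finally have 1: "a s + b (T s) \<le> c (s + T s)" .
    define x where "x = a s" define y where "y = b (T s)"
    have xy: "x > 0" "y > 0" using Tb[OF s] by (auto simp: x_def y_def)
    define v where "v = sqrt V" define w where "w = sqrt W"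
    have vw: "v > 0" "w > 0" "V = v * v" "W = w * w" using V by (auto simp: v_def w_def)
    \<comment> \<open>This square is the gap in the pointwise inequality; it vanishes when the slice
      lengths are in the ratio of the roots of the areas.\<close>
    have "0 \<le> (y * v - x * w)\<^sup>2 / (y * (v * v))" using xy vw(1,2) by simp
    also have "(y * v - x * w)\<^sup>2 / (y * (v * v)) = (x + y) * (1 + (w * w) * x / ((v * v) * y)) - (v + w)\<^sup>2 / (v * v) * x"
      using xy vw(1,2) by (simp add: divide_simps power2_eq_square) algebra
    also have "\<dots> = (x + y) * (1 + W * x / (V * y)) - q * x"
    proof -
      have "q = (v + w)\<^sup>2 / (v * v)" using V by (simp add: q_def v_def w_def)
      then show ?thesis by (simp only: vw(3,4))
    qed
    finally have "q * x \<le> (x + y) * (1 + W * x / (V * y))" by simp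
    also have "\<dots> \<le> c (s + T s) * (1 + W * x / (V * y))" using 1 xy V by (intro mult_right_mono) (auto simp: x_def y_def)
    finally show "q * a s \<le> c (s + 1 * T s) * (1 + 1 * (W * a s / (V * b (T s))))" by (simp add: x_def y_def)
  qed (use ci in auto)
  moreover have "integral {\<alpha><..<\<alpha>'} (\<lambda>s. q * a s) = q * V" using ap(5) by (simp add: integral_open_interval_real)
  ultimately have "(sqrt V + sqrt W)\<^sup>2 \<le> measure lborel (msum K L)" using ci(2) V by (simp add: q_def)
  then have "sqrt V + sqrt W \<le> sqrt (measure lborel (msum K L))" by (rule real_le_rsqrt)
  then show "root DIM(real \<times> real) (measure lborel K) + root DIM(real \<times> real) (measure lborel L) \<le> root DIM(real \<times> real) (measure lborel (msum K L))"
    by (simp add: V_def W_def sqrt_def numeral_2_eq_2)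
qed

text \<open>By the planar inequality the slice of the sum at level \<open>s + t * T s\<close> has
  area at least the square of \<open>sqrt (a s) + t * sqrt (b (T s))\<close>, and the levels stretch
  by \<open>1 + t * (a s / b (T s))\<close>. In the product the coefficient of \<open>t\<close>
  exceeds \<open>3 * a s\<close> by \<open>D s \<ge> 0\<close>, with equality only for
  \<open>a s = b (T s)\<close>. An excess of order \<open>t\<close> would beat the allowed error of
  order \<open>t\<^sup>2\<close>, so the slice areas agree and \<open>T\<close> has slope 1.\<close>

lemma slice_transport_eq:
  fixes A B :: "(real \<times> real \<times> real) set"
  assumes A: "convex_body A" and B: "convex_body B" and AB: "measure lborel A = measure lborel B"
    and K: "\<And>t. 0 < t \<Longrightarrow> t < 1 \<Longrightarrow> measure lborel (msum A ((*\<^sub>R) t ` B)) \<le> measure lborel A * (1 + 3 * t) + K * t\<^sup>2"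
    and fA: "fst ` A = {\<alpha>..\<alpha>'}" and fB: "fst ` B = {\<beta>..\<beta>'}" and lt: "\<alpha> < \<alpha>'" "\<beta> < \<beta>'"
  shows "\<exists>\<kappa>. \<forall>s\<in>{\<alpha><..<\<alpha>'}. s - \<kappa> \<in> {\<beta><..<\<beta>'} \<and> measure lborel (slice A s) = measure lborel (slice B (s - \<kappa>))"
proof -
  have cA: "compact A" and cB: "compact B" using A B by (auto simp: convex_body_def)
  have body: "convex_body (slice X s)" if X: "convex_body X" "fst ` X = {\<gamma>..\<gamma>'}" and s: "s \<in> {\<gamma><..<\<gamma>'}"
    for X :: "(real \<times> real \<times> real) set" and \<gamma> \<gamma>' s
  proof -
    obtain \<delta> \<delta>' where "fst ` X = {\<delta>..\<delta>'}" and b: "\<And>s. s \<in> {\<delta><..<\<delta>'} \<Longrightarrow> convex_body (slice X s)" using fst_body[OF X(1)] by metis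
    moreover from this have "\<delta> = \<gamma>" "\<delta>' = \<gamma>'" using X(2) s by (auto simp: Icc_eq_Icc)
    ultimately show ?thesis using s by blast
  qed
  note bA = body[OF A fA] and bB = body[OF B fB]
  define a where "a s = measure lborel (slice A s)" for s
  define b where "b s = measure lborel (slice B s)" for s
  define V where "V = measure lborel A"
  have V: "V > 0" using measure_body_pos A by (auto simp: V_def)
  note ap = slice_area[OF cA fA, folded a_def V_def]
  note bp = slice_area[OF cB fB, folded b_def AB V_def]
  have bV: "integral {\<beta>..\<beta>'} b = V" using bp(5) AB by (simp add: V_def)
  have apos: "a s > 0" if "\<alpha> < s" "s < \<alpha>'" for s using bA[of s] measure_body_pos that by (simp add: a_def)
  have bpos: "b s > 0" if "\<beta> < s" "s < \<beta>'" for s using bB[of s] measure_body_pos that by (simp add: b_def)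
  have ac: "continuous_on {\<alpha><..<\<alpha>'} a" unfolding a_def[abs_def] by (rule slice_continuous[OF brunn_minkowski_plane A bA])
  have bc: "continuous_on {\<beta><..<\<beta>'} b" unfolding b_def[abs_def] by (rule slice_continuous[OF brunn_minkowski_plane B bB])
  obtain T where T0: "\<And>s. s \<in> {\<alpha><..<\<alpha>'} \<Longrightarrow> T s \<in> {\<beta><..<\<beta>'} \<and> (T has_real_derivative (V * a s) / (V * b (T s))) (at s)"
    using transport_map[OF lt(1) ac apos ap(4) lt(2) bc bpos bp(4)] unfolding ap(5) bV by blast
  have T: "T s \<in> {\<beta><..<\<beta>'} \<and> (T has_real_derivative a s / b (T s)) (at s)" if "s \<in> {\<alpha><..<\<alpha>'}" for s
    using T0[OF that] V by simp
  have Tb: "b (T s) > 0" "a s > 0" if "s \<in> {\<alpha><..<\<alpha>'}" for s using T[OF that] bpos apos that by auto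
  \<comment> \<open>With \<open>x\<close> and \<open>y\<close> the roots of the two slice areas, the
    coefficient of \<open>t\<close> minus \<open>3 * x\<^sup>2\<close>. Its nonnegativity is the
    inequality of arithmetic and geometric means for the three terms xy, xy and x^4/y^2.\<close>
  define D where "D s = 2 * sqrt (a s * b (T s)) + (a s)\<^sup>2 / b (T s) - 3 * a s" for s
  have Dform: "D s = (sqrt (b (T s)) - sqrt (a s))\<^sup>2 * (2 * sqrt (b (T s)) + sqrt (a s)) * sqrt (a s) / b (T s)" if s: "s \<in> {\<alpha><..<\<alpha>'}" for s
  proof -
    define x where "x = sqrt (a s)" define y where "y = sqrt (b (T s))"
    have xy: "x > 0" "y > 0" "a s = x * x" "b (T s) = y * y" using Tb[OF s] by (auto simp: x_def y_def)
    have "D s = 2 * (x * y) + (x * x)\<^sup>2 / (y * y) - 3 * (x * x)"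
      unfolding D_def real_sqrt_mult x_def[symmetric] y_def[symmetric] xy(3,4) using xy by simp
    also have "\<dots> = (y - x)\<^sup>2 * (2 * y + x) * x / (y * y)"
      using xy(1,2) by (simp add: divide_simps power2_eq_square) algebra
    finally show ?thesis unfolding x_def[symmetric] y_def[symmetric] by (simp only: xy(4))
  qed
  have Dnn: "D s \<ge> 0" if s: "s \<in> {\<alpha><..<\<alpha>'}" for s
    unfolding Dform[OF s] using Tb[OF s] by simp
  have Tcont: "continuous_on {\<alpha><..<\<alpha>'} T" using T by (intro continuous_at_imp_continuous_on ballI) (auto intro: DERIV_isCont)
  have bTc: "continuous_on {\<alpha><..<\<alpha>'} (\<lambda>s. b (T s))" by (rule continuous_on_compose2[OF bc Tcont]) (use T in auto)
  have Dc: "continuous_on {\<alpha><..<\<alpha>'} D" unfolding D_def[abs_def]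
    by (intro continuous_intros ac bTc) (use Tb in fastforce)
  have eq: "a s = b (T s)" if s: "s \<in> {\<alpha><..<\<alpha>'}" for s
  proof (rule ccontr)
    assume ne: "a s \<noteq> b (T s)"
    then have "sqrt (b (T s)) - sqrt (a s) \<noteq> 0" by simp
    then have Dp: "D s > 0" unfolding Dform[OF s] using Tb[OF s] by (simp add: add_pos_pos)
    have "open {\<alpha><..<\<alpha>'}" by simp
    then have "isCont D s" using Dc s by (simp add: continuous_on_eq_continuous_at)
    then obtain d0 where d0: "d0 > 0" "\<And>r. dist r s < d0 \<Longrightarrow> dist (D r) (D s) < D s / 2"
      using Dp unfolding continuous_at_eps_delta by (metis half_gt_zero)
    define d where "d = min d0 (min (s - \<alpha>) (\<alpha>' - s)) / 2"
    have d: "d > 0" "d < d0" "d < s - \<alpha>" "d < \<alpha>' - s" using d0(1) s by (auto simp: d_def min_def)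
    define I where "I = {s - d..s + d}"
    have I: "I \<subseteq> {\<alpha><..<\<alpha>'}" using d by (auto simp: I_def)
    have DI: "D r \<ge> D s / 2" if "r \<in> I" for r
    proof -
      have "dist r s < d0" using that d by (auto simp: I_def dist_real_def)
      then show ?thesis using d0(2)[of r] by (simp add: dist_real_def abs_if split: if_splits)
    qed
    \<comment> \<open>Integral of the lower bound \<open>D s / 2\<close> over the interval
      \<open>I\<close>, whose length is \<open>2 * d\<close>.\<close>
    define \<eta> where "\<eta> = d * D s"
    have \<eta>: "\<eta> > 0" using d Dp by (simp add: \<eta>_def)
    have bound: "V * (1 + 3 * t) + t * \<eta> \<le> V * (1 + 3 * t) + K * t\<^sup>2" if t: "0 < t" "t < 1" for t
    proof -
      let ?B = "(*\<^sub>R) t ` B"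
      have cB': "compact ?B" using cB compact_scaling by blast
      have cAB: "compact (msum A ?B)" using cA cB' by (rule compact_msum)
      define c where "c s = measure lborel (slice (msum A ?B) s)" for s
      have ci: "integrable lborel c" "(\<integral>s. c s \<partial>lborel) = measure lborel (msum A ?B)" "c s \<ge> 0" for s
        using slice_integral[OF cAB, of "\<lambda>_. 1"] cAB by (auto simp: c_def[abs_def])
      define h where "h r = a r * (1 + 3 * t) + t * (D s / 2) * indicat_real I r" for r
      have "integrable lborel (indicat_real I)" unfolding I_def using d by (intro integrable_real_indicator) (auto simp: emeasure_lborel_Icc)
      then have "(indicat_real I has_integral measure lborel I) UNIV"
        using has_integral_integral_lborel[of "indicat_real I"] by simp
      then have hI: "(indicat_real I has_integral 2 * d) {\<alpha><..<\<alpha>'}"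
      proof -
        assume "(indicat_real I has_integral measure lborel I) UNIV"
        moreover have "measure lborel I = 2 * d" using d by (simp add: I_def)
        moreover have "(\<lambda>r. if r \<in> {\<alpha><..<\<alpha>'} then indicat_real I r else 0) = indicat_real I" using I by (auto simp: indicator_def fun_eq_iff subset_iff)
        ultimately show ?thesis using has_integral_restrict_UNIV[of "{\<alpha><..<\<alpha>'}" "indicat_real I" "2 * d"] by simp
      qed
      have ha: "(a has_integral V) {\<alpha><..<\<alpha>'}" using ap(4,5) by (simp add: has_integral_integral has_integral_Icc_iff_Ioo)
      have hh: "(h has_integral (V * (1 + 3 * t) + t * (D s / 2) * (2 * d))) {\<alpha><..<\<alpha>'}"
        unfolding h_def[abs_def] by (intro has_integral_add has_integral_mult_left has_integral_mult_right ha hI)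
      have "integral {\<alpha><..<\<alpha>'} h \<le> integral\<^sup>L lborel c"
      proof (rule transport_bound[where T=T and a'="\<lambda>s. a s / b (T s)" and t=t and \<beta>=\<beta> and \<beta>'=\<beta>'])
        show "T s \<in> {\<beta><..<\<beta>'} \<and> (T has_real_derivative a s / b (T s)) (at s) \<and> 0 < a s / b (T s)" if "s \<in> {\<alpha><..<\<alpha>'}" for s
          using T[OF that] Tb[OF that] by auto
        show "h integrable_on {\<alpha><..<\<alpha>'}" using hh by blast
        fix r assume r: "r \<in> {\<alpha><..<\<alpha>'}"
        define x where "x = sqrt (a r)" define y where "y = sqrt (b (T r))"
        have xy: "x > 0" "y > 0" "a r = x * x" "b (T r) = y * y" using Tb[OF r] by (auto simp: x_def y_def)
        have sl: "msum (slice A r) (slice ?B (t * T r)) \<subseteq> slice (msum A ?B) (r + t * T r)" by (rule slice_msum)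
        have slB: "slice ?B (t * T r) = (*\<^sub>R) t ` slice B (T r)"
        proof
          show "(*\<^sub>R) t ` slice B (T r) \<subseteq> slice ?B (t * T r)" by (force simp: slice_def)
          show "slice ?B (t * T r) \<subseteq> (*\<^sub>R) t ` slice B (T r)"
          proof
            fix z assume "z \<in> slice ?B (t * T r)"
            then obtain p where p: "p \<in> B" "(t * T r, z) = t *\<^sub>R p" by (auto simp: slice_def)
            then have "fst p = T r" "z = t *\<^sub>R snd p" using t by (auto simp: prod_eq_iff)
            then show "z \<in> (*\<^sub>R) t ` slice B (T r)" using p(1) by (metis (mono_tags, lifting) image_eqI mem_Collect_eq prod.collapse slice_def)
          qed
        qed
        have bT: "convex_body (slice B (T r))" using bB T[OF r] by blast
        have "sqrt (a r) + sqrt (measure lborel ((*\<^sub>R) t ` slice B (T r))) \<le> sqrt (measure lborel (msum (slice A r) ((*\<^sub>R) t ` slice B (T r))))"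
          using brunn_minkowski_plane bA[OF r] convex_body_scale[OF bT t(1)] unfolding brunn_minkowski_def a_def
          by (simp add: sqrt_def numeral_2_eq_2)
        also have "\<dots> \<le> sqrt (c (r + t * T r))"
          unfolding c_def using sl unfolding slB
          by (intro real_sqrt_le_mono measure_mono_compact compact_msum slice_compact cA cB' compact_scaling cB) auto
        also have "measure lborel ((*\<^sub>R) t ` slice B (T r)) = t\<^sup>2 * b (T r)"
          using measure_scale[OF slice_compact[OF cB] t(1), of "T r"] by (simp add: b_def power2_eq_square)
        also have "sqrt (t\<^sup>2 * b (T r)) = t * y" using t by (simp add: real_sqrt_mult y_def)
        finally have "x + t * y \<le> sqrt (c (r + t * T r))" by (simp add: x_def)
        moreover have "0 \<le> x + t * y" using xy t by simp
        ultimately have c1: "(x + t * y)\<^sup>2 \<le> c (r + t * T r)" using ci(3) by (metis power_mono real_sqrt_pow2)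
        have dr: "D r = 2 * (x * y) + (x * x)\<^sup>2 / (y * y) - 3 * (x * x)"
          unfolding D_def real_sqrt_mult x_def[symmetric] y_def[symmetric] xy(3,4) using xy by simp
        have "h r \<le> a r * (1 + 3 * t) + t * D r"
          using DI[of r] Dnn[OF r] t by (auto simp: h_def indicator_def)
        also have "\<dots> = x * x + t * (2 * (x * y) + (x * x)\<^sup>2 / (y * y))" unfolding dr xy(3) by (simp add: algebra_simps)
        also have "\<dots> \<le> (x + t * y)\<^sup>2 * (1 + t * (x * x / (y * y)))"
        proof -
          have "(x + t * y)\<^sup>2 * (1 + t * (x * x / (y * y))) = x * x + t * (2 * (x * y) + (x * x)\<^sup>2 / (y * y))
             + t\<^sup>2 * (y * y) + 2 * t\<^sup>2 * x * x * (x / y) + t ^ 3 * (x * x)"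
            using xy(1,2) by (simp add: divide_simps power2_eq_square power3_eq_cube) algebra
          moreover have "0 \<le> t\<^sup>2 * (y * y)" "0 \<le> 2 * t\<^sup>2 * x * x * (x / y)" "0 \<le> t ^ 3 * (x * x)" using xy t by auto
          ultimately show ?thesis by linarith
        qed
        also have "\<dots> \<le> c (r + t * T r) * (1 + t * (x * x / (y * y)))" using c1 t by (intro mult_right_mono) auto
        finally show "h r \<le> c (r + t * T r) * (1 + t * (a r / b (T r)))" by (simp add: xy(3,4))
      qed (use ci t in auto)
      moreover have "integral {\<alpha><..<\<alpha>'} h = V * (1 + 3 * t) + t * \<eta>" using integral_unique[OF hh] by (simp add: \<eta>_def)
      ultimately show ?thesis using ci(2) K[OF t] by (simp add: V_def)
    qed
    \<comment> \<open>So small that \<open>K * t\<close> is at most half of \<open>\<eta>\<close>;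
      the added 1 avoids division by zero.\<close>
    define t where "t = min (1/2) (\<eta> / (2 * (\<bar>K\<bar> + 1)))"
    have t: "0 < t" "t < 1" using \<eta> by (auto simp: t_def)
    have "t * \<eta> \<le> K * t\<^sup>2" using bound[OF t] by simp
    then have "\<eta> \<le> K * t" using t by (simp add: power2_eq_square)
    also have "K * t \<le> \<bar>K\<bar> * t" using t by (intro mult_right_mono) auto
    also have "\<dots> \<le> (\<bar>K\<bar> + 1) * t" using t by (simp add: algebra_simps)
    also have "\<dots> \<le> (\<bar>K\<bar> + 1) * (\<eta> / (2 * (\<bar>K\<bar> + 1)))" by (intro mult_left_mono) (auto simp: t_def)
    also have "\<dots> = \<eta> / 2" by (simp add: divide_simps)
    finally show False using \<eta> by simp
  qed
  have "((\<lambda>s. T s - s) has_field_derivative 0) (at s within {\<alpha><..<\<alpha>'})" if s: "s \<in> {\<alpha><..<\<alpha>'}" for s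
  proof -
    have "(T has_real_derivative 1) (at s)" using T[OF s] eq[OF s] Tb[OF s] by simp
    then have "((\<lambda>s. T s - s) has_field_derivative 1 - 1) (at s)" by (intro DERIV_diff DERIV_ident)
    then show ?thesis by (simp add: has_field_derivative_at_within)
  qed
  then obtain k where k: "\<And>s. s \<in> {\<alpha><..<\<alpha>'} \<Longrightarrow> T s - s = k"
    using has_field_derivative_zero_constant[of "{\<alpha><..<\<alpha>'}" "\<lambda>s. T s - s"] by auto
  have "T s = s - (- k)" if "s \<in> {\<alpha><..<\<alpha>'}" for s using k[OF that] by simp
  then show ?thesis using T eq unfolding a_def b_def by metis
qed

text \<open>The transport between the slice areas of \<open>A\<close> and \<open>-A\<close> is a translation, and it moves the first
  coordinate of the centroid of \<open>A\<close> to that of \<open>-A\<close>.\<close>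

lemma centroid_midpoint:
  fixes A :: "(real \<times> real \<times> real) set"
  assumes A: "convex_body A"
    and K: "\<And>t. 0 < t \<Longrightarrow> t < 1 \<Longrightarrow> measure lborel (msum A ((*\<^sub>R) t ` (uminus ` A))) \<le> measure lborel A * (1 + 3 * t) + K * t\<^sup>2"
    and fA: "fst ` A = {\<alpha>..\<alpha>'}" "\<alpha> < \<alpha>'"
  shows "2 * (\<integral>p. fst p * indicat_real A p \<partial>lborel) = (\<alpha> + \<alpha>') * measure lborel A"
proof -
  let ?B = "uminus ` A"
  have cA: "compact A" using A by (auto simp: convex_body_def)
  have B: "convex_body ?B" using A
    by (auto simp: convex_body_def convex_negations compact_negations interior_negations)
  have cB: "compact ?B" using B by (auto simp: convex_body_def)
  have AB: "measure lborel A = measure lborel ?B"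
    using measure_lebesgue_affine[of "-1" 0 A] cA cB by (simp add: measure_lborel_compact)
  have fB: "fst ` ?B = {-\<alpha>'..-\<alpha>}"
  proof -
    have "fst ` ?B = uminus ` (fst ` A)" by (simp add: image_image)
    then show ?thesis unfolding fA by simp
  qed
  have sl: "measure lborel (slice ?B s) = measure lborel (slice A (-s))" for s
  proof -
    have "slice ?B s = uminus ` slice A (-s)"
    proof (intro set_eqI iffI)
      fix y assume "y \<in> slice ?B s"
      then obtain p where "p \<in> A" "(s,y) = - p" by (auto simp: slice_def)
      then have "(-s,-y) \<in> A" by (metis minus_equation_iff uminus_Pair)
      then show "y \<in> uminus ` slice A (-s)" by (auto simp: slice_def intro!: image_eqI[of _ _ "-y"])
    next
      fix y assume "y \<in> uminus ` slice A (-s)"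
      then have "(-s,-y) \<in> A" by (auto simp: slice_def)
      then show "y \<in> slice ?B s" by (auto simp: slice_def intro!: image_eqI[of _ _ "(-s,-y)"])
    qed
    moreover have "compact (slice A (-s))" by (rule slice_compact[OF cA])
    ultimately show ?thesis
      using measure_lebesgue_affine[of "-1" 0 "slice A (-s)"] slice_compact[OF cB, of s] by (simp add: measure_lborel_compact)
  qed
  have l: "-\<alpha>' < -\<alpha>" using fA(2) by simp
  obtain \<kappa> where "\<forall>s\<in>{\<alpha><..<\<alpha>'}. s - \<kappa> \<in> {-\<alpha>'<..<-\<alpha>} \<and> measure lborel (slice A s) = measure lborel (slice ?B (s - \<kappa>))"
    using slice_transport_eq[OF A B AB K fA(1) fB fA(2) l] by blast
  then have \<kappa>: "\<And>s. s\<in>{\<alpha><..<\<alpha>'} \<Longrightarrow> s - \<kappa> \<in> {-\<alpha>'<..<-\<alpha>} \<and> measure lborel (slice A s) = measure lborel (slice ?B (s - \<kappa>))" by blast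
  \<comment> \<open>The open range of levels of \<open>A\<close>, shifted by
    \<open>\<kappa>\<close>, must fit into that of \<open>-A\<close>, which has the same length;
    approaching the two ends pins \<open>\<kappa>\<close> down.\<close>
  have "\<kappa> = \<alpha> + \<alpha>'"
  proof (rule antisym)
    have "\<kappa> \<le> \<alpha> + \<alpha>' + e" if e: "e > 0" for e
    proof -
      obtain \<delta> where \<delta>: "0 < \<delta>" "\<delta> < min e (\<alpha>'-\<alpha>)" using dense[of 0 "min e (\<alpha>'-\<alpha>)"] e fA(2) by auto
      then have "\<alpha> + \<delta> \<in> {\<alpha><..<\<alpha>'}" by auto
      from \<kappa>[OF this] show ?thesis using \<delta> by auto
    qed
    then show "\<kappa> \<le> \<alpha> + \<alpha>'" by (rule field_le_epsilon)
    have "\<alpha> + \<alpha>' \<le> \<kappa> + e" if e: "e > 0" for e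
    proof -
      obtain \<delta> where \<delta>: "0 < \<delta>" "\<delta> < min e (\<alpha>'-\<alpha>)" using dense[of 0 "min e (\<alpha>'-\<alpha>)"] e fA(2) by auto
      then have "\<alpha>' - \<delta> \<in> {\<alpha><..<\<alpha>'}" by auto
      from \<kappa>[OF this] show ?thesis using \<delta> by auto
    qed
    then show "\<alpha> + \<alpha>' \<le> \<kappa>" by (rule field_le_epsilon)
  qed
  define a where "a s = measure lborel (slice A s)" for s
  \<comment> \<open>The end levels are excluded, as the transport compares slices strictly inside
    only; two levels do not affect the integral.\<close>
  have sym: "a s = a (\<kappa> - s)" if "s \<notin> {\<alpha>,\<alpha>'}" for s
  proof (cases "s \<in> {\<alpha><..<\<alpha>'}")
    case True
    then show ?thesis using \<kappa>[OF True] by (simp add: sl a_def)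
  next
    case False
    then have "s \<notin> {\<alpha>..\<alpha>'}" "\<kappa> - s \<notin> {\<alpha>..\<alpha>'}" using that \<open>\<kappa> = \<alpha> + \<alpha>'\<close> by auto
    then show ?thesis using slice_area(3)[OF cA fA(1)] by (simp add: a_def)
  qed
  note i1 = slice_integral[OF cA, of "\<lambda>s. s", folded a_def] and i0 = slice_area[OF cA fA(1), folded a_def]
  \<comment> \<open>Substituting \<open>\<kappa> - s\<close> for \<open>s\<close> compares the first
    moment with that of the mirrored, hence equal, density.\<close>
  have "(\<integral>s. s * a s \<partial>lborel) = (\<integral>s. (\<kappa> - s) * a (\<kappa> - s) \<partial>lborel)"
    using lborel_integral_real_affine[of "-1" "\<lambda>s. s * a s" \<kappa>] by simp
  also have "\<dots> = (\<integral>s. (\<kappa> - s) * a s \<partial>lborel)"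
  proof (rule integral_cong_AE)
    have m: "a \<in> borel_measurable borel" using i0(1) by simp
    then show "(\<lambda>s. (\<kappa> - s) * a (\<kappa> - s)) \<in> borel_measurable lborel"
      by (intro borel_measurable_times) (auto intro: measurable_compose[OF _ m])
    show "(\<lambda>s. (\<kappa> - s) * a s) \<in> borel_measurable lborel" using m by (intro borel_measurable_times) auto
    have "AE s in lborel. s \<notin> {\<alpha>,\<alpha>'}" by (intro AE_not_in) (auto intro: countable_imp_null_set_lborel)
    then show "AE s in lborel. (\<kappa> - s) * a (\<kappa> - s) = (\<kappa> - s) * a s" by (rule eventually_mono) (use sym in auto)
  qed
  also have "\<dots> = (\<integral>s. \<kappa> * a s - s * a s \<partial>lborel)" by (simp add: algebra_simps)
  also have "\<dots> = \<kappa> * measure lborel A - (\<integral>s. s * a s \<partial>lborel)"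
    using i0(1,2) i1(1) by (subst Bochner_Integration.integral_diff) (auto simp: continuous_on_id)
  finally have "2 * (\<integral>s. s * a s \<partial>lborel) = \<kappa> * measure lborel A" by simp
  then show ?thesis using i1(2) \<open>\<kappa> = \<alpha> + \<alpha>'\<close> by (simp add: continuous_on_id)
qed

text \<open>A reflected point outside \<open>K\<close> could be strictly separated from
  \<open>K\<close>, against the assumed bound in the separating direction. Invariance is thus
  reduced to comparing linear functionals one direction at a time.\<close>

lemma reflect_invariant:
  fixes K :: "'a::euclidean_space set"
  assumes K: "closed K" "convex K" and sup: "\<And>u x. x \<in> K \<Longrightarrow> \<exists>y\<in>K. u \<bullet> (2 *\<^sub>R c - x) \<le> u \<bullet> y"
  shows "(\<lambda>x. 2 *\<^sub>R c - x) ` K = K"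
proof -
  have mem: "2 *\<^sub>R c - x \<in> K" if x: "x \<in> K" for x
  proof (rule ccontr)
    assume "2 *\<^sub>R c - x \<notin> K"
    then obtain u b where u: "u \<bullet> (2 *\<^sub>R c - x) < b" "\<And>y. y \<in> K \<Longrightarrow> u \<bullet> y > b"
      using separating_hyperplane_closed_point[OF K(2,1)] by metis
    obtain y where "y \<in> K" "(-u) \<bullet> (2 *\<^sub>R c - x) \<le> (-u) \<bullet> y" using sup[OF x] by blast
    then show False using u(1) u(2)[of y] by simp
  qed
  show ?thesis
  proof
    show "(\<lambda>x. 2 *\<^sub>R c - x) ` K \<subseteq> K" using mem by auto
    show "K \<subseteq> (\<lambda>x. 2 *\<^sub>R c - x) ` K"
    proof
      fix x assume "x \<in> K"
      then show "x \<in> (\<lambda>x. 2 *\<^sub>R c - x) ` K" using mem by (intro image_eqI[of _ _ "2 *\<^sub>R c - x"]) auto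
    qed
  qed
qed

section \<open>Arbitrary directions turned into the first coordinate\<close>

lemma msum_linear_image:
  assumes "linear f" shows "msum (f ` K) (f ` L) = f ` msum K L"
proof
  show "msum (f ` K) (f ` L) \<subseteq> f ` msum K L"
  proof
    fix z assume "z \<in> msum (f ` K) (f ` L)"
    then obtain x y where "x \<in> K" "y \<in> L" "z = f x + f y" unfolding msum_def by blast
    then have "x + y \<in> msum K L" "z = f (x + y)" using assms by (auto simp: msum_def linear_add)
    then show "z \<in> f ` msum K L" by blast
  qed
  show "f ` msum K L \<subseteq> msum (f ` K) (f ` L)"
  proof
    fix z assume "z \<in> f ` msum K L"
    then obtain x y where "x \<in> K" "y \<in> L" "z = f (x + y)" unfolding msum_def by blast
    then have "z = f x + f y" using assms by (simp add: linear_add)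
    then show "z \<in> msum (f ` K) (f ` L)" unfolding msum_def using \<open>x \<in> K\<close> \<open>y \<in> L\<close> by blast
  qed
qed

text \<open>Slicing uses a product type, whereas the body lives in \<open>real^3\<close>. This
  relabelling of coordinates preserves volume, as boxes correspond to boxes.\<close>

definition to_prod :: "real^3 \<Rightarrow> real \<times> real \<times> real" where
  "to_prod x = (x $ 1, x $ 2, x $ 3)"

lemma distr_to_prod: "distr lborel borel to_prod = lborel"
proof (rule lborel_eqI[symmetric])
  have m: "to_prod \<in> borel_measurable borel" unfolding to_prod_def[abs_def] by measurable
  fix l u :: "real \<times> real \<times> real" assume lu: "\<And>b. b \<in> Basis \<Longrightarrow> l \<bullet> b \<le> u \<bullet> b"
  obtain l1 l2 l3 u1 u2 u3 where e: "l = (l1,l2,l3)" "u = (u1,u2,u3)" by (metis prod.exhaust)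
  have le: "l1 \<le> u1" "l2 \<le> u2" "l3 \<le> u3"
    using lu[of "(1,0,0)"] lu[of "(0,1,0)"] lu[of "(0,0,1)"] by (auto simp: e Basis_prod_def zero_prod_def)
  have "to_prod -` box l u = box (vector [l1,l2,l3]) (vector [u1,u2,u3])"
  proof -
    have "(x,y,z) \<in> box l u \<longleftrightarrow> l1 < x \<and> x < u1 \<and> l2 < y \<and> y < u2 \<and> l3 < z \<and> z < u3" for x y z
      unfolding e by (auto simp: mem_box Basis_prod_def zero_prod_def ball_Un)
    then show ?thesis by (auto simp: to_prod_def mem_box_cart forall_3)
  qed
  then have "emeasure (distr lborel borel to_prod) (box l u) = emeasure lborel (box (vector [l1,l2,l3]) (vector [u1,u2,u3]) :: (real^3) set)"
    using m by (subst emeasure_distr) auto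
  also have "\<dots> = ennreal (\<Prod>b\<in>Basis. (vector [u1,u2,u3] - vector [l1,l2,l3] :: real^3) \<bullet> b)"
  proof (rule emeasure_lborel_box)
    fix b :: "real^3" assume "b \<in> Basis"
    then obtain i where "b = axis i 1" by (auto simp: Basis_vec_def)
    then show "vector [l1,l2,l3] \<bullet> b \<le> vector [u1,u2,u3] \<bullet> b" using le exhaust_3[of i] by (auto simp: inner_axis)
  qed
  also have "(\<Prod>b\<in>Basis. (vector [u1,u2,u3] - vector [l1,l2,l3] :: real^3) \<bullet> b) = (u1 - l1) * (u2 - l2) * (u3 - l3)"
  proof -
    have B: "(Basis :: (real^3) set) = (\<lambda>i. axis i 1) ` UNIV" by (auto simp: Basis_vec_def)
    have "inj (\<lambda>i. axis i (1::real) :: real^3)" by (auto simp: inj_on_def axis_eq_axis)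
    then have "(\<Prod>b\<in>Basis. (vector [u1,u2,u3] - vector [l1,l2,l3] :: real^3) \<bullet> b) = (\<Prod>i\<in>(UNIV::3 set). (vector [u1,u2,u3] - vector [l1,l2,l3] :: real^3) $ i)"
      unfolding B by (subst prod.reindex) (auto simp: inner_axis)
    moreover have "prod f (UNIV::3 set) = f 1 * f 2 * f 3" for f :: "3 \<Rightarrow> real"
      unfolding UNIV_3 by (simp add: ac_simps)
    ultimately show ?thesis by simp
  qed
  also have "(u1 - l1) * (u2 - l2) * (u3 - l3) = (\<Prod>b\<in>Basis. (u - l) \<bullet> b)"
  proof -
    have B: "(Basis :: (real \<times> real \<times> real) set) = {(1,0,0), (0,1,0), (0,0,1)}"
      by (auto simp: Basis_prod_def zero_prod_def)
    show ?thesis unfolding e B by simp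
  qed
  finally show "emeasure (distr lborel borel to_prod) (box l u) = ennreal (\<Prod>b\<in>Basis. (u - l) \<bullet> b)" .
qed simp

lemma distr_orthogonal:
  fixes f :: "real^3 \<Rightarrow> real^3"
  assumes f: "orthogonal_transformation f"
  shows "distr lborel borel f = lborel"
proof (rule lborel_eqI[symmetric])
  have lin: "linear f" using f by (simp add: orthogonal_transformation_linear)
  have m: "f \<in> borel_measurable borel" using lin linear_continuous_on linear_conv_bounded_linear borel_measurable_continuous_onI by blast
  have bij: "bij f" using f by (rule orthogonal_transformation_bij)
  have inv: "orthogonal_transformation (inv f)" using f by (rule orthogonal_transformation_inv)
  fix l u :: "real^3" assume lu: "\<And>b. b \<in> Basis \<Longrightarrow> l \<bullet> b \<le> u \<bullet> b"
  have "f -` box l u = inv f ` box l u" using bij by (simp add: bij_vimage_eq_inv_image)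
  moreover have "inv f ` box l u \<in> sets borel" using m calculation by (metis borel_open measurable_sets_borel open_box)
  moreover have "emeasure lebesgue (inv f ` box l u) = emeasure lebesgue (box l u)"
    using measurable_orthogonal_image[OF inv, of "box l u"] measure_orthogonal_image[OF inv, of "box l u"]
    by (simp add: emeasure_eq_measure2)
  ultimately have "emeasure (distr lborel borel f) (box l u) = emeasure lborel (box l u)"
    using m by (subst emeasure_distr) auto
  then show "emeasure (distr lborel borel f) (box l u) = ennreal (\<Prod>b\<in>Basis. (u - l) \<bullet> b)"
    using lu by simp
qed simp

text \<open>Rotate a unit direction \<open>u\<close> to the first axis and apply the centroid
  statement there: the centroid lies midway between the two support planes orthogonal to
  \<open>u\<close>. Hence reflection in the centroid moves no point of \<open>A\<close> beyond a
  support plane, whatever the direction.\<close>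

theorem symmetric_of_growth:
  fixes A :: "(real^3) set"
  assumes A: "convex_body A"
    and K: "\<And>t. 0 < t \<Longrightarrow> t < 1 \<Longrightarrow> measure lborel (msum A ((*\<^sub>R) t ` (uminus ` A))) \<le> measure lborel A * (1 + 3 * t) + K * t\<^sup>2"
  shows "\<exists>c. (\<lambda>x. 2 *\<^sub>R c - x) ` A = A"
proof -
  have cA: "compact A" "convex A" "closed A" using A by (auto simp: convex_body_def compact_imp_closed)
  define M where "M = measure lborel A"
  have M: "M > 0" using measure_body_pos[OF A] by (simp add: M_def)
  \<comment> \<open>The centroid: a single point that serves all directions.\<close>
  define g where "g = (1 / M) *\<^sub>R (\<integral>x. indicat_real A x *\<^sub>R x \<partial>lborel)"
  have intA: "integrable lborel (\<lambda>x. indicat_real A x *\<^sub>R x)"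
    by (rule borel_integrable_compact[OF cA(1)]) (intro continuous_intros)
  have main: "\<exists>y\<in>A. u \<bullet> (2 *\<^sub>R g - x) \<le> u \<bullet> y" if x: "x \<in> A" and u: "norm u = 1" for u x :: "real^3"
  proof -
    obtain f :: "real^3 \<Rightarrow> real^3" where f: "orthogonal_transformation f" "f u = axis 1 1"
      using orthogonal_transformation_exists[of u "axis 1 1"] u by (metis norm_axis_1)
    define \<psi> where "\<psi> = to_prod \<circ> f"
    have lin: "linear f" using f(1) by (simp add: orthogonal_transformation_linear)
    have fm: "f \<in> borel_measurable borel" using lin linear_continuous_on linear_conv_bounded_linear borel_measurable_continuous_onI by blast
    have pm: "to_prod \<in> borel_measurable borel" unfolding to_prod_def[abs_def] by measurable
    have \<psi>m: "\<psi> \<in> borel_measurable borel" unfolding \<psi>_def using fm pm by (rule measurable_comp)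
    have D: "distr lborel borel \<psi> = lborel"
    proof -
      have "distr lborel borel \<psi> = distr (distr lborel borel f) borel to_prod"
        unfolding \<psi>_def using fm pm by (subst distr_distr) auto
      then show ?thesis by (simp add: distr_orthogonal[OF f(1)] distr_to_prod)
    qed
    have pl: "linear to_prod" by (rule linearI) (auto simp: to_prod_def)
    have \<psi>l: "linear \<psi>" unfolding \<psi>_def using lin pl by (rule linear_compose)
    have pinj: "inj to_prod" by (rule injI) (auto simp: to_prod_def vec_eq_iff forall_3)
    have psurj: "surj to_prod"
    proof (rule surjI[where f="\<lambda>(a,b,c). vector [a,b,c]"])
    qed (auto simp: to_prod_def)
    have finj: "bij f" using f(1) by (rule orthogonal_transformation_bij)
    have \<psi>b: "bij \<psi>" unfolding \<psi>_def using finj pinj psurj by (intro bij_comp) (auto simp: bij_def)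
    have \<psi>i: "inj \<psi>" using \<psi>b by (rule bij_is_inj)
    have cont: "continuous_on S \<psi>" for S using \<psi>l by (rule linear_continuous_on[OF linear_conv_bounded_linear[THEN iffD1]])
    have fst: "fst (\<psi> z) = u \<bullet> z" for z
    proof -
      have "fst (\<psi> z) = f z \<bullet> axis 1 1" by (simp add: \<psi>_def to_prod_def inner_axis)
      also have "\<dots> = f z \<bullet> f u" using f(2) by simp
      also have "\<dots> = z \<bullet> u" using f(1) by (simp add: orthogonal_transformation_def)
      finally show ?thesis by (simp add: inner_commute)
    qed
    have meas: "measure lborel (\<psi> ` S) = measure lborel S" if "compact S" for S
    proof -
      have c: "compact (\<psi> ` S)" using that cont by (intro compact_continuous_image)
      have "measure lborel (\<psi> ` S) = measure (distr lborel borel \<psi>) (\<psi> ` S)" by (simp only: D)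
      also have "\<dots> = measure lborel (\<psi> -` (\<psi> ` S))"
        using \<psi>m c by (subst measure_distr) (auto simp: compact_imp_closed borel_closed)
      also have "\<psi> -` (\<psi> ` S) = S" by (rule inj_vimage_image_eq[OF \<psi>i])
      finally show ?thesis .
    qed
    have body: "convex_body (\<psi> ` A)"
    proof -
      have "interior (\<psi> ` A) = \<psi> ` interior A" using \<psi>l \<psi>b by (intro interior_bijective_linear_image)
      then show ?thesis using A cont \<psi>l by (auto simp: convex_body_def compact_continuous_image convex_linear_image)
    qed
    obtain \<alpha> \<alpha>' where fA: "fst ` \<psi> ` A = {\<alpha>..\<alpha>'}" "\<alpha> < \<alpha>'" using fst_body[OF body] by metis
    have K\<psi>: "measure lborel (msum (\<psi> ` A) ((*\<^sub>R) t ` (uminus ` (\<psi> ` A)))) \<le> measure lborel (\<psi> ` A) * (1 + 3 * t) + K * t\<^sup>2"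
      if t: "0 < t" "t < 1" for t
    proof -
      have "(*\<^sub>R) t ` (uminus ` (\<psi> ` A)) = \<psi> ` ((*\<^sub>R) t ` (uminus ` A))"
        using \<psi>l by (simp add: image_image linear_scale linear_neg)
      then have "msum (\<psi> ` A) ((*\<^sub>R) t ` (uminus ` (\<psi> ` A))) = \<psi> ` msum A ((*\<^sub>R) t ` (uminus ` A))"
        using msum_linear_image[OF \<psi>l] by metis
      moreover have "compact (msum A ((*\<^sub>R) t ` (uminus ` A)))"
        by (intro compact_msum compact_scaling compact_negations cA)
      ultimately show ?thesis using K[OF t] meas cA(1) by simp
    qed
    have "2 * (\<integral>p. fst p * indicat_real (\<psi> ` A) p \<partial>lborel) = (\<alpha> + \<alpha>') * M"
      using centroid_midpoint[OF body K\<psi> fA] meas[OF cA(1)] by (simp add: M_def)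
    also have "(\<integral>p. fst p * indicat_real (\<psi> ` A) p \<partial>lborel) = (\<integral>p. fst p * indicat_real (\<psi> ` A) p \<partial>(distr lborel borel \<psi>))"
      by (simp only: D)
    also have "\<dots> = (\<integral>z. fst (\<psi> z) * indicat_real (\<psi> ` A) (\<psi> z) \<partial>lborel)"
    proof (rule integral_distr)
      show "\<psi> \<in> lborel \<rightarrow>\<^sub>M borel" using \<psi>m by simp
      have "closed (\<psi> ` A)" using cA(1) cont by (intro compact_imp_closed compact_continuous_image)
      then show "(\<lambda>p. fst p * indicat_real (\<psi> ` A) p) \<in> borel_measurable borel"
        by (intro borel_measurable_times borel_measurable_indicator borel_closed) (auto intro!: borel_measurable_continuous_onI continuous_intros)
    qed
    also have "\<dots> = (\<integral>z. u \<bullet> (indicat_real A z *\<^sub>R z) \<partial>lborel)"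
      by (intro Bochner_Integration.integral_cong) (auto simp: fst indicator_def inj_image_mem_iff[OF \<psi>i])
    also have "\<dots> = u \<bullet> (\<integral>z. indicat_real A z *\<^sub>R z \<partial>lborel)" by (rule integral_inner_right) (rule intA)
    also have "\<dots> = M * (u \<bullet> g)" using M by (simp add: g_def)
    finally have c: "\<alpha> + \<alpha>' = 2 * (u \<bullet> g)" using M by simp
    have "u \<bullet> x \<in> {\<alpha>..\<alpha>'}" using imageI[OF imageI[OF x, of \<psi>], of fst] unfolding fA(1) fst .
    moreover have "\<alpha>' \<in> fst ` \<psi> ` A" using fA by auto
    then obtain y where y: "y \<in> A" "u \<bullet> y = \<alpha>'" using fst by auto
    moreover have "u \<bullet> (2 *\<^sub>R g - x) = \<alpha> + \<alpha>' - u \<bullet> x" using c by (simp add: inner_diff_right)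
    ultimately have "u \<bullet> (2 *\<^sub>R g - x) \<le> u \<bullet> y" by auto
    then show ?thesis using y(1) by blast
  qed
  have "\<exists>y\<in>A. u \<bullet> (2 *\<^sub>R g - x) \<le> u \<bullet> y" if x: "x \<in> A" for u x :: "real^3"
  proof (cases "u = 0")
    case False
    then obtain y where y: "y \<in> A" "(u /\<^sub>R norm u) \<bullet> (2 *\<^sub>R g - x) \<le> (u /\<^sub>R norm u) \<bullet> y" using main[OF x, of "u /\<^sub>R norm u"] by auto
    then have "u \<bullet> (2 *\<^sub>R g - x) \<le> u \<bullet> y" using False by (simp add: divide_simps)
    then show ?thesis using y by blast
  qed (use x in auto)
  then show ?thesis using reflect_invariant[OF cA(3,2)] by blast
qed

text \<open>Nonemptiness of \<open>irint\<close> detects the top dimension. In the flat case the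
  differences of points of \<open>P\<close> span a proper subspace of \<open>V\<close>, and a
  nonzero vector of \<open>V\<close> orthogonal to it is the normal \<open>m\<close>.\<close>

lemma aff_dim_vpoly:
  assumes V: "subspace V" and P: "vpoly V P"
  shows "aff_dim P \<le> int (dim V)"
    and "aff_dim P = int (dim V) \<Longrightarrow> irint V P \<noteq> {}"
    and "irint V P \<noteq> {} \<Longrightarrow> aff_dim P = int (dim V)"
    and "irint V P = {} \<Longrightarrow> \<exists>m\<in>V. m \<noteq> 0 \<and> (\<forall>x\<in>P. \<forall>y\<in>P. m \<bullet> x = m \<bullet> y)"
proof -
  define S where "S p = (\<lambda>x. - p + x) ` P" for p
  have ne: "P \<noteq> {}" and cv: "convex P" and PV: "\<And>x y. x\<in>P \<Longrightarrow> y\<in>P \<Longrightarrow> y - x \<in> V"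
    using P by (auto simp: vpoly_def polytope_imp_convex)
  have SV: "S p \<subseteq> V" if "p \<in> P" for p using PV that by (auto simp: S_def)
  have ad: "aff_dim P = int (dim (S p))" if "p\<in>P" for p
    unfolding S_def by (rule aff_dim_eq_dim[OF hull_inc[OF that]])
  obtain p where p: "p \<in> P" using ne by blast
  show le: "aff_dim P \<le> int (dim V)" using ad[OF p] dim_subset[OF SV[OF p]] by simp
  have sp: "span (S q) = V" if "q \<in> P" "aff_dim P = int (dim V)" for q
  proof (rule subspace_dim_equal[OF subspace_span V])
    show "span (S q) \<subseteq> V" using SV[OF that(1)] V by (rule span_minimal)
    show "dim V \<le> dim (span (S q))" using ad[OF that(1)] that(2) by simp
  qed
  show 2: "irint V P \<noteq> {}" if d: "aff_dim P = int (dim V)"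
  proof -
    \<comment> \<open>In the top dimension the affine hull is the whole coset of \<open>V\<close>,
      so a point of the relative interior qualifies.\<close>
    obtain z where z: "z \<in> rel_interior P" using rel_interior_eq_empty[OF cv] ne by blast
    then obtain e where e: "z\<in>P" "e>0" "ball z e \<inter> affine hull P \<subseteq> P" by (auto simp: mem_rel_interior_ball)
    have "affine hull P = (+) z ` span ((\<lambda>x. - z + x) ` (P - {z}))" by (rule affine_hull_span2[OF e(1)])
    also have "span ((\<lambda>x. - z + x) ` (P - {z})) = span (S z)"
    proof -
      have "S z = insert 0 ((\<lambda>x. - z + x) ` (P - {z}))" using e(1) by (auto simp: S_def)
      then show ?thesis by (simp add: span_insert_0)
    qed
    finally have ah: "affine hull P = (+) z ` V" using sp[OF e(1) d] by simp
    have "z + v \<in> P" if "v \<in> V" "norm v < e" for v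
    proof -
      have "z + v \<in> ball z e \<inter> affine hull P" using that by (auto simp: ah dist_norm)
      then show ?thesis using e(3) by blast
    qed
    then have "z \<in> irint V P" using e by (auto simp: irint_def)
    then show ?thesis by blast
  qed
  show "aff_dim P = int (dim V)" if ni: "irint V P \<noteq> {}"
  proof -
    obtain x e where x: "x\<in>P" "e>0" "\<And>v. v\<in>V \<Longrightarrow> norm v < e \<Longrightarrow> x + v \<in> P" using ni by (auto simp: irint_def)
    have "V \<subseteq> span (S x)"
    proof
      fix v assume v: "v \<in> V"
      define c where "c = e / (2 * (norm v + 1))"
      have np: "2 * (norm v + 1) > 0" by (simp add: add_nonneg_pos)
      have c: "c > 0" using x(2) np by (simp add: c_def)
      have "norm v < 2 * (norm v + 1)" using norm_ge_zero[of v] by (smt (verit))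
      then have "e * norm v < e * (2 * (norm v + 1))" using x(2) by (rule mult_strict_left_mono)
      then have "norm (c *\<^sub>R v) < e" using np c x(2) unfolding c_def by (simp add: pos_divide_less_eq)
      then have "x + c *\<^sub>R v \<in> P" using x(3) v V by (simp add: subspace_scale)
      then have "c *\<^sub>R v \<in> S x" by (force simp: S_def)
      then have "(1/c) *\<^sub>R (c *\<^sub>R v) \<in> span (S x)" by (intro span_scale span_base)
      then show "v \<in> span (S x)" using c by simp
    qed
    from dim_subset[OF this] have "dim V \<le> dim (S x)" by simp
    then show ?thesis using le ad[OF x(1)] by simp
  qed
  show "\<exists>m\<in>V. m \<noteq> 0 \<and> (\<forall>x\<in>P. \<forall>y\<in>P. m \<bullet> x = m \<bullet> y)" if "irint V P = {}"
  proof -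
    have "aff_dim P \<noteq> int (dim V)" using that 2 by blast
    then have "span (S p) \<noteq> V" using ad[OF p] dim_span[of "S p"] by auto
    moreover have sV: "span V = V" using V span_eq_iff by blast
    moreover have "span (S p) \<subseteq> V" using SV[OF p] V by (rule span_minimal)
    ultimately have "span (S p) \<subset> span V" unfolding sV by blast
    then obtain m where m: "m \<noteq> 0" "m \<in> span V" "\<And>y. y \<in> span (S p) \<Longrightarrow> orthogonal m y"
      using orthogonal_to_subspace_exists_gen[OF \<open>span (S p) \<subset> span V\<close>] by blast
    have "m \<bullet> x = m \<bullet> p" if "x \<in> P" for x
    proof -
      have "- p + x \<in> span (S p)" using that by (intro span_base) (auto simp: S_def)
      then show ?thesis using m(3)[of "- p + x"] by (simp add: orthogonal_def inner_diff_right)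
    qed
    moreover have "m \<in> V" using m(2) unfolding sV .
    ultimately show ?thesis using m(1) by (intro bexI[of _ m]) auto
  qed
qed

text \<open>A small step from \<open>x\<close> along \<open>m\<close> itself stays in
  \<open>P\<close> and would change the value if \<open>m\<close> were nonzero. This is the
  uniqueness principle by which normals are identified later.\<close>

lemma irint_not_flat:
  assumes V: "subspace V" and x: "x \<in> irint V P" and m: "m \<in> V" "\<And>y. y\<in>P \<Longrightarrow> m \<bullet> y = m \<bullet> x"
  shows "m = 0"
proof (rule ccontr)
  assume m0: "m \<noteq> 0"
  obtain e where e: "e>0" "\<And>v. v\<in>V \<Longrightarrow> norm v < e \<Longrightarrow> x + v \<in> P" using x by (auto simp: irint_def)
  define v where "v = (e / (2 * norm m)) *\<^sub>R m"
  have "v \<in> V" using V m(1) by (simp add: v_def subspace_scale)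
  moreover have "norm v < e" using m0 e(1) by (simp add: v_def)
  ultimately have "m \<bullet> (x + v) = m \<bullet> x" using e(2) m(2) by blast
  then show False using m0 e(1) by (simp add: v_def inner_add_right)
qed

section \<open>Volume growth of polytopes and symmetry\<close>

definition supp :: "'a::euclidean_space set \<Rightarrow> 'a \<Rightarrow> real" where
  "supp A u = Sup ((\<bullet>) u ` A)"

lemma supp_ge:
  assumes "compact A" "x \<in> A" shows "u \<bullet> x \<le> supp A u"
  unfolding supp_def
proof (rule cSup_upper)
  have "compact ((\<bullet>) u ` A)" using assms(1) by (intro compact_continuous_image continuous_intros)
  then show "bdd_above ((\<bullet>) u ` A)" by (intro bounded_imp_bdd_above compact_imp_bounded)
qed (use assms in auto)

lemma supp_fc:
  assumes "x \<in> fc u A" shows "u \<bullet> x = supp A u"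
  unfolding supp_def by (rule cSup_eq_maximum[symmetric]) (use assms in \<open>auto simp: fc_def\<close>)

lemma fc_eq_supp: assumes "compact A" shows "fc u A = {x\<in>A. u \<bullet> x = supp A u}"
proof (intro set_eqI iffI)
  fix x assume "x \<in> fc u A"
  then show "x \<in> {x\<in>A. u \<bullet> x = supp A u}" using supp_fc fc_subset by blast
next
  fix x assume "x \<in> {x\<in>A. u \<bullet> x = supp A u}"
  then show "x \<in> fc u A" using supp_ge[OF assms, of _ u] by (auto simp: fc_def)
qed

abbreviation hyper :: "'a::euclidean_space \<Rightarrow> 'a set" where
  "hyper n \<equiv> perp UNIV n"

lemma hyper_alt: "hyper n = {x. n \<bullet> x = 0}" by (simp add: perp_def)

lemma facet_fc:
  fixes A :: "(real^3) set"
  assumes A: "polytope A" "interior A \<noteq> {}" and n: "n \<noteq> 0"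
  shows "fc n A facet_of A \<longleftrightarrow> irint (hyper n) (fc n A) \<noteq> {}"
proof -
  have vp: "vpoly (hyper n) (fc n A)" using A by (intro vpoly_fc) (auto simp: vpoly_def)
  have d: "dim (hyper n) = 2" unfolding hyper_alt using dim_hyperplane[OF n] by simp
  have aA: "aff_dim A = 3" using A(2) aff_dim_nonempty_interior[of A] by simp
  have f: "fc n A face_of A" by (rule fc_face_of[OF polytope_imp_convex[OF A(1)]])
  have sub: "subspace (hyper n)" by (rule subspace_perp) simp
  have "fc n A facet_of A \<longleftrightarrow> aff_dim (fc n A) = 2"
    unfolding facet_of_def using f aA vp by (auto simp: vpoly_def)
  then show ?thesis using aff_dim_vpoly(2,3)[OF sub vp] d by auto
qed

lemma facet_of_imp_fc:
  fixes A :: "(real^3) set"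
  assumes A: "polytope A" "interior A \<noteq> {}" and F: "F facet_of A"
  shows "\<exists>n. norm n = 1 \<and> F = fc n A"
proof -
  have "F face_of A" "F \<noteq> {}" using F by (auto simp: facet_of_def)
  then have "F exposed_face_of A" using A(1) exposed_face_of_polyhedron polytope_imp_polyhedron by blast
  moreover have "F \<noteq> A" using F facet_of_irrefl by blast
  ultimately obtain a b where a: "a \<noteq> 0" "A \<subseteq> {x. a \<bullet> x \<le> b}" "F = A \<inter> {x. a \<bullet> x = b}"
    using \<open>F \<noteq> {}\<close> unfolding exposed_face_of by blast
  have "F = fc a A" using a(2,3) \<open>F \<noteq> {}\<close> unfolding fc_def by force
  moreover have "fc ((1 / norm a) *\<^sub>R a) A = fc a A" using a(1) by (intro fc_scale) simp
  ultimately show ?thesis using a(1) by (intro exI[of _ "(1 / norm a) *\<^sub>R a"]) simp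
qed

lemma fc_disjoint_opposite:
  fixes A :: "'a::euclidean_space set"
  assumes "interior A \<noteq> {}" "n \<noteq> 0" shows "fc n A \<inter> fc (-n) A = {}"
proof (rule ccontr)
  assume "fc n A \<inter> fc (-n) A \<noteq> {}"
  then obtain x where x: "x \<in> fc n A" "x \<in> fc (-n) A" by blast
  have "n \<bullet> y = n \<bullet> x" if "y \<in> A" for y using x that by (force simp: fc_def intro: antisym)
  moreover obtain z where "z \<in> irint UNIV A" using assms(1) by (auto simp: irint_UNIV)
  moreover from this have "z \<in> A" by (simp add: irint_def)
  ultimately show False using irint_not_flat[of UNIV z A n] assms(2) by auto
qed

text \<open>The half-spaces of a minimal description cut out exactly the facets, so their unit
  normals are the candidates for \<open>N\<close>. A unit vector with a full-dimensional face agrees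
  with one of them up to sign, as both are constant on that face, and the wrong sign would make
  opposite faces meet.\<close>

lemma facet_normals:
  fixes A :: "(real^3) set"
  assumes A: "polytope A" "interior A \<noteq> {}"
  obtains N where "finite N" "\<And>n. n \<in> N \<longleftrightarrow> norm n = 1 \<and> irint (hyper n) (fc n A) \<noteq> {}"
    "A = {x. \<forall>n\<in>N. n \<bullet> x \<le> supp A n}"
proof -
  have cA: "compact A" "A \<noteq> {}" using A by (auto simp: polytope_imp_compact)
  have ah: "affine hull A = UNIV" using affine_hull_nonempty_interior[OF A(2)] .
  have "polyhedron A" using A by (simp add: polytope_imp_polyhedron)
  then obtain F where F: "finite F" "A = (affine hull A) \<inter> \<Inter>F" "\<forall>h\<in>F. \<exists>a b. a \<noteq> 0 \<and> h = {x. a \<bullet> x \<le> b}"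
     "\<forall>F'. F' \<subset> F \<longrightarrow> A \<subset> (affine hull A) \<inter> \<Inter>F'"
    unfolding polyhedron_Int_affine_minimal by blast
  then obtain a b where ab: "\<And>h. h\<in>F \<Longrightarrow> a h \<noteq> 0 \<and> h = {x. a h \<bullet> x \<le> b h}" by metis
  have fac: "c facet_of A \<longleftrightarrow> (\<exists>h\<in>F. c = A \<inter> {x. a h \<bullet> x = b h})" for c
    using facet_of_polyhedron_explicit[OF F(1,2), of a b c] ab F(4) by auto
  define u where "u h = (1 / norm (a h)) *\<^sub>R a h" for h
  have u1: "norm (u h) = 1" "u h \<noteq> 0" if "h\<in>F" for h using ab[OF that] by (auto simp: u_def)
  have fu: "fc (u h) A = A \<inter> {x. a h \<bullet> x = b h} \<and> fc (u h) A facet_of A \<and> supp A (u h) = b h / norm (a h)" if h: "h\<in>F" for h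
  proof -
    have ne: "A \<inter> {x. a h \<bullet> x = b h} \<noteq> {}" using fac h by (metis facet_of_def)
    have le: "a h \<bullet> x \<le> b h" if "x \<in> A" for x using that h ab[OF h] F(2) by blast
    have "fc (a h) A = A \<inter> {x. a h \<bullet> x = b h}" using ne le by (force simp: fc_def)
    moreover have e: "fc (u h) A = fc (a h) A" unfolding u_def using ab[OF h] by (intro fc_scale) simp
    moreover from calculation ne obtain x where "x \<in> fc (u h) A" "a h \<bullet> x = b h" by auto
    then have "supp A (u h) = b h / norm (a h)" using supp_fc[of x "u h" A] by (simp add: u_def)
    ultimately show ?thesis using fac h by metis
  qed
  show ?thesis
  proof (rule that)
    show "finite (u ` F)" using F(1) by simp
    show "n \<in> u ` F \<longleftrightarrow> norm n = 1 \<and> irint (hyper n) (fc n A) \<noteq> {}" for n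
    proof
      assume "n \<in> u ` F"
      then obtain h where h: "h\<in>F" "n = u h" by blast
      then show "norm n = 1 \<and> irint (hyper n) (fc n A) \<noteq> {}" using fu[OF h(1)] u1[OF h(1)] facet_fc[OF A, of n] by auto
    next
      assume n: "norm n = 1 \<and> irint (hyper n) (fc n A) \<noteq> {}"
      then have n0: "n \<noteq> 0" by auto
      then have "fc n A facet_of A" using facet_fc[OF A n0] n by blast
      then obtain h where h: "h\<in>F" "fc n A = A \<inter> {x. a h \<bullet> x = b h}" using fac by blast
      then have eq: "fc n A = fc (u h) A" using fu by blast
      obtain x where x: "x \<in> irint (hyper n) (fc n A)" using n by blast
      \<comment> \<open>The component of \<open>u h\<close> orthogonal to \<open>n\<close>; it is
        constant on the common face, hence zero.\<close>
      define m where "m = u h - (n \<bullet> u h) *\<^sub>R n"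
      have nn: "n \<bullet> n = 1" using n by (simp add: dot_square_norm)
      have "m = 0"
      proof (rule irint_not_flat[OF subspace_perp[OF subspace_UNIV] x])
        show "m \<in> hyper n" by (simp add: m_def perp_def inner_diff_right nn)
        fix y assume y: "y \<in> fc n A"
        have x': "x \<in> fc n A" using x by (simp add: irint_def)
        have "u h \<bullet> y = u h \<bullet> x" using y x' supp_fc unfolding eq by metis
        moreover have "n \<bullet> y = n \<bullet> x" using y x' supp_fc by metis
        ultimately show "m \<bullet> y = m \<bullet> x" by (simp add: m_def inner_diff_left)
      qed
      then have un: "u h = (n \<bullet> u h) *\<^sub>R n" by (simp add: m_def)
      then have "\<bar>n \<bullet> u h\<bar> = 1" using u1(1)[OF h(1)] n by (metis mult.right_neutral norm_scaleR)
      then consider "n \<bullet> u h = 1" | "n \<bullet> u h = -1" by linarith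
      then show "n \<in> u ` F"
      proof cases
        case 1 then show ?thesis using un h(1) by auto
      next
        case 2
        then have "u h = - n" using un by simp
        then have "fc n A \<inter> fc (-n) A \<noteq> {}" using eq x by (auto simp: irint_def)
        then show ?thesis using fc_disjoint_opposite[OF A(2) n0] by blast
      qed
    qed
    have "x \<in> A \<longleftrightarrow> (\<forall>h\<in>F. u h \<bullet> x \<le> supp A (u h))" for x
    proof -
      have "x \<in> A \<longleftrightarrow> (\<forall>h\<in>F. x \<in> h)" using F(2) ah by auto
      also have "\<dots> \<longleftrightarrow> (\<forall>h\<in>F. u h \<bullet> x \<le> supp A (u h))"
      proof (intro ball_cong refl)
        fix h assume h: "h\<in>F"
        have "x \<in> h \<longleftrightarrow> a h \<bullet> x \<le> b h" using ab[OF h] by blast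
        also have "\<dots> \<longleftrightarrow> u h \<bullet> x \<le> supp A (u h)" using fu[OF h] ab[OF h] by (simp add: u_def divide_right_mono field_simps)
        finally show "x \<in> h \<longleftrightarrow> u h \<bullet> x \<le> supp A (u h)" .
      qed
      finally show ?thesis .
    qed
    then show "A = {x. \<forall>n\<in>u ` F. n \<bullet> x \<le> supp A n}" by auto
  qed
qed

section \<open>Volumes of prisms over planar sets\<close>

lemma det_rank_one:
  fixes w n :: "real^3"
  shows "\<bar>det (matrix (\<lambda>v. \<alpha> *\<^sub>R v + (n \<bullet> v) *\<^sub>R w))\<bar> = \<alpha>\<^sup>2 * \<bar>\<alpha> + n \<bullet> w\<bar>"
proof -
  \<comment> \<open>The matrix is \<open>\<alpha>\<close> times the identity plus the rank-one
    product of the column \<open>w\<close> and the row \<open>n\<close>.\<close>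
  have m: "matrix (\<lambda>v. \<alpha> *\<^sub>R v + (n \<bullet> v) *\<^sub>R w) $ i $ j = \<alpha> * of_bool (i = j) + w $ i * n $ j" for i j :: 3
    by (simp add: matrix_def inner_axis) (simp add: axis_def)
  have "det (matrix (\<lambda>v. \<alpha> *\<^sub>R v + (n \<bullet> v) *\<^sub>R w)) = \<alpha>\<^sup>2 * (\<alpha> + n \<bullet> w)"
    unfolding det_3 m by (simp add: inner_vec_def sum_3) algebra
  then show ?thesis by (simp add: abs_mult)
qed

text \<open>Areas of planar sets are measured by the volume of the prism of unit height over them.\<close>

definition prism :: "'a::real_vector \<Rightarrow> 'a set \<Rightarrow> 'a set" where
  "prism n F = msum F (closed_segment 0 n)"

lemma prism_alt: "prism n F = {z + s *\<^sub>R n |z s. z \<in> F \<and> 0 \<le> s \<and> s \<le> 1}"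
  unfolding prism_def msum_def closed_segment_def by auto

text \<open>An affine image of the upright unit prism: the linear part scales directions orthogonal
  to \<open>n\<close> by \<open>\<alpha>\<close> and sends \<open>n\<close> to \<open>q\<close>.
  Both the dilated facets of the upper growth bound and the slanted slabs of the lower one have this
  shape.\<close>

lemma measure_oblique_prism:
  fixes F :: "(real^3) set"
  assumes F: "compact F" and n: "norm n = 1" and h: "\<And>z. z\<in>F \<Longrightarrow> n \<bullet> z = h"
  shows "compact {c + \<alpha> *\<^sub>R z + s *\<^sub>R q |z s. z \<in> F \<and> 0 \<le> s \<and> s \<le> 1}"
    "measure lborel {c + \<alpha> *\<^sub>R z + s *\<^sub>R q |z s. z \<in> F \<and> 0 \<le> s \<and> s \<le> 1} = \<alpha>\<^sup>2 * \<bar>n \<bullet> q\<bar> * measure lborel (prism n F)"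
proof -
  define w where "w = q - \<alpha> *\<^sub>R n"
  define f where "f v = \<alpha> *\<^sub>R v + (n \<bullet> v) *\<^sub>R w" for v
  have nn: "n \<bullet> n = 1" using n by (simp add: dot_square_norm)
  have lin: "linear f" unfolding f_def by (rule linearI) (auto simp: algebra_simps inner_add_right)
  have fz: "(c - h *\<^sub>R w) + f (z + s *\<^sub>R n) = c + \<alpha> *\<^sub>R z + s *\<^sub>R q" if "z \<in> F" for z s
    by (simp add: f_def w_def inner_add_right h[OF that] nn algebra_simps)
  have im: "{c + \<alpha> *\<^sub>R z + s *\<^sub>R q |z s. z \<in> F \<and> 0 \<le> s \<and> s \<le> 1} = (+) (c - h *\<^sub>R w) ` f ` prism n F"
  proof (intro set_eqI iffI)
    fix y assume "y \<in> {c + \<alpha> *\<^sub>R z + s *\<^sub>R q |z s. z \<in> F \<and> 0 \<le> s \<and> s \<le> 1}"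
    then obtain z s where "y = (c - h *\<^sub>R w) + f (z + s *\<^sub>R n)" "z \<in> F" "0 \<le> s" "s \<le> 1" using fz by auto
    then show "y \<in> (+) (c - h *\<^sub>R w) ` f ` prism n F" unfolding prism_alt by blast
  next
    fix y assume "y \<in> (+) (c - h *\<^sub>R w) ` f ` prism n F"
    then obtain z s where "y = (c - h *\<^sub>R w) + f (z + s *\<^sub>R n)" "z \<in> F" "0 \<le> s" "s \<le> 1" unfolding prism_alt by blast
    then show "y \<in> {c + \<alpha> *\<^sub>R z + s *\<^sub>R q |z s. z \<in> F \<and> 0 \<le> s \<and> s \<le> 1}" using fz by auto
  qed
  have cp: "compact (prism n F)" unfolding prism_def using F by (intro compact_msum) auto
  have cf: "compact (f ` prism n F)" using cp lin by (intro compact_continuous_image linear_continuous_on) (auto simp: linear_conv_bounded_linear)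
  show c: "compact {c + \<alpha> *\<^sub>R z + s *\<^sub>R q |z s. z \<in> F \<and> 0 \<le> s \<and> s \<le> 1}" unfolding im using cf by (rule compact_translation)
  have "measure lborel {c + \<alpha> *\<^sub>R z + s *\<^sub>R q |z s. z \<in> F \<and> 0 \<le> s \<and> s \<le> 1} = measure lebesgue (f ` prism n F)"
    unfolding measure_lborel_compact[OF c, symmetric] unfolding im by (rule measure_translation)
  also have "\<dots> = \<bar>det (matrix f)\<bar> * measure lebesgue (prism n F)"
    using measure_linear_image[OF lin lmeasurable_compact[OF cp]] by simp
  also have "\<bar>det (matrix f)\<bar> = \<alpha>\<^sup>2 * \<bar>\<alpha> + n \<bullet> w\<bar>" using det_rank_one unfolding f_def[abs_def] .
  also have "\<alpha> + n \<bullet> w = n \<bullet> q" by (simp add: w_def inner_diff_right nn)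
  finally show "measure lborel {c + \<alpha> *\<^sub>R z + s *\<^sub>R q |z s. z \<in> F \<and> 0 \<le> s \<and> s \<le> 1} = \<alpha>\<^sup>2 * \<bar>n \<bullet> q\<bar> * measure lborel (prism n F)"
    using measure_lborel_compact[OF cp] by simp
qed

section \<open>First-order growth of the volume\<close>

lemma first_exit:
  fixes a v :: "'a::euclidean_space"
  assumes N: "finite N" "A = {x. \<forall>n\<in>N. n \<bullet> x \<le> h n}" and a: "a \<in> A" and av: "a + v \<notin> A"
  obtains \<theta> n where "0 \<le> \<theta>" "\<theta> \<le> 1" "n \<in> N" "a + \<theta> *\<^sub>R v \<in> A" "n \<bullet> (a + \<theta> *\<^sub>R v) = h n" "n \<bullet> v > 0"
proof -
  define M where "M = {n\<in>N. n \<bullet> (a + v) > h n}"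
  have M: "finite M" "M \<noteq> {}" using N av by (auto simp: M_def not_le)
  \<comment> \<open>Times at which the constraints violated at the end point become tight; the
    smallest of them is the exit time.\<close>
  define \<tau> where "\<tau> n = (h n - n \<bullet> a) / (n \<bullet> v)" for n
  have Mp: "n \<bullet> v > 0" "0 \<le> \<tau> n" "\<tau> n \<le> 1" if "n \<in> M" for n
  proof -
    have 1: "n \<bullet> a \<le> h n" "n \<bullet> a + n \<bullet> v > h n" using that a N(2) by (auto simp: M_def inner_add_right)
    then show p: "n \<bullet> v > 0" by linarith
    show "0 \<le> \<tau> n" "\<tau> n \<le> 1" using 1 p by (auto simp: \<tau>_def divide_le_eq)
  qed
  obtain n where n: "n \<in> M" "\<And>m. m\<in>M \<Longrightarrow> \<tau> n \<le> \<tau> m"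
    using ex_min_if_finite[of "\<tau> ` M"] M by (metis (no_types, lifting) arg_min_if_finite(1) arg_min_if_finite(2) not_le)
  show ?thesis
  proof (rule that[of "\<tau> n" n])
    show "n \<in> N" using n by (simp add: M_def)
    show "n \<bullet> (a + \<tau> n *\<^sub>R v) = h n" using Mp(1)[OF n(1)] by (simp add: inner_add_right \<tau>_def)
    have "m \<bullet> (a + \<tau> n *\<^sub>R v) \<le> h m" if m: "m \<in> N" for m
    proof (cases "m \<in> M")
      case True
      have "\<tau> n * (m \<bullet> v) \<le> \<tau> m * (m \<bullet> v)" using n(2)[OF True] Mp(1)[OF True] by (intro mult_right_mono) auto
      also have "\<dots> = h m - m \<bullet> a" using Mp(1)[OF True] by (simp add: \<tau>_def)
      finally show ?thesis by (simp add: inner_add_right)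
    next
      case False
      then have 1: "m \<bullet> a + m \<bullet> v \<le> h m" "m \<bullet> a \<le> h m" using m a N(2) by (auto simp: M_def inner_add_right)
      have "m \<bullet> (a + \<tau> n *\<^sub>R v) = (1 - \<tau> n) * (m \<bullet> a) + \<tau> n * (m \<bullet> a + m \<bullet> v)" by (simp add: inner_add_right algebra_simps)
      also have "\<dots> \<le> (1 - \<tau> n) * h m + \<tau> n * h m" using 1 Mp(2,3)[OF n(1)] by (intro add_mono mult_left_mono) auto
      finally show ?thesis by (simp add: algebra_simps)
    qed
    then show "a + \<tau> n *\<^sub>R v \<in> A" using N(2) by blast
  qed (use Mp n in auto)
qed

text \<open>A point of the sum outside \<open>A\<close> is reached by leaving \<open>A\<close>
  through some facet. What remains of the displacement has normal component at most
  \<open>t * supp B n\<close>, which is the height of a prism over the facet, and a tangential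
  component of order \<open>t\<close>, which is absorbed by dilating the facet by
  \<open>1 + c n * t\<close>. The dilation affects the volume of the prism in second order
  only.\<close>

lemma growth_upper:
  fixes A B :: "(real^3) set"
  assumes A: "polytope A" and N: "finite N" "\<And>n. n\<in>N \<Longrightarrow> norm n = 1 \<and> irint (hyper n) (fc n A) \<noteq> {}"
      "A = {x. \<forall>n\<in>N. n \<bullet> x \<le> supp A n}"
    and B: "compact B" "0 \<in> B"
  shows "\<exists>K. \<forall>t. 0 < t \<and> t < 1 \<longrightarrow> measure lborel (msum A ((*\<^sub>R) t ` B)) \<le>
     measure lborel A + t * (\<Sum>n\<in>N. supp B n * measure lborel (prism n (fc n A))) + K * t\<^sup>2"
proof -
  have cA: "compact A" using A by (rule polytope_imp_compact)
  obtain R where R: "R > 0" "\<And>b. b\<in>B \<Longrightarrow> norm b \<le> R" using B(1) compact_imp_bounded bounded_pos by metis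
  \<comment> \<open>A centre \<open>p n\<close> in each facet, with a disc of radius
    \<open>\<rho> n\<close> around it inside the facet.\<close>
  have "\<forall>n. \<exists>p \<rho>. n\<in>N \<longrightarrow> \<rho> > 0 \<and> p \<in> fc n A \<and> (\<forall>v. n \<bullet> v = 0 \<longrightarrow> norm v < \<rho> \<longrightarrow> p + v \<in> fc n A)"
    using N(2) unfolding irint_def perp_def by fast
  then obtain p \<rho> where p\<rho>: "\<And>n. n\<in>N \<Longrightarrow> \<rho> n > 0" "\<And>n. n\<in>N \<Longrightarrow> p n \<in> fc n A"
     "\<And>n v. n\<in>N \<Longrightarrow> n \<bullet> v = 0 \<Longrightarrow> norm v < \<rho> n \<Longrightarrow> p n + v \<in> fc n A" by metis
  \<comment> \<open>The tangential part has length at most \<open>t * R\<close>; divided by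
    \<open>c n * t\<close> it is at most \<open>\<rho> n / 2\<close>, which keeps it inside the
    disc.\<close>
  define c where "c n = 2 * R / \<rho> n" for n
  have c: "c n > 0" if "n\<in>N" for n using p\<rho>(1)[OF that] R by (simp add: c_def)
  define ar where "ar n = measure lborel (prism n (fc n A))" for n
  define Q where "Q t n = {(- c n * t) *\<^sub>R p n + (1 + c n * t) *\<^sub>R z + s *\<^sub>R ((t * supp B n) *\<^sub>R n) |z s. z \<in> fc n A \<and> 0 \<le> s \<and> s \<le> 1}" for t n
  have sB: "supp B n \<ge> 0" for n using supp_ge[OF B(1,2), of n] by simp
  have cF: "compact (fc n A)" for n using polytope_fc[OF A] polytope_imp_compact by blast
  have Q: "compact (Q t n)" "measure lborel (Q t n) = (1 + c n * t)\<^sup>2 * (t * supp B n) * ar n" if "n\<in>N" "t > 0" for t n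
  proof -
    have n1: "norm n = 1" using N(2) that by blast
    show "compact (Q t n)" unfolding Q_def by (rule measure_oblique_prism(1)[OF cF n1 supp_fc])
    have "measure lborel (Q t n) = (1 + c n * t)\<^sup>2 * \<bar>n \<bullet> ((t * supp B n) *\<^sub>R n)\<bar> * ar n"
      unfolding Q_def ar_def by (rule measure_oblique_prism(2)[OF cF n1 supp_fc])
    then show "measure lborel (Q t n) = (1 + c n * t)\<^sup>2 * (t * supp B n) * ar n"
      using n1 sB[of n] that(2) by (simp add: dot_square_norm)
  qed
  have cover: "msum A ((*\<^sub>R) t ` B) \<subseteq> A \<union> (\<Union>n\<in>N. Q t n)" if t: "t > 0" for t
  proof
    fix y assume "y \<in> msum A ((*\<^sub>R) t ` B)"
    then obtain a b where ab: "a \<in> A" "b \<in> B" "y = a + t *\<^sub>R b" by (auto simp: msum_def)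
    show "y \<in> A \<union> (\<Union>n\<in>N. Q t n)"
    proof (cases "y \<in> A")
      case False
      then obtain \<theta> n where \<theta>: "0 \<le> \<theta>" "\<theta> \<le> 1" "n \<in> N" "a + \<theta> *\<^sub>R (t *\<^sub>R b) \<in> A" "n \<bullet> (a + \<theta> *\<^sub>R (t *\<^sub>R b)) = supp A n" "n \<bullet> (t *\<^sub>R b) > 0"
        using first_exit[OF N(1,3) ab(1), of "t *\<^sub>R b"] ab(3) by blast
      have n1: "norm n = 1" "n \<bullet> n = 1" using N(2)[OF \<theta>(3)] by (auto simp: dot_square_norm)
      define z where "z = a + \<theta> *\<^sub>R (t *\<^sub>R b)"
      have z: "z \<in> fc n A" using \<theta>(4,5) unfolding z_def fc_eq_supp[OF cA] by blast
      define v where "v = (1 - \<theta>) *\<^sub>R (t *\<^sub>R b)"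
      have yz: "y = z + v" unfolding ab(3) z_def v_def by (simp add: algebra_simps)
      define \<sigma> where "\<sigma> = n \<bullet> v"
      define w where "w = v - \<sigma> *\<^sub>R n"
      have nw: "n \<bullet> w = 0" by (simp add: w_def inner_diff_right n1 \<sigma>_def)
      have \<sigma>: "0 \<le> \<sigma>" "\<sigma> \<le> t * supp B n"
      proof -
        show "0 \<le> \<sigma>" unfolding \<sigma>_def v_def inner_scaleR_right using \<theta>(2,6) t by (auto intro!: mult_nonneg_nonneg simp: zero_less_mult_iff)
        have "\<sigma> = (1 - \<theta>) * (t * (n \<bullet> b))" by (simp add: \<sigma>_def v_def)
        also have "\<dots> \<le> 1 * (t * (n \<bullet> b))" using \<theta> by (intro mult_right_mono) auto
        also have "\<dots> \<le> t * supp B n" using supp_ge[OF B(1) ab(2)] t by simp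
        finally show "\<sigma> \<le> t * supp B n" .
      qed
      have "norm w \<le> norm v"
      proof -
        have "v \<bullet> v = w \<bullet> w + \<sigma>\<^sup>2"
        proof -
          have "v = w + \<sigma> *\<^sub>R n" by (simp add: w_def)
          then have "v \<bullet> v = (w + \<sigma> *\<^sub>R n) \<bullet> (w + \<sigma> *\<^sub>R n)" by simp
          then show ?thesis using nw n1 by (simp add: inner_add_left inner_add_right inner_commute power2_eq_square)
        qed
        then show ?thesis by (simp add: norm_le)
      qed
      also have "norm v \<le> t * R"
      proof -
        have "norm v = (1 - \<theta>) * (t * norm b)" using \<theta> t by (simp add: v_def)
        also have "\<dots> \<le> 1 * (t * R)" using \<theta> t R(2)[OF ab(2)] by (intro mult_mono mult_left_mono) auto
        finally show ?thesis by simp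
      qed
      finally have w: "norm w \<le> t * R" .
      define \<gamma> where "\<gamma> = c n * t"
      have \<gamma>: "\<gamma> > 0" using c \<theta>(3) t by (simp add: \<gamma>_def)
      have "norm ((1/\<gamma>) *\<^sub>R w) < \<rho> n"
      proof -
        have "norm ((1/\<gamma>) *\<^sub>R w) \<le> (t * R) / \<gamma>" using w \<gamma> by (simp add: divide_right_mono)
        also have "\<dots> = \<rho> n / 2" using t R(1) p\<rho>(1)[OF \<theta>(3)] by (simp add: \<gamma>_def c_def)
        also have "\<dots> < \<rho> n" using p\<rho>(1)[OF \<theta>(3)] by simp
        finally show ?thesis .
      qed
      then have pw: "p n + (1/\<gamma>) *\<^sub>R w \<in> fc n A" using p\<rho>(3)[OF \<theta>(3)] nw by simp
      have cv: "convex (fc n A)" using polytope_fc[OF A] polytope_imp_convex by blast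
      \<comment> \<open>A convex combination of the exit point and a point of the disc, weighted so
        that \<open>z + w\<close> becomes the image of \<open>z'\<close> under the dilation by
        \<open>1 + \<gamma>\<close> about \<open>p n\<close>.\<close>
      define z' where "z' = (1/(1+\<gamma>)) *\<^sub>R z + (\<gamma>/(1+\<gamma>)) *\<^sub>R (p n + (1/\<gamma>) *\<^sub>R w)"
      have z': "z' \<in> fc n A" unfolding z'_def
        by (rule convexD[OF cv z pw]) (use \<gamma> in \<open>auto simp: divide_simps\<close>)
      have "(1 + \<gamma>) *\<^sub>R z' = z + \<gamma> *\<^sub>R p n + w" using \<gamma> by (simp add: z'_def scaleR_add_right)
      then have zw: "z + w = (- \<gamma>) *\<^sub>R p n + (1 + \<gamma>) *\<^sub>R z'" by simp
      obtain s where s: "0 \<le> s" "s \<le> 1" "\<sigma> = s * (t * supp B n)"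
      proof (cases "t * supp B n = 0")
        case True
        then have "\<sigma> = 0" using \<sigma> by linarith
        then show ?thesis by (intro that[of 0]) auto
      next
        case False
        then have pos: "t * supp B n > 0" using sB[of n] t by (metis less_eq_real_def mult_nonneg_nonneg)
        show ?thesis by (rule that[of "\<sigma> / (t * supp B n)"]) (use \<sigma> pos in \<open>auto simp: divide_le_eq\<close>)
      qed
      have "y = (- \<gamma>) *\<^sub>R p n + (1 + \<gamma>) *\<^sub>R z' + s *\<^sub>R ((t * supp B n) *\<^sub>R n)"
        unfolding zw[symmetric] yz using s(3) by (simp add: w_def)
      then have "y \<in> Q t n" unfolding Q_def \<gamma>_def using z' s(1,2) by auto
      then show ?thesis using \<theta>(3) by blast
    qed simp
  qed
  \<comment> \<open>Collects the second-order remainders of the prism volumes; \<open>t < 1\<close>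
    bounds the cubic term by a quadratic one.\<close>
  define K where "K = (\<Sum>n\<in>N. (2 * c n + (c n)\<^sup>2) * (supp B n * ar n))"
  show ?thesis
  proof (intro exI[of _ K] allI impI)
    fix t :: real assume t: "0 < t \<and> t < 1"
    have lm: "A \<in> lmeasurable" "Q t n \<in> lmeasurable" if "n\<in>N" for n using cA Q(1) that t by (auto intro: lmeasurable_compact)
    have lmU: "(\<Union>n\<in>N. Q t n) \<in> lmeasurable" using N(1) Q(1) t by (intro lmeasurable_compact compact_UN) auto
    have lA: "A \<in> lmeasurable" using cA by (rule lmeasurable_compact)
    have cs: "compact (msum A ((*\<^sub>R) t ` B))" by (intro compact_msum compact_scaling cA B)
    have "measure lebesgue (msum A ((*\<^sub>R) t ` B)) \<le> measure lebesgue (A \<union> (\<Union>n\<in>N. Q t n))"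
      using cover t lmU lA lmeasurable_compact[OF cs] by (intro measure_mono_fmeasurable) auto
    also have "\<dots> \<le> measure lebesgue A + measure lebesgue (\<Union>n\<in>N. Q t n)"
      using lmU lA by (intro measure_Un_le) auto
    also have "measure lebesgue (\<Union>n\<in>N. Q t n) \<le> (\<Sum>n\<in>N. measure lebesgue (Q t n))"
      using N(1) lm by (intro measure_UNION_le) auto
    also have "(\<Sum>n\<in>N. measure lebesgue (Q t n)) = (\<Sum>n\<in>N. (1 + c n * t)\<^sup>2 * (t * supp B n) * ar n)"
      using Q t by (intro sum.cong refl) (simp add: measure_lborel_compact)
    also have "\<dots> \<le> (\<Sum>n\<in>N. t * (supp B n * ar n) + t\<^sup>2 * ((2 * c n + (c n)\<^sup>2) * (supp B n * ar n)))"
    proof (rule sum_mono)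
      fix n assume n: "n\<in>N"
      have "(1 + c n * t)\<^sup>2 * t \<le> t + t\<^sup>2 * (2 * c n + (c n)\<^sup>2)"
      proof -
        have "t\<^sup>2 * (t * (c n)\<^sup>2) \<le> t\<^sup>2 * (1 * (c n)\<^sup>2)" using t by (intro mult_left_mono mult_right_mono) auto
        then show ?thesis by (simp add: power2_eq_square algebra_simps)
      qed
      moreover have "supp B n * ar n \<ge> 0" using sB by (simp add: ar_def)
      ultimately have "(1 + c n * t)\<^sup>2 * t * (supp B n * ar n) \<le> (t + t\<^sup>2 * (2 * c n + (c n)\<^sup>2)) * (supp B n * ar n)"
        by (intro mult_right_mono)
      then show "(1 + c n * t)\<^sup>2 * (t * supp B n) * ar n \<le> t * (supp B n * ar n) + t\<^sup>2 * ((2 * c n + (c n)\<^sup>2) * (supp B n * ar n))"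
        by (simp add: algebra_simps)
    qed
    also have "\<dots> = t * (\<Sum>n\<in>N. supp B n * ar n) + K * t\<^sup>2"
      by (simp add: sum.distrib sum_distrib_left sum_distrib_right K_def mult.commute)
    finally show "measure lborel (msum A ((*\<^sub>R) t ` B)) \<le> measure lborel A + t * (\<Sum>n\<in>N. supp B n * measure lborel (prism n (fc n A))) + K * t\<^sup>2"
      using measure_lborel_compact[OF cs] measure_lborel_compact[OF cA] by (simp add: ar_def)
  qed
qed

text \<open>The dilate of \<open>A\<close> by \<open>1 + t\<close> contains \<open>A\<close>
  together with slabs over its facets, each of volume \<open>t * supp A n\<close> times the area,
  and these pieces overlap in null sets only. Comparison with the factor \<open>(1 + t) ^ 3\<close>
  for small \<open>t\<close> gives the 3.\<close>

lemma growth_lower: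
  fixes A :: "(real^3) set"
  assumes A: "polytope A" "0 \<in> interior A" and N: "finite N" "\<And>n. n\<in>N \<Longrightarrow> norm n = 1"
  shows "(\<Sum>n\<in>N. supp A n * measure lborel (prism n (fc n A))) \<le> 3 * measure lborel A"
proof -
  have cA: "compact A" and vA: "convex A" using A(1) by (auto intro: polytope_imp_compact polytope_imp_convex)
  have A0: "0 \<in> A" "A \<noteq> {}" using A(2) interior_subset by auto
  have sp: "supp A n > 0" if n: "norm n = 1" for n
  proof -
    obtain e where e: "e>0" "ball 0 e \<subseteq> A" using A(2) mem_interior by blast
    have "(e/2) *\<^sub>R n \<in> A" using e n by (auto simp: subset_iff)
    from supp_ge[OF cA this, of n] show ?thesis using e(1) n by (simp add: dot_square_norm)
  qed
  define ar where "ar n = measure lborel (prism n (fc n A))" for n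
  define S where "S = (\<Sum>n\<in>N. supp A n * ar n)"
  have "\<exists>p. p \<in> fc n A" for n using fc_nonempty[OF cA A0(2)] by blast
  then obtain p where p: "\<And>n. p n \<in> fc n A" by metis
  have cF: "compact (fc n A)" for n using polytope_fc[OF A(1)] polytope_imp_compact by blast
  \<comment> \<open>The slab over a facet is slanted along a point \<open>p n\<close> of that same
    facet. Convexity of the facet then writes each point of the slab as \<open>1 + s\<close> times a
    point of the facet with \<open>0 \<le> s \<le> t\<close>, so the slab stays in the cone over the
    facet and in the dilate of \<open>A\<close>.\<close>
  define Q where "Q t n = {0 + 1 *\<^sub>R z + s *\<^sub>R (t *\<^sub>R p n) |z s. z \<in> fc n A \<and> 0 \<le> s \<and> s \<le> 1}" for t n
  have Q: "compact (Q t n)" "measure lborel (Q t n) = t * supp A n * ar n" if "n\<in>N" "t > 0" for t n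
  proof -
    have n1: "norm n = 1" using N(2) that by blast
    show "compact (Q t n)" unfolding Q_def by (rule measure_oblique_prism(1)[OF cF n1 supp_fc])
    have "measure lborel (Q t n) = 1\<^sup>2 * \<bar>n \<bullet> (t *\<^sub>R p n)\<bar> * ar n"
      unfolding Q_def ar_def by (rule measure_oblique_prism(2)[OF cF n1 supp_fc])
    then show "measure lborel (Q t n) = t * supp A n * ar n"
      using supp_fc[OF p[of n]] sp[OF n1] that(2) by simp
  qed
  have Qform: "\<exists>s z. 0 \<le> s \<and> s \<le> t \<and> z \<in> fc n A \<and> y = (1 + s) *\<^sub>R z" if y: "y \<in> Q t n" and t: "t > 0" for t n y
  proof -
    obtain z s where zs: "z \<in> fc n A" "0 \<le> s" "s \<le> 1" "y = z + s *\<^sub>R (t *\<^sub>R p n)" using y by (auto simp: Q_def)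
    define r where "r = s * t"
    have r: "0 \<le> r" "r \<le> t" using zs t by (auto simp: r_def mult_left_le_one_le)
    define z' where "z' = (1/(1+r)) *\<^sub>R z + (r/(1+r)) *\<^sub>R p n"
    have cv: "convex (fc n A)" using polytope_fc[OF A(1)] polytope_imp_convex by blast
    have "z' \<in> fc n A" unfolding z'_def by (rule convexD[OF cv zs(1) p]) (use r in \<open>auto simp: divide_simps\<close>)
    moreover have "y = (1 + r) *\<^sub>R z'" using r by (simp add: z'_def scaleR_add_right zs(4) r_def)
    ultimately show ?thesis using r by blast
  qed
  have main: "measure lborel A + t * S \<le> (1 + t) ^ 3 * measure lborel A" if t: "t > 0" for t
  proof -
    \<comment> \<open>Index 0 stands for the body itself; it is free because the normals are unit
      vectors.\<close>
    define f where "f n = (if n = 0 then A else Q t n)" for n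
    have N0: "0 \<notin> N" using N(2) by force
    have cf: "compact (f n)" if "n \<in> insert 0 N" for n using that cA Q(1) t by (auto simp: f_def)
    have neg: "pairwise (\<lambda>m n. negligible (f m \<inter> f n)) (insert 0 N)"
    proof -
      have 1: "negligible (A \<inter> Q t n)" if n: "n\<in>N" for n
      proof (rule negligible_subset)
        show "negligible {y. n \<bullet> y = supp A n}" using N(2)[OF n] by (intro negligible_hyperplane) auto
        show "A \<inter> Q t n \<subseteq> {y. n \<bullet> y = supp A n}"
        proof
          fix y assume y: "y \<in> A \<inter> Q t n"
          then obtain s z where sz: "0 \<le> s" "z \<in> fc n A" "y = (1 + s) *\<^sub>R z" using Qform t by blast
          have "n \<bullet> y = (1 + s) * supp A n" using supp_fc[OF sz(2)] by (simp add: sz(3))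
          moreover have "n \<bullet> y \<le> supp A n" using y supp_ge[OF cA] by blast
          moreover have "supp A n \<le> (1 + s) * supp A n" using sz(1) sp[OF N(2)[OF n]] by simp
          ultimately show "y \<in> {y. n \<bullet> y = supp A n}" by simp
        qed
      qed
      have 2: "negligible (Q t m \<inter> Q t n)" if mn: "m\<in>N" "n\<in>N" "m \<noteq> n" for m n
      proof (rule negligible_subset)
        \<comment> \<open>A point in the slabs of both \<open>m\<close> and \<open>n\<close> has the
          same dilation factor with respect to either, which places it in the plane through the
          origin with this normal.\<close>
        let ?u = "supp A m *\<^sub>R n - supp A n *\<^sub>R m"
        have s: "supp A m > 0" "supp A n > 0" using sp N(2) mn by auto
        have "?u \<noteq> 0"
        proof
          assume "?u = 0"
          then have e: "supp A m *\<^sub>R n = supp A n *\<^sub>R m" by simp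
          then have "norm (supp A m *\<^sub>R n) = norm (supp A n *\<^sub>R m)" by simp
          then have "supp A m = supp A n" using s N(2) mn by simp
          then show False using e s mn by simp
        qed
        then show "negligible {y. ?u \<bullet> y = 0}" by (intro negligible_hyperplane) auto
        show "Q t m \<inter> Q t n \<subseteq> {y. ?u \<bullet> y = 0}"
        proof
          fix y assume y: "y \<in> Q t m \<inter> Q t n"
          then obtain s z where sz: "0 \<le> s" "z \<in> fc m A" "y = (1 + s) *\<^sub>R z" using Qform t by blast
          obtain s' z' where sz': "0 \<le> s'" "z' \<in> fc n A" "y = (1 + s') *\<^sub>R z'" using y Qform t by blast
          have zA: "z \<in> A" "z' \<in> A" using sz sz' fc_subset by auto
          have m1: "m \<bullet> y = (1 + s) * supp A m" "n \<bullet> y = (1 + s') * supp A n"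
            using supp_fc[OF sz(2)] supp_fc[OF sz'(2)] sz(3) sz'(3) by (metis inner_scaleR_right)+
          have "m \<bullet> y = (1 + s') * (m \<bullet> z')" "n \<bullet> y = (1 + s) * (n \<bullet> z)" using sz(3) sz'(3) by (metis inner_scaleR_right)+
          then have "m \<bullet> y \<le> (1 + s') * supp A m" "n \<bullet> y \<le> (1 + s) * supp A n"
            using supp_ge[OF cA zA(1), of n] supp_ge[OF cA zA(2), of m] sz(1) sz'(1) by (auto intro!: mult_left_mono)
          then have "s = s'" using m1 s by (simp add: antisym)
          then show "y \<in> {y. ?u \<bullet> y = 0}" using m1 by (simp add: inner_diff_left)
        qed
      qed
      show ?thesis unfolding pairwise_def f_def using 1 2 N0 by (auto simp: Int_commute)
    qed
    have "measure lebesgue (\<Union>(f ` insert 0 N)) = (\<Sum>n\<in>insert 0 N. measure lebesgue (f n))"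
      by (rule measure_negligible_finite_Union_image) (use N(1) cf neg in \<open>auto intro: lmeasurable_compact\<close>)
    also have "\<dots> = measure lborel A + t * S"
    proof -
      have "(\<Sum>n\<in>N. measure lebesgue (f n)) = (\<Sum>n\<in>N. t * (supp A n * ar n))"
        using Q t N0 by (intro sum.cong refl) (auto simp: f_def measure_lborel_compact simp del: measure_completion)
      then show ?thesis using N(1) N0 measure_lborel_compact[OF cA] by (simp add: f_def S_def sum_distrib_left)
    qed
    finally have 1: "measure lebesgue (\<Union>(f ` insert 0 N)) = measure lborel A + t * S" .
    have "\<Union>(f ` insert 0 N) \<subseteq> (*\<^sub>R) (1 + t) ` A"
    proof -
      have sc: "y \<in> (*\<^sub>R) (1 + t) ` A" if y: "y = (1 + s) *\<^sub>R z" "z \<in> A" "0 \<le> s" "s \<le> t" for s z y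
      proof -
        have "(1 - (1+s)/(1+t)) *\<^sub>R 0 + ((1+s)/(1+t)) *\<^sub>R z \<in> A"
          by (rule convexD[OF vA A0(1) y(2)]) (use y t in \<open>auto simp: divide_simps\<close>)
        then have "((1+s)/(1+t)) *\<^sub>R z \<in> A" by simp
        moreover have "y = (1 + t) *\<^sub>R (((1+s)/(1+t)) *\<^sub>R z)" using y t by simp
        ultimately show ?thesis by blast
      qed
      have "f n \<subseteq> (*\<^sub>R) (1 + t) ` A" if "n \<in> insert 0 N" for n
      proof
        fix y assume y: "y \<in> f n"
        show "y \<in> (*\<^sub>R) (1 + t) ` A"
        proof (cases "n = 0")
          case True
          then show ?thesis using sc[of y 0 y] y t by (simp add: f_def)
        next
          case False
          then show ?thesis using Qform[of y t n] y t sc fc_subset by (force simp: f_def)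
        qed
      qed
      then show ?thesis by blast
    qed
    then have "measure lebesgue (\<Union>(f ` insert 0 N)) \<le> measure lebesgue ((*\<^sub>R) (1 + t) ` A)"
      using N(1) cf cA by (intro measure_mono_fmeasurable fmeasurableD lmeasurable_compact compact_UN compact_scaling) auto
    also have "\<dots> = (1 + t) ^ 3 * measure lborel A"
      using measure_scale[OF cA, of "1 + t"] t measure_lborel_compact[OF compact_scaling[OF cA], of "1 + t"] by simp
    finally show ?thesis using 1 by simp
  qed
  define M where "M = measure lborel A"
  have M: "M \<ge> 0" by (simp add: M_def)
  have "S \<le> 3 * M + e" if e: "e > 0" for e
  proof -
    \<comment> \<open>For \<open>t \<le> 1\<close> the terms of higher order add up to at most
      \<open>4 * t * M\<close>; the added 1 covers \<open>M = 0\<close>.\<close>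
    define t where "t = min 1 (e / (4 * M + 1))"
    have t: "t > 0" "t \<le> 1" "t * (4 * M + 1) \<le> e"
    proof -
      show "t > 0" "t \<le> 1" using e M by (auto simp: t_def)
      have "t * (4 * M + 1) \<le> (e / (4 * M + 1)) * (4 * M + 1)" using M by (intro mult_right_mono) (auto simp: t_def)
      then show "t * (4 * M + 1) \<le> e" using M by simp
    qed
    have "M + t * S \<le> (1 + t) ^ 3 * M" using main[OF t(1)] by (simp add: M_def)
    then have "t * S \<le> t * ((3 + 3 * t + t\<^sup>2) * M)" by (simp add: power3_eq_cube power2_eq_square algebra_simps)
    then have "S \<le> (3 + 3 * t + t\<^sup>2) * M" using t(1) by simp
    also have "\<dots> \<le> (3 + 3 * t + t) * M" using t M by (intro mult_right_mono) (auto simp: power2_eq_square mult_left_le_one_le)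
    also have "\<dots> = 3 * M + t * (4 * M)" by (simp add: algebra_simps)
    also have "\<dots> \<le> 3 * M + t * (4 * M + 1)" using t by simp
    finally show ?thesis using t(3) by linarith
  qed
  then show ?thesis unfolding S_def[symmetric] ar_def[symmetric] M_def[symmetric] by (rule field_le_epsilon)
qed

lemma measure_prism_flat:
  fixes F :: "(real^3) set"
  assumes F: "vpoly (hyper n) F" and e: "irint (hyper n) F = {}"
  shows "measure lborel (prism n F) = 0"
proof -
  obtain m where m: "m \<in> hyper n" "m \<noteq> 0" "\<forall>x\<in>F. \<forall>y\<in>F. m \<bullet> x = m \<bullet> y"
    using aff_dim_vpoly(4)[OF subspace_perp[OF subspace_UNIV] F e] by blast
  obtain p where p: "p \<in> F" using F by (auto simp: vpoly_def)
  have cF: "compact F" using F by (auto simp: vpoly_def polytope_imp_compact)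
  have "prism n F \<subseteq> {y. m \<bullet> y = m \<bullet> p}"
  proof
    fix y assume "y \<in> prism n F"
    then obtain z s where "z \<in> F" "y = z + s *\<^sub>R n" by (auto simp: prism_alt)
    moreover have "m \<bullet> n = 0" using m(1) by (simp add: perp_def inner_commute)
    moreover from calculation have "m \<bullet> z = m \<bullet> p" using m(3) p by blast
    ultimately show "y \<in> {y. m \<bullet> y = m \<bullet> p}" by (simp add: inner_add_right)
  qed
  then have "negligible (prism n F)" using m(2) negligible_hyperplane[of m "m \<bullet> p"] negligible_subset by blast
  then have "measure lebesgue (prism n F) = 0" by (rule negligible_imp_measure0)
  moreover have "compact (prism n F)" unfolding prism_def using cF by (intro compact_msum) auto
  ultimately show ?thesis using measure_lborel_compact by metis
qed

text \<open>Together with the flat case this says that the area tells whether a direction carries a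
  facet, so equal areas pass facets from \<open>n\<close> to \<open>-n\<close>.\<close>

lemma measure_prism_pos:
  fixes F :: "(real^3) set"
  assumes F: "vpoly (hyper n) F" and i: "irint (hyper n) F \<noteq> {}" and n: "n \<noteq> 0"
  shows "measure lborel (prism n F) > 0"
proof (rule measure_body_pos)
  have cF: "compact F" "convex F" using F by (auto simp: vpoly_def polytope_imp_compact polytope_imp_convex)
  have cv: "convex (prism n F)" unfolding prism_def using cF by (intro convex_msum) auto
  have cp: "compact (prism n F)" unfolding prism_def using cF by (intro compact_msum) auto
  have "interior (prism n F) \<noteq> {}"
  proof
    assume "interior (prism n F) = {}"
    then obtain a b where ab: "a \<noteq> 0" "prism n F \<subseteq> {x. a \<bullet> x = b}" using empty_interior_subset_hyperplane[OF cv] by metis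
    obtain x where x: "x \<in> irint (hyper n) F" using i by blast
    have xF: "x \<in> F" using x by (simp add: irint_def)
    have mem: "z + s *\<^sub>R n \<in> prism n F" if "z \<in> F" "0 \<le> s" "s \<le> 1" for z s using that by (auto simp: prism_alt)
    have "a \<bullet> z = b" if "z \<in> F" for z using ab(2) mem[OF that, of 0] by auto
    moreover have "a \<bullet> (x + 1 *\<^sub>R n) = b" using ab(2) mem[OF xF, of 1] by auto
    ultimately have "a \<bullet> n = 0" "\<And>z. z \<in> F \<Longrightarrow> a \<bullet> z = a \<bullet> x" using xF by (auto simp: inner_add_right)
    then have "a = 0" using irint_not_flat[OF subspace_perp[OF subspace_UNIV] x, of a] by (simp add: perp_def inner_commute)
    then show False using ab by simp
  qed
  then show "convex_body (prism n F)" using cv cp by (simp add: convex_body_def)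
qed

lemma measure_lborel_translation:
  fixes S :: "'a::euclidean_space set"
  assumes "compact S" shows "measure lborel ((+) a ` S) = measure lborel S"
  unfolding measure_lborel_compact[OF assms, symmetric] measure_lborel_compact[OF compact_translation[OF assms], symmetric]
  by (rule measure_translation)

lemma fc_translation: "fc n ((+) a ` A) = (+) a ` fc n A"
proof (intro set_eqI iffI)
  fix y assume "y \<in> fc n ((+) a ` A)"
  then obtain x where "x \<in> A" "y = a + x" "\<forall>z\<in>A. n \<bullet> (a + z) \<le> n \<bullet> (a + x)" by (auto simp: fc_def)
  then have "x \<in> fc n A" by (simp add: fc_def inner_add_right)
  then show "y \<in> (+) a ` fc n A" using \<open>y = a + x\<close> by blast
next
  fix y assume "y \<in> (+) a ` fc n A"
  then show "y \<in> fc n ((+) a ` A)" by (auto simp: fc_def inner_add_right)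
qed

lemma msum_translation: "msum ((+) a ` S) T = (+) a ` msum S T"
proof (intro set_eqI iffI)
  fix y assume "y \<in> msum ((+) a ` S) T"
  then obtain s t where st: "s \<in> S" "t \<in> T" "y = a + s + t" by (auto simp: msum_def)
  then have "s + t \<in> msum S T" "y = a + (s + t)" by (auto simp: msum_def)
  then show "y \<in> (+) a ` msum S T" by blast
next
  fix y assume "y \<in> (+) a ` msum S T"
  then obtain s t where "s \<in> S" "t \<in> T" "y = a + (s + t)" by (auto simp: msum_def)
  then have "y = (a + s) + t" "a + s \<in> (+) a ` S" "t \<in> T" by auto
  then show "y \<in> msum ((+) a ` S) T" unfolding msum_def by blast
qed

lemma prism_translation: "prism n ((+) a ` F) = (+) a ` prism n F"
  unfolding prism_def by (rule msum_translation)

lemma prism_uminus: "prism (-n) F = (+) (-n) ` prism n F"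
proof (intro set_eqI iffI)
  fix y assume "y \<in> prism (-n) F"
  then obtain z s where zs: "z \<in> F" "0 \<le> s" "s \<le> 1" "y = z + s *\<^sub>R (-n)" by (auto simp: prism_alt)
  then have "y = - n + (z + (1 - s) *\<^sub>R n)" by (simp add: algebra_simps)
  moreover have "z + (1 - s) *\<^sub>R n \<in> prism n F" using zs unfolding prism_alt by (intro CollectI exI[of _ z] exI[of _ "1-s"]) auto
  ultimately show "y \<in> (+) (-n) ` prism n F" by blast
next
  fix y assume "y \<in> (+) (-n) ` prism n F"
  then obtain z s where zs: "z \<in> F" "0 \<le> s" "s \<le> 1" "y = - n + (z + s *\<^sub>R n)" by (auto simp: prism_alt)
  then have "y = z + (1 - s) *\<^sub>R (-n)" by (simp add: algebra_simps)
  then show "y \<in> prism (-n) F" using zs unfolding prism_alt by (intro CollectI exI[of _ z] exI[of _ "1-s"]) auto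
qed

text \<open>Equal areas in opposite directions make the set of facet normals symmetric, and
  reindexing by \<open>-n\<close> turns the sum with the support values of \<open>-B\<close> into
  the sum with those of \<open>B\<close>. The upper and lower growth bounds then combine to the
  extremal growth. Passing to \<open>B\<close> puts the origin inside the body, as both bounds ask
  for.\<close>

theorem symmetric_of_equal_areas:
  fixes A :: "(real^3) set"
  assumes A: "polytope A" "interior A \<noteq> {}"
    and eq: "\<And>n. norm n = 1 \<Longrightarrow> measure lborel (prism n (fc n A)) = measure lborel (prism n (fc (-n) A))"
  shows "\<exists>c. (\<lambda>x. 2 *\<^sub>R c - x) ` A = A"
proof -
  obtain a where a: "a \<in> interior A" using A(2) by blast
  define B where "B = (+) (-a) ` A"
  have pB: "polytope B" unfolding B_def by (subst polytope_translation_eq) (rule A)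
  have B0: "0 \<in> interior B" unfolding B_def interior_translation using a by force
  have iB: "interior B \<noteq> {}" using B0 by blast
  have cB: "compact B" "convex B" using pB by (auto intro: polytope_imp_compact polytope_imp_convex)
  have body: "convex_body B" using cB iB by (simp add: convex_body_def)
  have vp: "vpoly (hyper n) (fc n B)" for n using pB iB by (intro vpoly_fc) (auto simp: vpoly_def)
  have cF: "compact (prism m (fc n B))" for m n
    unfolding prism_def using polytope_imp_compact[OF polytope_fc[OF pB, of n]] by (intro compact_msum) auto
  have cA: "compact (prism m (fc n A))" for m n
    unfolding prism_def using polytope_imp_compact[OF polytope_fc[OF A(1), of n]] by (intro compact_msum) auto
  define ar where "ar n = measure lborel (prism n (fc n B))" for n
  have eqB: "measure lborel (prism n (fc n B)) = measure lborel (prism n (fc (-n) B))" if "norm n = 1" for n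
    unfolding B_def fc_translation prism_translation measure_lborel_translation[OF cA] using eq[OF that] .
  have arm: "ar (-n) = ar n" if "norm n = 1" for n
    unfolding ar_def prism_uminus measure_lborel_translation[OF cF] using eqB[OF that] by simp
  obtain N where N: "finite N" "\<And>n. n \<in> N \<longleftrightarrow> norm n = 1 \<and> irint (hyper n) (fc n B) \<noteq> {}"
    "B = {x. \<forall>n\<in>N. n \<bullet> x \<le> supp B n}" by (rule facet_normals[OF pB iB]) (rule that)
  have Nm: "-n \<in> N" if n: "n \<in> N" for n
  proof -
    have n1: "norm n = 1" "n \<noteq> 0" using n N(2) by auto
    have "ar n > 0" unfolding ar_def using measure_prism_pos[OF vp] n N(2) n1 by blast
    then have "measure lborel (prism (-n) (fc (-n) B)) \<noteq> 0" using arm[OF n1(1)] by (simp add: ar_def)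
    then have "irint (hyper (-n)) (fc (-n) B) \<noteq> {}" using measure_prism_flat[OF vp[of "-n"]] by blast
    then show ?thesis using N(2) n1 by simp
  qed
  have bij: "bij_betw uminus N N" by (rule bij_betw_byWitness[where f'=uminus]) (use Nm in auto)
  let ?B' = "uminus ` B"
  have sB': "supp ?B' n = supp B (-n)" for n by (simp add: supp_def image_image)
  have N2: "norm n = 1 \<and> irint (hyper n) (fc n B) \<noteq> {}" if "n \<in> N" for n using N(2) that by blast
  have B'0: "0 \<in> ?B'" using B0 interior_subset by force
  obtain K where K: "\<forall>t. 0 < t \<and> t < 1 \<longrightarrow> measure lborel (msum B ((*\<^sub>R) t ` ?B')) \<le>
     measure lborel B + t * (\<Sum>n\<in>N. supp ?B' n * measure lborel (prism n (fc n B))) + K * t\<^sup>2"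
    using growth_upper[OF pB N(1) N2 N(3) compact_negations[OF cB(1)] B'0] by blast
  have "(\<Sum>n\<in>N. supp ?B' n * ar n) = (\<Sum>n\<in>N. supp B (-n) * ar (-n))"
    using N2 arm by (intro sum.cong refl) (simp add: sB')
  also have "\<dots> = (\<Sum>n\<in>N. supp B n * ar n)"
    using sum.reindex_bij_betw[OF bij, of "\<lambda>n. supp B n * ar n"] by simp
  also have "\<dots> \<le> 3 * measure lborel B"
    unfolding ar_def using growth_lower[OF pB B0 N(1)] N2 by blast
  finally have S: "(\<Sum>n\<in>N. supp ?B' n * ar n) \<le> 3 * measure lborel B" .
  have "\<exists>c. (\<lambda>x. 2 *\<^sub>R c - x) ` B = B"
  proof (rule symmetric_of_growth[OF body])
    fix t :: real assume t: "0 < t" "t < 1"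
    have "measure lborel (msum B ((*\<^sub>R) t ` ?B')) \<le> measure lborel B + t * (\<Sum>n\<in>N. supp ?B' n * ar n) + K * t\<^sup>2"
      using K t unfolding ar_def by blast
    also have "\<dots> \<le> measure lborel B + t * (3 * measure lborel B) + K * t\<^sup>2"
      using mult_left_mono[OF S, of t] t by simp
    finally show "measure lborel (msum B ((*\<^sub>R) t ` ?B')) \<le> measure lborel B * (1 + 3 * t) + K * t\<^sup>2"
      by (simp add: algebra_simps)
  qed
  then obtain c where c: "(\<lambda>x. 2 *\<^sub>R c - x) ` B = B" by blast
  have AB: "A = (+) a ` B" by (simp add: B_def image_image)
  have "(\<lambda>x. 2 *\<^sub>R (c + a) - x) ` A = (+) a ` ((\<lambda>x. 2 *\<^sub>R c - x) ` B)"
    unfolding AB by (simp add: image_image algebra_simps scaleR_2)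
  then have "(\<lambda>x. 2 *\<^sub>R (c + a) - x) ` A = A" unfolding c AB[symmetric] .
  then show ?thesis by blast
qed

section \<open>Support functions and symmetry of polygons\<close>

lemma supp_local:
  fixes F :: "'a::euclidean_space set"
  assumes F: "polytope F" "F \<noteq> {}"
  shows "\<exists>e>0. \<forall>w. norm w < e \<longrightarrow> supp F (m + w) = supp (fc m F) (m + w)"
proof -
  have cF: "compact F" using F by (simp add: polytope_imp_compact)
  let ?E = "fc m F"
  have cE: "compact ?E" using polytope_fc[OF F(1)] polytope_imp_compact by blast
  obtain e0 where e0: "e0 \<in> ?E" using fc_nonempty[OF cF F(2)] by blast
  obtain S where S: "finite S" "F = convex hull S" using F(1) by (auto simp: polytope_def)
  have SF: "S \<subseteq> F" unfolding S(2) by (rule hull_subset)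
  \<comment> \<open>Generators off the face are strictly worse than \<open>e0\<close> in direction
    \<open>m\<close>, hence also in all nearby directions; the maximum there is attained on the
    face.\<close>
  define S0 where "S0 = {v\<in>S. m \<bullet> v < m \<bullet> e0}"
  have "\<exists>e>0. \<forall>w. norm w < e \<longrightarrow> (\<forall>v\<in>S0. (v - e0) \<bullet> (m + w) < 0)"
  proof (rule finite_eps)
    show "finite S0" using S(1) by (simp add: S0_def)
    fix v assume "v \<in> S0"
    then have "(v - e0) \<bullet> m < 0" by (simp add: S0_def inner_diff_right inner_commute[of "v - e0"] inner_commute[of e0])
    then show "\<exists>e>0. \<forall>w. norm w < e \<longrightarrow> (v - e0) \<bullet> (m + w) < 0" by (rule slack_eps)
  qed
  then obtain e where e: "e>0" "\<And>w v. norm w < e \<Longrightarrow> v\<in>S0 \<Longrightarrow> (v - e0) \<bullet> (m + w) < 0" by blast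
  have "supp F (m + w) = supp ?E (m + w)" if w: "norm w < e" for w
  proof -
    let ?y = "m + w"
    have "v \<in> {x. ?y \<bullet> x \<le> supp ?E ?y}" if v: "v \<in> S" for v
    proof (cases "v \<in> ?E")
      case True then show ?thesis using supp_ge[OF cE] by blast
    next
      case False
      have vF: "v \<in> F" using v SF by blast
      have m1: "m \<bullet> x \<le> m \<bullet> e0" if "x \<in> F" for x using e0 that by (simp add: fc_def)
      have "m \<bullet> v \<noteq> m \<bullet> e0" using False m1 vF unfolding fc_def by auto
      then have "v \<in> S0" using m1[OF vF] v by (simp add: S0_def)
      then have "?y \<bullet> v < ?y \<bullet> e0" using e(2)[OF w, of v] by (simp add: inner_diff_right inner_commute[of "v - e0"])
      also have "\<dots> \<le> supp ?E ?y" by (rule supp_ge[OF cE e0])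
      finally show ?thesis by simp
    qed
    then have sub: "F \<subseteq> {x. ?y \<bullet> x \<le> supp ?E ?y}"
      unfolding S(2) by (intro hull_minimal subsetI convex_halfspace_le) auto
    obtain x where x: "x \<in> fc ?y F" using fc_nonempty[OF cF F(2)] by blast
    then have "supp F ?y \<le> supp ?E ?y" using sub supp_fc[OF x] fc_subset[of ?y F] by auto
    moreover obtain x' where x': "x' \<in> fc ?y ?E" using fc_nonempty[OF cE] e0 by blast
    then have "supp ?E ?y \<le> supp F ?y" using supp_fc[OF x'] fc_subset[of ?y ?E] fc_subset[of m F] supp_ge[OF cF, of x' ?y] by auto
    ultimately show ?thesis by simp
  qed
  then show ?thesis using e(1) by blast
qed

lemma vpoly_dim1_segment:
  assumes W: "subspace W" "dim W \<le> 1" and E: "vpoly W E"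
  shows "\<exists>p q. E = closed_segment p q"
proof -
  have "collinear E"
  proof -
    have "aff_dim E \<le> 1" using aff_dim_vpoly(1)[OF W(1) E] W(2) by linarith
    then show ?thesis by (simp add: collinear_aff_dim)
  qed
  then show ?thesis using E compact_convex_collinear_segment[of E]
    by (metis vpoly_def polytope_imp_compact polytope_imp_convex)
qed

text \<open>For a segment the support function is the larger of two linear values, and
  \<open>max a b - max (-a) (-b) = a + b\<close>.\<close>

lemma supp_segment_odd: "supp (closed_segment p q) y - supp (closed_segment p q) (-y) = (p + q) \<bullet> y"
proof -
  have "supp (closed_segment p q) y = max (y \<bullet> p) (y \<bullet> q)" for y
  proof (rule antisym)
    obtain x where x: "x \<in> fc y (closed_segment p q)" using fc_nonempty[of "closed_segment p q" y] by auto
    then obtain u where u: "0 \<le> u" "u \<le> 1" "x = (1 - u) *\<^sub>R p + u *\<^sub>R q" using fc_subset closed_segment_def by blast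
    have "y \<bullet> x = (1 - u) * (y \<bullet> p) + u * (y \<bullet> q)" by (simp add: u(3) inner_add_right)
    also have "\<dots> \<le> (1 - u) * max (y \<bullet> p) (y \<bullet> q) + u * max (y \<bullet> p) (y \<bullet> q)" using u by (intro add_mono mult_left_mono) auto
    finally show "supp (closed_segment p q) y \<le> max (y \<bullet> p) (y \<bullet> q)" using supp_fc[OF x] by (simp add: algebra_simps)
    show "max (y \<bullet> p) (y \<bullet> q) \<le> supp (closed_segment p q) y" by (intro max.boundedI supp_ge) auto
  qed
  from this[of y] this[of "-y"]
  have "supp (closed_segment p q) y - supp (closed_segment p q) (-y) = max (y \<bullet> p) (y \<bullet> q) - max (- (y \<bullet> p)) (- (y \<bullet> q))" by simp
  also have "\<dots> = y \<bullet> p + y \<bullet> q" by (simp add: max_def)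
  finally show ?thesis by (simp add: inner_add_right inner_commute[of "p + q"])
qed

lemma supp_translation:
  assumes "compact E" "E \<noteq> {}" shows "supp ((+) t ` E) y = y \<bullet> t + supp E y"
proof -
  obtain x where x: "x \<in> fc y E" using fc_nonempty[OF assms] by blast
  then have "t + x \<in> fc y ((+) t ` E)" by (simp add: fc_translation)
  then show ?thesis using supp_fc[OF x] supp_fc[of "t + x" y] by (simp add: inner_add_right)
qed

text \<open>The odd part of the support function is linear near every direction, as opposite
  faces are translates of each other; the punctured plane being connected, it is linear.\<close>

theorem polygon_symmetric:
  fixes F :: "'a::euclidean_space set"
  assumes n: "norm n = 1" and dim: "dim (hyper n) = 2" and F: "vpoly (hyper n) F"
    and opp: "\<And>m. m \<in> hyper n \<Longrightarrow> m \<noteq> 0 \<Longrightarrow> \<exists>t. fc (-m) F = (+) t ` fc m F"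
  shows "\<exists>c. (\<lambda>x. 2 *\<^sub>R c - x) ` F = F"
proof -
  let ?V = "hyper n"
  have V: "subspace ?V" by (rule subspace_perp) simp
  have pF: "polytope F" "F \<noteq> {}" using F by (auto simp: vpoly_def)
  have cF: "compact F" "convex F" using pF by (auto intro: polytope_imp_compact polytope_imp_convex)
  \<comment> \<open>Twice the odd part of the support function. For a set with centre
    \<open>c\<close> it is \<open>2 * (c \<bullet> y)\<close>, so linearity is the goal and the
    gradient yields the centre.\<close>
  define H where "H y = supp F y - supp F (-y)" for y
  have loc: "\<exists>e>0. \<exists>g. \<forall>z. norm (z - m) < e \<longrightarrow> H z = g \<bullet> z" if m: "m \<in> ?V" "m \<noteq> 0" for m
  proof -
    let ?E = "fc m F"
    obtain t where t: "fc (-m) F = (+) t ` ?E" using opp[OF m] by blast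
    have "dim (perp ?V m) \<le> 1"
    proof -
      have "m \<in> ?V" "m \<notin> perp ?V m" "perp ?V m \<subseteq> ?V" using m by (simp_all add: perp_def subset_iff)
      then have "perp ?V m \<subset> ?V" by blast
      moreover have "span (perp ?V m) = perp ?V m" "span ?V = ?V" using V subspace_perp[OF V] span_eq_iff by blast+
      ultimately have "span (perp ?V m) \<subset> span ?V" by metis
      from dim_psubset[OF this] show ?thesis using dim by linarith
    qed
    then obtain p q where pq: "?E = closed_segment p q"
      using vpoly_dim1_segment[OF subspace_perp[OF V] _ vpoly_fc[OF F]] by blast
    obtain e1 where e1: "e1>0" "\<And>w. norm w < e1 \<Longrightarrow> supp F (m + w) = supp ?E (m + w)" using supp_local[OF pF] by blast
    obtain e2 where e2: "e2>0" "\<And>w. norm w < e2 \<Longrightarrow> supp F (-m + w) = supp (fc (-m) F) (-m + w)" using supp_local[OF pF] by blast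
    \<comment> \<open>Near \<open>m\<close> only the two opposite edges matter. The edge in
      direction \<open>-m\<close> is that in direction \<open>m\<close> moved by \<open>t\<close>,
      which leaves the odd part of a segment plus the contribution of \<open>t\<close>.\<close>
    have "H z = (p + q + t) \<bullet> z" if z: "norm (z - m) < min e1 e2" for z
    proof -
      have "supp F z = supp ?E z" using e1(2)[of "z - m"] z by simp
      moreover have "supp F (-z) = supp (fc (-m) F) (-z)" using e2(2)[of "m - z"] z by (simp add: norm_minus_commute)
      moreover have "supp (fc (-m) F) (-z) = (-z) \<bullet> t + supp ?E (-z)" unfolding t pq by (rule supp_translation) auto
      moreover have "supp ?E z - supp ?E (-z) = (p + q) \<bullet> z" unfolding pq by (rule supp_segment_odd)
      ultimately show ?thesis unfolding H_def by (simp add: inner_add_left inner_commute[of t z])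
    qed
    then show ?thesis using e1(1) e2(1) by (intro exI[of _ "min e1 e2"]) auto
  qed
  have "\<exists>m. m \<in> ?V \<and> m \<noteq> 0"
  proof (rule ccontr)
    assume "\<not> (\<exists>m. m \<in> ?V \<and> m \<noteq> 0)"
    then have "?V \<subseteq> {0}" by auto
    then have "dim ?V = 0" by (simp only: dim_eq_0)
    then show False using dim by simp
  qed
  then obtain m0 where m0: "m0 \<in> ?V" "m0 \<noteq> 0" by blast
  obtain g e0 where g: "e0>0" "\<And>z. norm (z - m0) < e0 \<Longrightarrow> H z = g \<bullet> z" using loc[OF m0] by blast
  define P where "P y \<longleftrightarrow> (\<exists>e>0. \<forall>z\<in>?V. norm (z - y) < e \<longrightarrow> H z = g \<bullet> z)" for y
  \<comment> \<open>A linear functional is determined on \<open>?V\<close> by its values near one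
    point; this makes the local gradients agree on overlaps.\<close>
  have unique: "a \<bullet> v = b \<bullet> v" if ab: "y \<in> ?V" "e > 0" "\<And>z. z\<in>?V \<Longrightarrow> norm (z - y) < e \<Longrightarrow> a \<bullet> z = b \<bullet> z" and v: "v \<in> ?V" for a b y v e
  proof -
    define s where "s = e / (2 * (norm v + 1))"
    have np: "2 * (norm v + 1) > 0" by (simp add: add_nonneg_pos)
    have s: "s > 0" using ab(2) np by (simp add: s_def)
    have "norm v < 2 * (norm v + 1)" using norm_ge_zero[of v] by (smt (verit))
    then have "e * norm v < e * (2 * (norm v + 1))" using ab(2) by (rule mult_strict_left_mono)
    then have "norm (s *\<^sub>R v) < e" using np s ab(2) unfolding s_def by (simp add: pos_divide_less_eq)
    then have "a \<bullet> (y + s *\<^sub>R v) = b \<bullet> (y + s *\<^sub>R v)" using ab(1) v V by (intro ab(3)) (auto simp: subspace_add subspace_scale)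
    moreover have "a \<bullet> y = b \<bullet> y" using ab(2) by (intro ab(3)[OF ab(1)]) simp
    ultimately show ?thesis using s by (simp add: inner_add_right)
  qed
  have "connected (?V - {0})"
    using path_connected_punctured_convex[OF subspace_imp_convex[OF V], of 0] dim aff_dim_subspace[OF V] path_connected_imp_connected by simp
  then have P: "P y" if "y \<in> ?V - {0}" for y
  proof (rule connected_induction_simple[where P=P and a=m0])
    show "m0 \<in> ?V - {0}" using m0 by blast
    show "y \<in> ?V - {0}" by fact
    show "P m0" unfolding P_def using g by blast
    fix x assume x: "x \<in> ?V - {0}"
    then obtain e gx where e: "e>0" "\<And>z. norm (z - x) < e \<Longrightarrow> H z = gx \<bullet> z" using loc[of x] by auto
    show "\<exists>T. openin (top_of_set (?V - {0})) T \<and> x \<in> T \<and> (\<forall>u\<in>T. \<forall>w\<in>T. P u \<longrightarrow> P w)"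
    proof (intro exI conjI ballI impI)
      show "openin (top_of_set (?V - {0})) ((?V - {0}) \<inter> ball x e)" by (simp add: openin_open_Int)
      show "x \<in> (?V - {0}) \<inter> ball x e" using x e by simp
      fix u w assume u: "u \<in> (?V - {0}) \<inter> ball x e" and w: "w \<in> (?V - {0}) \<inter> ball x e" and Pu: "P u"
      obtain d where d: "d>0" "\<And>z. z\<in>?V \<Longrightarrow> norm (z - u) < d \<Longrightarrow> H z = g \<bullet> z" using Pu by (auto simp: P_def)
      have du: "e - norm (u - x) > 0" using u by (simp add: dist_norm norm_minus_commute)
      have gg: "gx \<bullet> v = g \<bullet> v" if "v \<in> ?V" for v
      proof (rule unique[of u "min d (e - norm (u - x))"])
        show "u \<in> ?V" "v \<in> ?V" using u that by auto
        show "min d (e - norm (u - x)) > 0" using d(1) du by simp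
        fix z assume z: "z \<in> ?V" "norm (z - u) < min d (e - norm (u - x))"
        have "norm (z - x) \<le> norm (z - u) + norm (u - x)" using norm_triangle_ineq[of "z - u" "u - x"] by simp
        then have "norm (z - x) < e" using z(2) by simp
        then show "gx \<bullet> z = g \<bullet> z" using e(2)[of z] d(2)[OF z(1)] z(2) by simp
      qed
      have dw: "e - norm (w - x) > 0" using w by (simp add: dist_norm norm_minus_commute)
      have "H z = g \<bullet> z" if z: "z \<in> ?V" "norm (z - w) < e - norm (w - x)" for z
      proof -
        have "norm (z - x) \<le> norm (z - w) + norm (w - x)" using norm_triangle_ineq[of "z - w" "w - x"] by simp
        then show ?thesis using e(2)[of z] gg[OF z(1)] z(2) by simp
      qed
      then show "P w" unfolding P_def using dw by blast
    qed
  qed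
  have Hg: "H y = g \<bullet> y" if y: "y \<in> ?V" for y
  proof (cases "y = 0")
    case True then show ?thesis by (simp add: H_def)
  next
    case False
    then obtain e where "e>0" "\<forall>z\<in>?V. norm (z - y) < e \<longrightarrow> H z = g \<bullet> z" using P[of y] y by (auto simp: P_def)
    then show ?thesis using y by simp
  qed
  obtain p where p: "p \<in> F" using pF by blast
  have nn: "n \<bullet> n = 1" using n by (simp add: dot_square_norm)
  have nF: "n \<bullet> x = n \<bullet> p" if "x \<in> F" for x
  proof -
    have "x - p \<in> ?V" using F p that by (simp add: vpoly_def)
    then show ?thesis by (simp add: perp_def inner_diff_right)
  qed
  \<comment> \<open>Within the directions of the plane the centre is half the gradient; the
    component along \<open>n\<close> places it in the plane of \<open>F\<close>.\<close>
  define c where "c = (1/2) *\<^sub>R (g - (n \<bullet> g) *\<^sub>R n + (2 * (n \<bullet> p)) *\<^sub>R n)"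
  have c2: "2 *\<^sub>R c = g - (n \<bullet> g) *\<^sub>R n + (2 * (n \<bullet> p)) *\<^sub>R n" by (simp add: c_def)
  have "(\<lambda>x. 2 *\<^sub>R c - x) ` F = F"
  proof (rule reflect_invariant[OF compact_imp_closed[OF cF(1)] cF(2)])
    fix u x assume x: "x \<in> F"
    define s where "s = n \<bullet> u"
    define v where "v = u - s *\<^sub>R n"
    have v: "v \<in> ?V" "n \<bullet> v = 0" by (auto simp: v_def perp_def inner_diff_right nn s_def)
    have u: "u = v + s *\<^sub>R n" by (simp add: v_def)
    obtain y where y: "y \<in> fc v F" using fc_nonempty[OF cF(1) pF(2)] by blast
    have yF: "y \<in> F" using y fc_subset by auto
    have "u \<bullet> (2 *\<^sub>R c - x) = v \<bullet> g - v \<bullet> x + s * (n \<bullet> p)"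
      unfolding c2 u using v(2) nn nF[OF x]
      by (simp add: inner_add_left inner_add_right inner_diff_right inner_commute algebra_simps)
    also have "v \<bullet> g - v \<bullet> x \<le> supp F v"
    proof -
      have "(-v) \<bullet> x \<le> supp F (-v)" by (rule supp_ge[OF cF(1) x])
      moreover have "supp F v - supp F (-v) = g \<bullet> v" using Hg[OF v(1)] by (simp add: H_def)
      ultimately show ?thesis by (simp add: inner_commute)
    qed
    also have "supp F v = v \<bullet> y" using supp_fc[OF y] by simp
    also have "v \<bullet> y + s * (n \<bullet> p) = u \<bullet> y" using nF[OF yF] by (simp add: u inner_add_left)
    finally show "\<exists>y\<in>F. u \<bullet> (2 *\<^sub>R c - x) \<le> u \<bullet> y" using yF by auto
  qed
  then show ?thesis by blast
qed

text \<open>The coordinate functionals dual to the basis are bounded, so the integer coordinates of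
  lattice points in a ball lie in a finite box.\<close>

lemma lattice_discrete_subgroup:
  assumes "is_lattice L"
  shows "discrete_subgroup L"
proof -
  obtain B where B: "independent B" "card B = 3" and L: "L = {\<Sum>b\<in>B. of_int (c b) *\<^sub>R b | c :: real^3 \<Rightarrow> int. True}"
    using assms unfolding is_lattice_def by blast
  have fB: "finite B" using B(2) card.infinite by force
  show ?thesis
  proof
    show "0 \<in> L" unfolding L by (intro CollectI exI[of _ "\<lambda>_. 0"]) simp
    show "x - y \<in> L" if xy: "x \<in> L" "y \<in> L" for x y
    proof -
      obtain c d where "x = (\<Sum>b\<in>B. of_int (c b) *\<^sub>R b)" "y = (\<Sum>b\<in>B. of_int (d b) *\<^sub>R b)"
        using xy unfolding L by blast
      then have "x - y = (\<Sum>b\<in>B. of_int (c b - d b) *\<^sub>R b)"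
        by (simp add: sum_subtractf[symmetric] scaleR_left_diff_distrib)
      then show ?thesis unfolding L by (intro CollectI exI[of _ "\<lambda>b. c b - d b"] conjI) auto
    qed
    show "finite (L \<inter> cball 0 r)" for r
    proof -
      have "\<exists>g :: real^3 \<Rightarrow> real. linear g \<and> (\<forall>x\<in>B. g x = (if x = b then 1 else 0))" for b
        using linear_independent_extend[OF B(1), of "\<lambda>x. if x = b then 1 else 0"] by blast
      then obtain g :: "real^3 \<Rightarrow> real^3 \<Rightarrow> real" where g: "\<And>b. linear (g b)" "\<And>b x. x\<in>B \<Longrightarrow> g b x = (if x = b then 1 else 0)" by metis
      have "\<exists>K. \<forall>x. norm (g b x) \<le> K * norm x" for b using linear_bounded[OF g(1)] by blast
      then obtain K where K: "\<And>b x. norm (g b x) \<le> K b * norm x" by metis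
      define M where "M = (\<Sum>b\<in>B. \<lceil>\<bar>K b\<bar> * \<bar>r\<bar>\<rceil>)"
      have "L \<inter> cball 0 r \<subseteq> (\<lambda>c. \<Sum>b\<in>B. of_int (c b) *\<^sub>R b) ` (B \<rightarrow>\<^sub>E {-M..M})"
      proof
        fix x assume x: "x \<in> L \<inter> cball 0 r"
        then obtain c where c: "x = (\<Sum>b\<in>B. of_int (c b) *\<^sub>R b)" unfolding L by blast
        have "c b \<in> {-M..M}" if b: "b\<in>B" for b
        proof -
          have "g b x = (\<Sum>b'\<in>B. of_int (c b') * g b b')" unfolding c using g(1) by (simp add: linear_sum linear_scale)
          also have "\<dots> = (\<Sum>b'\<in>B. if b' = b then of_int (c b') else 0)" using g(2) by (intro sum.cong) auto
          also have "\<dots> = of_int (c b)" using fB b by simp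
          finally have "\<bar>of_int (c b)\<bar> \<le> K b * norm x" using K[of b x] by simp
          also have "\<dots> \<le> \<bar>K b\<bar> * \<bar>r\<bar>" using x by (intro mult_mono) auto
          also have "\<dots> \<le> of_int \<lceil>\<bar>K b\<bar> * \<bar>r\<bar>\<rceil>" by (rule le_of_int_ceiling)
          finally have "\<bar>of_int (c b)\<bar> \<le> (of_int \<lceil>\<bar>K b\<bar> * \<bar>r\<bar>\<rceil> :: real)" .
          then have "\<bar>c b\<bar> \<le> \<lceil>\<bar>K b\<bar> * \<bar>r\<bar>\<rceil>" by linarith
          also have "\<dots> \<le> M" unfolding M_def
          proof (rule member_le_sum[OF b _ fB])
            fix x
            have "-1 < \<bar>K x\<bar> * \<bar>r\<bar>" by (rule less_le_trans[of _ 0]) auto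
            then show "0 \<le> \<lceil>\<bar>K x\<bar> * \<bar>r\<bar>\<rceil>" by simp
          qed
          finally show ?thesis by auto
        qed
        then have "restrict c B \<in> B \<rightarrow>\<^sub>E {-M..M}" by auto
        moreover have "x = (\<Sum>b\<in>B. of_int (restrict c B b) *\<^sub>R b)" unfolding c by (intro sum.cong) auto
        ultimately show "x \<in> (\<lambda>c. \<Sum>b\<in>B. of_int (c b) *\<^sub>R b) ` (B \<rightarrow>\<^sub>E {-M..M})" by blast
      qed
      moreover have "finite (B \<rightarrow>\<^sub>E {-M..M})" using fB by (intro finite_PiE) auto
      ultimately show ?thesis using finite_subset by blast
    qed
  qed
qed

section \<open>Four-legged frames and the main equivalence\<close>

text \<open>\<open>coplanar\<close> asks for three points whose affine hull contains
  \<open>S\<close>; an affine basis of a set lying in a plane has at most three elements.\<close>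

lemma hyperplane_imp_coplanar:
  fixes S :: "(real^3) set"
  assumes n: "n \<noteq> 0" and S: "S \<subseteq> {x. n \<bullet> x = b}"
  shows "coplanar S"
proof -
  obtain C where C: "\<not> affine_dependent C" "C \<subseteq> S" "affine hull C = affine hull S" using affine_basis_exists by blast
  have "aff_dim C \<le> aff_dim {x. n \<bullet> x = b}" using C(2) S by (intro aff_dim_subset) auto
  also have "\<dots> = 2" using n by (simp add: aff_dim_hyperplane)
  finally have "card C \<le> 3" using aff_dim_affine_independent[OF C(1)] by linarith
  moreover have "finite C" using C(1) by (rule aff_independent_finite)
  ultimately have "\<exists>u v w. C \<subseteq> {u,v,w}"
  proof -
    assume fc: "card C \<le> 3" "finite C"
    obtain xs where xs: "set xs = C" "length xs = card C" using fc(2) by (metis finite_distinct_list distinct_card)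
    then have "length xs \<le> 3" using fc by simp
    then consider "xs = []" | a where "xs = [a]" | a b where "xs = [a,b]" | a b c where "xs = [a,b,c]"
      by (cases xs; cases "tl xs"; cases "tl (tl xs)"; cases "tl (tl (tl xs))") auto
    then show ?thesis by cases (use xs in auto)
  qed
  then obtain u v w where "C \<subseteq> {u,v,w}" by blast
  then have "affine hull S \<subseteq> affine hull {u,v,w}" using C(3) hull_mono by metis
  then have "S \<subseteq> affine hull {u,v,w}" using hull_subset[of S affine] by blast
  then show ?thesis unfolding coplanar_def by blast
qed

lemma coplanar_imp_hyperplane:
  fixes S :: "(real^3) set"
  assumes "coplanar S"
  obtains a b where "a \<noteq> 0" "S \<subseteq> {x. a \<bullet> x = b}"
proof -
  obtain u v w where "S \<subseteq> affine hull {u,v,w}" using assms unfolding coplanar_def by blast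
  then have "aff_dim S \<le> aff_dim {u,v,w}" using aff_dim_affine_hull aff_dim_subset by metis
  also have "\<dots> \<le> int (card {u,v,w}) - 1" by (rule aff_dim_le_card) auto
  also have "\<dots> \<le> 2" using card_insert_le_m1[of 3] by (simp add: card_insert_if)
  finally show ?thesis using aff_lowdim_subset_hyperplane[of S] that by auto
qed

lemma dim_hyper: "n \<noteq> 0 \<Longrightarrow> dim (hyper n) = 2" for n :: "real^3"
  unfolding hyper_alt using dim_hyperplane[of n] by simp

lemma subspace_hyper: "subspace (hyper n)"
  by (rule subspace_perp) simp

text \<open>Four nonzero pairwise orthogonal vectors do not fit into three dimensions, so the
  vectors orthogonal to both \<open>n\<close> and \<open>m\<close> form a line.\<close>

lemma edge_direction:
  fixes n m :: "real^3"
  assumes n: "n \<noteq> 0" and m: "m \<in> hyper n" "m \<noteq> 0"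
  obtains v where "norm v = 1" "v \<in> perp (hyper n) m" "\<And>w. w \<in> perp (hyper n) m \<Longrightarrow> w = (w \<bullet> v) *\<^sub>R v"
proof -
  have nm: "n \<bullet> m = 0" using m(1) by (simp add: perp_def)
  have "dim {n,m} \<le> card {n,m}" by (rule dim_le_card') simp
  also have "\<dots> \<le> 2" by (simp add: card_insert_if)
  finally have "dim {n,m} < DIM(real^3)" by simp
  then obtain v0 where v0: "v0 \<noteq> 0" "\<And>y. y \<in> span {n,m} \<Longrightarrow> orthogonal v0 y" using orthogonal_to_subspace_exists by metis
  define v where "v = (1 / norm v0) *\<^sub>R v0"
  have v1: "norm v = 1" "v \<noteq> 0" using v0(1) by (auto simp: v_def)
  have "orthogonal v0 n" "orthogonal v0 m" using v0(2) by (auto intro: span_base)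
  then have vn: "n \<bullet> v = 0" "m \<bullet> v = 0" by (auto simp: v_def orthogonal_def inner_commute)
  have "w = (w \<bullet> v) *\<^sub>R v" if w: "w \<in> perp (hyper n) m" for w
  proof (rule ccontr)
    assume ne: "w \<noteq> (w \<bullet> v) *\<^sub>R v"
    define u where "u = w - (w \<bullet> v) *\<^sub>R v"
    have wn: "n \<bullet> w = 0" "m \<bullet> w = 0" using w by (auto simp: perp_def)
    have u: "u \<noteq> 0" "n \<bullet> u = 0" "m \<bullet> u = 0" "v \<bullet> u = 0"
      using ne vn wn v1 by (auto simp: u_def inner_diff_right dot_square_norm inner_commute)
    have "pairwise orthogonal {n,m,v,u}"
      using nm vn u by (auto simp: pairwise_def orthogonal_def inner_commute)
    then have "independent {n,m,v,u}" using n m(2) v1 u(1) by (intro pairwise_orthogonal_independent) auto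
    then have "card {n,m,v,u} \<le> DIM(real^3)" by (rule independent_card_le)
    moreover have "n \<noteq> m" "n \<noteq> v" "n \<noteq> u" "m \<noteq> v" "m \<noteq> u" "v \<noteq> u" using nm vn u n m(2) v1(2) by auto
    then have "card {n,m,v,u} = 4" by simp
    ultimately show False by simp
  qed
  then show ?thesis using that[OF v1(1)] vn by (auto simp: perp_def)
qed

lemma dim_edge:
  fixes n m :: "real^3"
  assumes n: "n \<noteq> 0" and m: "m \<in> hyper n" "m \<noteq> 0"
  shows "dim (perp (hyper n) m) = 1"
proof -
  obtain v where v: "norm v = 1" "v \<in> perp (hyper n) m" "\<And>w. w \<in> perp (hyper n) m \<Longrightarrow> w = (w \<bullet> v) *\<^sub>R v"
    by (rule edge_direction[OF assms]) (rule that)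
  have "perp (hyper n) m \<subseteq> span {v}" using v(3) by (auto simp: span_singleton)
  moreover have "span {v} \<subseteq> perp (hyper n) m" using v(2) subspace_perp[OF subspace_hyper] by (intro span_minimal) auto
  ultimately have "perp (hyper n) m = span {v}" by blast
  moreover have "dim (span {v}) = 1" using v(1) by (simp add: dim_span) (metis dim_singleton norm_zero zero_neq_one)
  ultimately show ?thesis by simp
qed

lemma fc_reflect:
  assumes "(\<lambda>x. 2 *\<^sub>R c - x) ` A = A"
  shows "fc (-n) A = (\<lambda>x. 2 *\<^sub>R c - x) ` fc n A"
proof -
  have mem: "2 *\<^sub>R c - x \<in> A" if "x \<in> A" for x using assms that by blast
  have sub: "(\<lambda>x. 2 *\<^sub>R c - x) ` fc n A \<subseteq> fc (-n) A" for n
  proof (rule image_subsetI)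
    fix x assume x: "x \<in> fc n A"
    have "(-n) \<bullet> y \<le> (-n) \<bullet> (2 *\<^sub>R c - x)" if "y \<in> A" for y
    proof -
      have "n \<bullet> (2 *\<^sub>R c - y) \<le> n \<bullet> x" using x mem[OF that] by (simp add: fc_def)
      then show ?thesis by (simp add: inner_diff_right)
    qed
    then show "2 *\<^sub>R c - x \<in> fc (-n) A" using mem x by (simp add: fc_def)
  qed
  show ?thesis
  proof
    show "fc (-n) A \<subseteq> (\<lambda>x. 2 *\<^sub>R c - x) ` fc n A"
    proof
      fix y assume "y \<in> fc (-n) A"
      then have "2 *\<^sub>R c - y \<in> fc n A" using sub[of "-n"] by auto
      then show "y \<in> (\<lambda>x. 2 *\<^sub>R c - x) ` fc n A" by (intro image_eqI[of _ _ "2 *\<^sub>R c - y"]) auto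
    qed
  qed (rule sub)
qed

text \<open>Two point reflections compose to a translation. For a set with centre \<open>d\<close>,
  a reflection can thus be replaced by a translation; this is how the vectors of a frame
  arise.\<close>

lemma reflect_reflect: "(\<lambda>x. 2 *\<^sub>R c - x) ` S = (+) (2 *\<^sub>R (c - d)) ` S" if "(\<lambda>x. 2 *\<^sub>R d - x) ` S = S"
  for S :: "'a::real_vector set"
proof -
  have "(+) (2 *\<^sub>R (c - d)) ` S = (+) (2 *\<^sub>R (c - d)) ` ((\<lambda>x. 2 *\<^sub>R d - x) ` S)" using that by simp
  also have "\<dots> = (\<lambda>x. 2 *\<^sub>R c - x) ` S" by (simp add: image_image scaleR_diff_right)
  finally show ?thesis by simp
qed

lemma irint_translation: "irint V ((+) t ` P) = (+) t ` irint V P"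
proof -
  have sub: "(+) t ` irint V P \<subseteq> irint V ((+) t ` P)" for t and P :: "'a set"
  proof (rule image_subsetI)
    fix x assume "x \<in> irint V P"
    then obtain e where e: "x \<in> P" "e>0" "\<forall>v\<in>V. norm v < e \<longrightarrow> x + v \<in> P" by (auto simp: irint_def)
    have "t + x + v \<in> (+) t ` P" if "v\<in>V" "norm v < e" for v
      using e(3) that by (intro image_eqI[of _ _ "x + v"]) (auto simp: algebra_simps)
    then show "t + x \<in> irint V ((+) t ` P)" using e unfolding irint_def by blast
  qed
  show ?thesis
  proof
    show "irint V ((+) t ` P) \<subseteq> (+) t ` irint V P"
    proof
      fix y assume "y \<in> irint V ((+) t ` P)"
      then have "-t + y \<in> irint V ((+) (-t) ` (+) t ` P)" using sub by blast
      then have "-t + y \<in> irint V P" by (simp add: image_image)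
      then show "y \<in> (+) t ` irint V P" by (intro image_eqI[of _ _ "-t + y"]) auto
    qed
  qed (rule sub)
qed

text \<open>Project an exposing normal to the directions of the plane of \<open>P\<close>: the
  discarded component along \<open>n\<close> is constant on \<open>P\<close> and does not affect the
  maximisers.\<close>

lemma face_imp_fc:
  fixes P :: "(real^3) set"
  assumes n: "n \<noteq> 0" and P: "vpoly (hyper n) P" and e: "e face_of P" "e \<noteq> {}" "e \<noteq> P"
  shows "\<exists>m. m \<in> hyper n \<and> m \<noteq> 0 \<and> e = fc m P"
proof -
  have pP: "polyhedron P" using P by (auto simp: vpoly_def polytope_imp_polyhedron)
  then have "e exposed_face_of P" using e exposed_face_of_polyhedron by blast
  then obtain a b where ab: "P \<subseteq> {x. a \<bullet> x \<le> b}" "e = P \<inter> {x. a \<bullet> x = b}" using e(2,3) unfolding exposed_face_of by blast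
  have ea: "e = fc a P" using ab e(2) unfolding fc_def by force
  define m where "m = a - ((a \<bullet> n) / (n \<bullet> n)) *\<^sub>R n"
  have mV: "m \<in> hyper n" using n by (simp add: m_def perp_def inner_diff_right inner_commute)
  have diff: "n \<bullet> y = n \<bullet> x" if "x \<in> P" "y \<in> P" for x y
  proof -
    have "y - x \<in> hyper n" using P that by (simp add: vpoly_def)
    then show ?thesis by (simp add: perp_def inner_diff_right)
  qed
  have "m \<bullet> y \<le> m \<bullet> x \<longleftrightarrow> a \<bullet> y \<le> a \<bullet> x" if "x \<in> P" "y \<in> P" for x y
    using diff[OF that] by (simp add: m_def inner_diff_left)
  then have em: "e = fc m P" unfolding ea fc_def by auto
  have "m \<noteq> 0"
  proof
    assume "m = 0"
    then have "fc m P = P" by (auto simp: fc_def)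
    then show False using em e(3) by simp
  qed
  then show ?thesis using mV em by blast
qed

lemma parallel_of_const:
  assumes V: "subspace V" and m: "m \<in> V" "m \<noteq> 0" and x: "irint (perp V m) E \<noteq> {}"
    and a: "a \<in> V" "\<And>x y. x\<in>E \<Longrightarrow> y\<in>E \<Longrightarrow> a \<bullet> x = a \<bullet> y" and mE: "\<And>x y. x\<in>E \<Longrightarrow> y\<in>E \<Longrightarrow> m \<bullet> x = m \<bullet> y"
  shows "\<exists>k. a = k *\<^sub>R m"
proof -
  obtain z where z: "z \<in> irint (perp V m) E" using x by blast
  define u where "u = a - ((a \<bullet> m)/(m \<bullet> m)) *\<^sub>R m"
  have "u = 0"
  proof (rule irint_not_flat[OF subspace_perp[OF V] z])
    show "u \<in> perp V m" unfolding u_def perp_def using V a m by (simp add: subspace_diff subspace_scale inner_diff_right inner_commute)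
    fix y assume "y \<in> E"
    moreover have "z \<in> E" using z by (simp add: irint_def)
    ultimately show "u \<bullet> y = u \<bullet> z" using a(2)[of y z] mE[of y z] by (simp add: u_def inner_diff_left)
  qed
  then show ?thesis by (auto simp: u_def)
qed

lemma fc_const: "x \<in> fc m P \<Longrightarrow> y \<in> fc m P \<Longrightarrow> m \<bullet> x = m \<bullet> y"
  using supp_fc[of x m P] supp_fc[of y m P] by simp

text \<open>A facet that is a translate of \<open>F\<close> has normal \<open>n\<close> or
  \<open>-n\<close>, and being different from \<open>F\<close> it must be \<open>fc (-n) A\<close>;
  the same reasoning inside the plane of \<open>F\<close> identifies \<open>e''\<close>. The four
  edges of a frame thus become the members of the twofold boundary of \<open>A\<close> in directions
  \<open>n\<close> and \<open>m\<close>.\<close>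

lemma frame_fc:
  fixes A :: "(real^3) set"
  assumes A: "polytope A" "interior A \<noteq> {}" and fr: "four_legged_frame A F F' t' t'' e e' e'' e'''"
  obtains n m where "n \<noteq> 0" "F = fc n A" "F' = fc (-n) A" "irint (hyper n) F \<noteq> {}" "m \<in> hyper n" "m \<noteq> 0"
    "e = fc m F" "e'' = fc (-m) F" "irint (perp (hyper n) m) e \<noteq> {}" "e' = fc m F'" "e''' = fc (-m) F'"
proof -
  have F: "F facet_of A" and F': "F' facet_of A" "F' \<noteq> F" "F' = (+) t' ` F"
    and e: "e edge_of A" "e \<subseteq> F" and e'': "e'' edge_of F" "e'' \<noteq> e" "e'' = (+) t'' ` e"
    and e': "e' = (+) t' ` e" "e''' = (+) (t' + t'') ` e"
    using fr unfolding four_legged_frame_def by auto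
  obtain n where n: "norm n = 1" "F = fc n A" using facet_of_imp_fc[OF A F] by blast
  have n0: "n \<noteq> 0" using n by auto
  obtain n' where n': "norm n' = 1" "F' = fc n' A" using facet_of_imp_fc[OF A F'(1)] by blast
  let ?V = "hyper n"
  have iF: "irint ?V F \<noteq> {}" using facet_fc[OF A n0] F n by simp
  have vF: "vpoly ?V F" unfolding n(2) using A by (intro vpoly_fc) (auto simp: vpoly_def)
  have constF: "n' \<bullet> x = n' \<bullet> y" if "x\<in>F" "y\<in>F" for x y
  proof -
    have "t' + x \<in> fc n' A" "t' + y \<in> fc n' A" using F'(3) n'(2) that by auto
    from fc_const[OF this] show ?thesis by (simp add: inner_add_right)
  qed
  have "\<exists>k. n' = k *\<^sub>R n"
  proof (rule parallel_of_const[OF subspace_UNIV _ n0 iF])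
    show "n' \<bullet> x = n' \<bullet> y" if "x \<in> F" "y \<in> F" for x y using that by (rule constF)
    show "n \<bullet> x = n \<bullet> y" if "x \<in> F" "y \<in> F" for x y using that unfolding n(2) by (rule fc_const)
  qed auto
  then obtain k where k: "n' = k *\<^sub>R n" by blast
  have "\<bar>k\<bar> = 1" using n(1) n'(1) unfolding k by simp
  then have "n' = n \<or> n' = - n" using k by (auto simp: abs_if split: if_splits)
  then have F'n: "F' = fc (-n) A" using F'(2) n(2) n'(2) by auto
  have eF: "e face_of F" "aff_dim e = 1"
    using e F face_of_subset[of e A F] facet_of_imp_subset unfolding edge_of_def by auto
  have aF: "aff_dim F = 2" using aff_dim_vpoly(3)[OF subspace_hyper vF iF] dim_hyper[OF n0] by simp
  have "e \<noteq> {}" "e \<noteq> F" using eF aF by auto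
  then obtain m where m: "m \<in> ?V" "m \<noteq> 0" "e = fc m F" using face_imp_fc[OF n0 vF eF(1)] by blast
  let ?W = "perp ?V m"
  have ve: "vpoly ?W e" unfolding m(3) by (rule vpoly_fc[OF vF])
  have ie: "irint ?W e \<noteq> {}"
    using aff_dim_vpoly(2)[OF subspace_perp[OF subspace_hyper] ve] eF(2) dim_edge[OF n0 m(1,2)] by simp
  have "e'' \<noteq> {}" "e'' \<noteq> F" using e''(1) aF unfolding edge_of_def by auto
  then obtain m'' where m'': "m'' \<in> ?V" "m'' \<noteq> 0" "e'' = fc m'' F"
    using face_imp_fc[OF n0 vF] e''(1) unfolding edge_of_def by blast
  have conste: "m'' \<bullet> x = m'' \<bullet> y" if "x\<in>e" "y\<in>e" for x y
  proof -
    have "t'' + x \<in> fc m'' F" "t'' + y \<in> fc m'' F" using e''(3) m''(3) that by auto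
    from fc_const[OF this] show ?thesis by (simp add: inner_add_right)
  qed
  have "\<exists>k. m'' = k *\<^sub>R m"
  proof (rule parallel_of_const[OF subspace_hyper m(1,2) ie m''(1)])
    show "m'' \<bullet> x = m'' \<bullet> y" if "x \<in> e" "y \<in> e" for x y using that by (rule conste)
    show "m \<bullet> x = m \<bullet> y" if "x \<in> e" "y \<in> e" for x y using that unfolding m(3) by (rule fc_const)
  qed
  then obtain l where l: "m'' = l *\<^sub>R m" by blast
  have "l \<noteq> 0" using l m''(2) by auto
  moreover have "\<not> l > 0" using fc_scale[of l m F] l m''(3) m(3) e''(2) by auto
  ultimately have "-l > 0" by simp
  then have "fc ((-l) *\<^sub>R (-m)) F = fc (-m) F" by (rule fc_scale)
  then have e''m: "e'' = fc (-m) F" using m''(3) l by simp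
  have "e' = fc m F'" unfolding e'(1) F'(3) fc_translation m(3) ..
  moreover have "e''' = fc (-m) F'"
    unfolding e'(2) F'(3) fc_translation e''m[symmetric] e''(3) by (simp add: image_image algebra_simps)
  ultimately show ?thesis using that n0 n(2) F'n iF m e''m ie by blast
qed

lemma fc_reflect_image: "fc m ((\<lambda>x. 2 *\<^sub>R c - x) ` F) = (\<lambda>x. 2 *\<^sub>R c - x) ` fc (-m) F"
  by (auto simp: fc_def inner_diff_right)

lemma msum_reflect:
  assumes "uminus ` T = T"
  shows "msum ((\<lambda>x. 2 *\<^sub>R c - x) ` P) T = (\<lambda>x. 2 *\<^sub>R c - x) ` msum P T"
proof (intro set_eqI iffI)
  have neg: "- t \<in> T" if "t \<in> T" for t using assms that by blast
  fix y
  {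
    assume "y \<in> msum ((\<lambda>x. 2 *\<^sub>R c - x) ` P) T"
    then obtain x t where xt: "x \<in> P" "t \<in> T" "y = (2 *\<^sub>R c - x) + t" by (auto simp: msum_def)
    then have "y = 2 *\<^sub>R c - (x + (- t))" "x + (- t) \<in> msum P T" using neg unfolding msum_def by (simp, blast)
    then show "y \<in> (\<lambda>x. 2 *\<^sub>R c - x) ` msum P T" by blast
  next
    assume "y \<in> (\<lambda>x. 2 *\<^sub>R c - x) ` msum P T"
    then obtain x t where "x \<in> P" "t \<in> T" "y = 2 *\<^sub>R c - (x + t)" by (auto simp: msum_def)
    then have "y = (2 *\<^sub>R c - x) + (- t)" "2 *\<^sub>R c - x \<in> (\<lambda>x. 2 *\<^sub>R c - x) ` P" "- t \<in> T" using neg by auto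
    then show "y \<in> msum ((\<lambda>x. 2 *\<^sub>R c - x) ` P) T" unfolding msum_def by blast
  }
qed

lemma measure_reflect:
  fixes S :: "'a::euclidean_space set"
  assumes "compact S" shows "measure lborel ((\<lambda>x. 2 *\<^sub>R c - x) ` S) = measure lborel S"
proof -
  have im: "(\<lambda>x. 2 *\<^sub>R c - x) ` S = (\<lambda>x. (-1) *\<^sub>R x + 2 *\<^sub>R c) ` S" by (intro image_cong) auto
  have "compact ((\<lambda>x. 2 *\<^sub>R c - x) ` S)" using assms by (intro compact_continuous_image continuous_intros)
  moreover have "measure lebesgue ((\<lambda>x. 2 *\<^sub>R c - x) ` S) = measure lebesgue S"
    using measure_lebesgue_affine[of "-1" "2 *\<^sub>R c" S] unfolding im by (simp add: add.commute)
  ultimately show ?thesis using assms measure_lborel_compact by metis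
qed

lemma fc_segment:
  assumes "p \<noteq> q" "k > 0"
  shows "fc (k *\<^sub>R (q - p)) (closed_segment p q) = {q}" "fc (- (k *\<^sub>R (q - p))) (closed_segment p q) = {p}"
proof -
  have e: "fc (k *\<^sub>R (q - p)) (closed_segment p q) = {q}" if "p \<noteq> q" for p q :: 'a
  proof -
    have le: "(q - p) \<bullet> x \<le> (q - p) \<bullet> q \<and> ((q - p) \<bullet> x = (q - p) \<bullet> q \<longrightarrow> x = q)" if x: "x \<in> closed_segment p q" for x
    proof -
      obtain u where u: "0 \<le> u" "u \<le> 1" "x = (1 - u) *\<^sub>R p + u *\<^sub>R q" using x by (auto simp: closed_segment_def)
      have d: "(q - p) \<bullet> q - (q - p) \<bullet> x = (1 - u) * ((q - p) \<bullet> (q - p))"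
        by (simp add: u(3) inner_add_right inner_diff_right algebra_simps)
      have p: "(q - p) \<bullet> (q - p) > 0" using \<open>p \<noteq> q\<close> by simp
      have "0 \<le> (1 - u) * ((q - p) \<bullet> (q - p))" using u p by (intro mult_nonneg_nonneg) auto
      moreover have "u = 1" if "(1 - u) * ((q - p) \<bullet> (q - p)) = 0" using that p by auto
      ultimately show ?thesis using d u(3) by auto
    qed
    have "fc (q - p) (closed_segment p q) = {q}"
    proof (intro set_eqI iffI)
      fix x assume x: "x \<in> fc (q - p) (closed_segment p q)"
      then have "(q - p) \<bullet> q \<le> (q - p) \<bullet> x" "x \<in> closed_segment p q" by (auto simp: fc_def)
      then show "x \<in> {q}" using le[of x] by auto
    next
      fix x assume "x \<in> {q}"
      then show "x \<in> fc (q - p) (closed_segment p q)" using le by (auto simp: fc_def)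
    qed
    then show ?thesis using fc_scale[OF assms(2)] by metis
  qed
  show "fc (k *\<^sub>R (q - p)) (closed_segment p q) = {q}" by (rule e[OF assms(1)])
  have "- (k *\<^sub>R (q - p)) = k *\<^sub>R (p - q)" by (simp add: algebra_simps)
  then show "fc (- (k *\<^sub>R (q - p))) (closed_segment p q) = {p}"
    using e[of q p] assms(1) by (simp add: closed_segment_commute)
qed

section \<open>Good points and counts of corners\<close>

context lattice3 begin

lemma cnt_pos: "bounded P \<Longrightarrow> l \<in> L \<Longrightarrow> x - l \<in> P \<Longrightarrow> cnt P x > 0"
  unfolding cnt_def using finite_bounded[of P x] by (auto simp: card_gt_0_iff)

lemma cnt_posD: "cnt P x > 0 \<Longrightarrow> \<exists>l\<in>L. x - l \<in> P"
  unfolding cnt_def by (metis (mono_tags, lifting) card_gt_0_iff ex_in_conv mem_Collect_eq)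

text \<open>A generic displacement within the relative interior keeps the point in \<open>P\<close>
  and takes it off all walls. It provides a point at which the vanishing of a count can be
  exploited.\<close>

lemma good_point:
  assumes V: "subspace V" and P: "irint V P \<noteq> {}" and fam: "vfam V fam"
  shows "\<exists>x\<in>P. x \<in> good V fam"
proof -
  obtain x e where x: "x \<in> P" "e>0" "\<And>v. v\<in>V \<Longrightarrow> norm v < e \<Longrightarrow> x + v \<in> P" using P by (auto simp: irint_def)
  obtain C where C: "hreps V C fam" by (rule walls_ex[OF V fam]) blast
  have "\<exists>w\<in>V. norm (w - 0) < e \<and> (\<forall>(a,\<beta>)\<in>walls V C fam x. a \<bullet> w \<noteq> \<beta>)"
  proof (rule generic_in_subspace[OF V walls_props(1)[OF C] _ subspace_0[OF V] x(2)])
    show "\<exists>u\<in>V. a \<bullet> u \<noteq> 0" if "(a,\<beta>) \<in> walls V C fam x" for a \<beta>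
      using walls_props(2)[OF C that] by (intro bexI[of _ a]) auto
  qed
  then obtain w where w: "w\<in>V" "norm w < e" "\<And>a \<beta>. (a,\<beta>)\<in>walls V C fam x \<Longrightarrow> a \<bullet> w \<noteq> \<beta>" by auto
  have "x + w \<in> good V fam" by (rule walls_good[OF V C w(3)])
  then show ?thesis using x(3)[OF w(1,2)] by blast
qed

lemma cnt_flat: "x \<in> good V fam \<Longrightarrow> (c,P) \<in> set fam \<Longrightarrow> irint V P = {} \<Longrightarrow> cnt P x = 0"
  using cnt_posD[of P x] by (fastforce simp: good_def)

lemma cnt_singleton: "int (cnt {a} x) = of_bool (x - a \<in> L)"
proof -
  have "{l\<in>L. x - l \<in> {a}} = (if x - a \<in> L then {x - a} else {})" by (auto simp: algebra_simps)
  then show ?thesis by (simp add: cnt_def)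
qed

lemma mem_diff_iff: "l \<in> L \<Longrightarrow> y - l \<in> L \<longleftrightarrow> y \<in> L"
  using diff_mem[of y l] add_mem[of "y - l" l] by auto

text \<open>The end points of the four signed edges, written relative to \<open>p\<close>: the eight
  vertices of a parallelepiped, with opposite signs at the two ends of each edge.\<close>

lemma corner_mult:
  assumes "p \<noteq> q" "k > 0"
  defines "e \<equiv> closed_segment p q" and "\<delta> \<equiv> \<lambda>y. (of_bool (y \<in> L) :: int)"
  shows "mult (bdry (k *\<^sub>R (q - p)) [(1, e), (-1, (+) t'' ` e), (-1, (+) t' ` e), (1, (+) (t' + t'') ` e)]) x =
    \<delta> (x - p - (q - p)) - \<delta> (x - p) - \<delta> (x - p - t'' - (q - p)) + \<delta> (x - p - t'') - \<delta> (x - p - t' - (q - p)) + \<delta> (x - p - t')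
    + \<delta> (x - p - t' - t'' - (q - p)) - \<delta> (x - p - t' - t'')"
proof -
  have f: "fc (k *\<^sub>R (q - p)) ((+) t ` e) = {t + q}" "fc (- (k *\<^sub>R (q - p))) ((+) t ` e) = {t + p}" for t
    unfolding fc_translation e_def fc_segment[OF assms(1,2)] by simp_all
  have f0: "fc (k *\<^sub>R (q - p)) e = {q}" "fc (- (k *\<^sub>R (q - p))) e = {p}"
    unfolding e_def fc_segment[OF assms(1,2)] by simp_all
  have a: "x - q = x - p - (q - p)" "x - (t'' + q) = x - p - t'' - (q - p)" "x - (t'' + p) = x - p - t''"
    "x - (t' + q) = x - p - t' - (q - p)" "x - (t' + p) = x - p - t'"
    "x - (t' + t'' + q) = x - p - t' - t'' - (q - p)" "x - (t' + t'' + p) = x - p - t' - t''"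
    by simp_all
  show ?thesis
    unfolding bdry_Cons bdry_Nil mult_Cons mult_Nil f f0 cnt_singleton a \<delta>_def by simp
qed

text \<open>Adjacent vertices carry opposite signs, and so do antipodal ones, which are three edges
  apart. If an edge vector lies in \<open>L\<close>, vertices cancel along the edges parallel to it;
  if all four diagonals lie in \<open>L\<close>, they cancel along the diagonals.\<close>

lemma corner_vanish:
  assumes "w \<notin> L \<and> t' \<notin> L \<and> t'' \<notin> L \<longrightarrow> w + t' + t'' \<in> L \<and> w + t' - t'' \<in> L \<and> w - t' + t'' \<in> L \<and> w - t' - t'' \<in> L"
  defines "\<delta> \<equiv> \<lambda>y. (of_bool (y \<in> L) :: int)"
  shows "\<delta> (a - w) - \<delta> a - \<delta> (a - t'' - w) + \<delta> (a - t'') - \<delta> (a - t' - w) + \<delta> (a - t') + \<delta> (a - t' - t'' - w) - \<delta> (a - t' - t'') = 0"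
proof -
  have per: "\<delta> y = \<delta> z" if "y - z \<in> L" for y z
    using mem_diff_iff[OF that, of y] by (simp add: \<delta>_def)
  consider "w \<in> L" | "t' \<in> L" | "t'' \<in> L" | "w + t' + t'' \<in> L" "w + t' - t'' \<in> L" "w - t' + t'' \<in> L" "w - t' - t'' \<in> L"
    using assms(1) by blast
  then show ?thesis
  proof cases
    case 1
    have "\<delta> y = \<delta> (y - w)" for y by (rule per) (simp add: 1)
    then show ?thesis by (metis (no_types, opaque_lifting) add.commute add_diff_cancel_left' diff_add_cancel diff_self diff_minus_eq_add)
  next
    case 2
    have "\<delta> (a - t') = \<delta> a" "\<delta> (a - t' - w) = \<delta> (a - w)" "\<delta> (a - t' - t'') = \<delta> (a - t'')" "\<delta> (a - t' - t'' - w) = \<delta> (a - t'' - w)"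
      using 2 uminus_mem[OF 2] by (intro per; simp)+
    then show ?thesis by simp
  next
    case 3
    have "\<delta> (a - t'') = \<delta> a" "\<delta> (a - t'' - w) = \<delta> (a - w)" "\<delta> (a - t' - t'') = \<delta> (a - t')" "\<delta> (a - t' - t'' - w) = \<delta> (a - t' - w)"
      using 3 uminus_mem[OF 3] by (intro per; simp)+
    then show ?thesis by simp
  next
    case 4
    have "\<delta> a = \<delta> (a - t' - t'' - w)" by (rule per) (use 4(1) in \<open>simp add: algebra_simps\<close>)
    moreover have "\<delta> (a - t'') = \<delta> (a - t' - w)" by (rule per) (use 4(2) in \<open>simp add: algebra_simps\<close>)
    moreover have "\<delta> (a - t') = \<delta> (a - t'' - w)" by (rule per) (use 4(3) in \<open>simp add: algebra_simps\<close>)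
    moreover have "\<delta> (a - t' - t'') = \<delta> (a - w)" by (rule per) (use 4(4) in \<open>simp add: algebra_simps\<close>)
    ultimately show ?thesis by simp
  qed
qed

text \<open>Choose \<open>a\<close> so that a given vertex contributes. Only its three neighbours
  and its antipode have the opposite sign; the neighbours are ruled out because no edge vector is in
  \<open>L\<close>, so the antipode must be congruent to it. Four starting vertices give the four
  diagonals.\<close>

lemma corner_vanish_iff:
  assumes z: "\<And>a. (of_bool (a - w \<in> L) :: int) - of_bool (a \<in> L) - of_bool (a - t'' - w \<in> L) + of_bool (a - t'' \<in> L)
     - of_bool (a - t' - w \<in> L) + of_bool (a - t' \<in> L) + of_bool (a - t' - t'' - w \<in> L) - of_bool (a - t' - t'' \<in> L) = 0"
    and n: "w \<notin> L" "t' \<notin> L" "t'' \<notin> L"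
  shows "w + t' + t'' \<in> L" "w + t' - t'' \<in> L" "w - t' + t'' \<in> L" "w - t' - t'' \<in> L"
proof -
  have neg: "- y \<in> L \<longleftrightarrow> y \<in> L" for y using uminus_mem[of y] uminus_mem[of "-y"] by auto
  have 1: "- w \<notin> L" "- t' \<notin> L" "- t'' \<notin> L" using n neg by auto
  have "- t' - t'' - w \<in> L" using z[of 0] 1 zero_mem by (auto simp: of_bool_def split: if_splits)
  then have "- (w + t' + t'') \<in> L" by (simp add: algebra_simps)
  then show "w + t' + t'' \<in> L" unfolding neg .
  have "t' - t'' - w \<in> L" using z[of t'] n 1 zero_mem by (auto simp: of_bool_def split: if_splits)
  then have "- (w - t' + t'') \<in> L" by (simp add: algebra_simps)
  then show "w - t' + t'' \<in> L" unfolding neg .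
  have "t'' - t' - w \<in> L" using z[of t''] n 1 zero_mem by (auto simp: of_bool_def diff_right_commute split: if_splits)
  then have "- (w + t' - t'') \<in> L" by (simp add: algebra_simps)
  then show "w + t' - t'' \<in> L" unfolding neg .
  have "t' + t'' - w \<in> L" using z[of "t' + t''"] n 1 zero_mem by (auto simp: of_bool_def split: if_splits)
  then have "- (w - t' - t'') \<in> L" by (simp add: algebra_simps)
  then show "w - t' - t'' \<in> L" unfolding neg .
qed

section \<open>From tiling to symmetry and the frame conditions\<close>

lemma vfam_facets:
  fixes A :: "(real^3) set"
  assumes "polytope A" "interior A \<noteq> {}"
  shows "vfam (hyper n) (bdry n [(1,A)])" "vpoly (hyper n) (fc n A)"
proof -
  have v: "vpoly UNIV A" using assms by (auto simp: vpoly_def)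
  show "vfam (hyper n) (bdry n [(1,A)])" using v by (intro vfam_bdry) (simp add: vfam_Cons)
  show "vpoly (hyper n) (fc n A)" using v by (rule vpoly_fc)
qed

text \<open>Thickening by the segment from 0 to \<open>n\<close> turns opposite faces into the
  prisms by which areas are measured, so balanced volumes mean equal areas.\<close>

lemma tiling_imp_symmetric:
  assumes A: "polytope A" "interior A \<noteq> {}" and c: "const_on UNIV [(1,A)]"
  shows "\<exists>c. (\<lambda>x. 2 *\<^sub>R c - x) ` A = A"
proof (rule symmetric_of_equal_areas[OF A])
  fix n :: "real^3" assume n: "norm n = 1"
  have fam: "vfam UNIV [(1,A)]" using A by (auto simp: vfam_Cons vpoly_def)
  have null: "null_on (hyper n) (bdry n [(1,A)])"
    using n by (intro const_imp_null_bdry[OF subspace_UNIV _ _ fam c]) auto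
  have TV: "t \<bullet> v = 0" if "t \<in> closed_segment 0 n" "v \<in> hyper n" for t v
    using that by (auto simp: closed_segment_def perp_def)
  show "measure lborel (prism n (fc n A)) = measure lborel (prism n (fc (-n) A))"
    using null_imp_prism_measure[OF subspace_hyper vfam_facets(1)[OF A] null compact_segment TV]
    by (simp add: prism_def msum_def)
qed

text \<open>The twofold boundary consists of two opposite edges of the facet and two of the opposite
  facet. Reflection in the centre of \<open>A\<close> identifies the latter pair with the former,
  with signs that add up, so the balance of volumes says that opposite edges have equal length. This
  is where symmetry of \<open>A\<close> enters.\<close>

lemma tiling_imp_facet_symmetric:
  assumes A: "polytope A" "interior A \<noteq> {}" and const: "const_on UNIV [(1,A)]"
    and c: "(\<lambda>x. 2 *\<^sub>R c - x) ` A = A" and n: "norm n = 1"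
  shows "\<exists>d. (\<lambda>x. 2 *\<^sub>R d - x) ` fc n A = fc n A"
proof -
  have n0: "n \<noteq> 0" using n by auto
  let ?V = "hyper n" let ?F = "fc n A"
  have fam: "vfam UNIV [(1,A)]" using A by (auto simp: vfam_Cons vpoly_def)
  note vF = vfam_facets[OF A]
  have null: "null_on ?V (bdry n [(1,A)])"
    by (rule const_imp_null_bdry[OF subspace_UNIV UNIV_I n0 fam const])
  show ?thesis
  proof (rule polygon_symmetric[OF n dim_hyper[OF n0] vF(2)])
    fix m assume m: "m \<in> ?V" "m \<noteq> 0"
    let ?W = "perp ?V m"
    have W: "subspace ?W" by (rule subspace_perp[OF subspace_hyper])
    have nullC: "null_on ?W (bdry m (bdry n [(1,A)]))"
      by (rule const_imp_null_bdry[OF subspace_hyper m vF(1) null_imp_const[OF null]])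
    obtain v where v: "norm v = 1" "v \<in> ?W" "\<And>w. w \<in> ?W \<Longrightarrow> w = (w \<bullet> v) *\<^sub>R v"
      by (rule edge_direction[OF n0 m]) (rule that)
    \<comment> \<open>A rectangle orthogonal to the edge direction and symmetric under negation, so
      that reflecting a thickened edge gives the thickening of the reflected edge.\<close>
    define T where "T = msum (closed_segment (-n) n) (closed_segment (-m) m)"
    have T: "compact T" "convex T" unfolding T_def by (auto intro: compact_msum convex_msum)
    have seg: "x \<in> closed_segment (-a) a \<longleftrightarrow> (\<exists>s. \<bar>s\<bar> \<le> 1 \<and> x = s *\<^sub>R a)" for x a :: "real^3"
    proof
      have comb: "(1 - u) *\<^sub>R (- a) + u *\<^sub>R a = (2 * u - 1) *\<^sub>R a" for u :: real
      proof -
        have "(1 - u) *\<^sub>R (- a) + u *\<^sub>R a = (- (1 - u) + u) *\<^sub>R a"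
          by (simp only: scaleR_left_distrib scaleR_minus_left scaleR_minus_right)
        then show ?thesis by simp
      qed
      {
      assume "x \<in> closed_segment (-a) a"
      then obtain u where "0 \<le> u" "u \<le> 1" "x = (1 - u) *\<^sub>R (-a) + u *\<^sub>R a" by (auto simp: closed_segment_def)
      then show "\<exists>s. \<bar>s\<bar> \<le> 1 \<and> x = s *\<^sub>R a" unfolding comb by (intro exI[of _ "2*u - 1"]) auto
    next
      assume "\<exists>s. \<bar>s\<bar> \<le> 1 \<and> x = s *\<^sub>R a"
      then obtain s where "\<bar>s\<bar> \<le> 1" "x = s *\<^sub>R a" by blast
      then show "x \<in> closed_segment (-a) a" unfolding closed_segment_def
        unfolding comb by (intro CollectI exI[of _ "(s+1)/2"]) (auto simp: abs_le_iff add_divide_distrib)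
      }
    qed
    have Tmem: "t \<in> T \<longleftrightarrow> (\<exists>s r. \<bar>s\<bar> \<le> 1 \<and> \<bar>r\<bar> \<le> 1 \<and> t = s *\<^sub>R n + r *\<^sub>R m)" for t
      unfolding T_def msum_def using seg by (simp, metis)
    have nv: "n \<bullet> v = 0" "m \<bullet> v = 0" using v(2) by (auto simp: perp_def)
    have Tv: "v \<bullet> t = 0" if "t \<in> T" for t using that nv by (auto simp: Tmem inner_add_right inner_commute)
    have TW: "t \<bullet> w = 0" if "t \<in> T" "w \<in> ?W" for t w
      using Tv[OF that(1)] v(3)[OF that(2)] by (metis inner_commute inner_scaleR_right mult_zero_right)
    have Tneg: "uminus ` T = T"
    proof -
      have "- t \<in> T" if tT: "t \<in> T" for t
      proof -
        obtain s r where sr: "\<bar>s\<bar> \<le> 1" "\<bar>r\<bar> \<le> 1" "t = s *\<^sub>R n + r *\<^sub>R m" using tT Tmem[of t] by blast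
        have "- t = (-s) *\<^sub>R n + (-r) *\<^sub>R m" unfolding sr(3) by (simp only: minus_add_distrib scaleR_minus_left)
        moreover have "\<bar>-s\<bar> \<le> 1" "\<bar>-r\<bar> \<le> 1" using sr by simp_all
        ultimately show ?thesis using Tmem[of "-t"] by blast
      qed
      then have "uminus ` T \<subseteq> T" "uminus ` (uminus ` T) \<subseteq> uminus ` T" by blast+
      then show ?thesis by (simp add: image_image subset_antisym)
    qed
    have \<kappa>: "measure lborel (prism v T) > 0"
    proof (rule measure_body_pos)
      have cv: "convex (prism v T)" "compact (prism v T)" unfolding prism_def using T by (auto intro: convex_msum compact_msum)
      have "interior (prism v T) \<noteq> {}"
      proof
        assume "interior (prism v T) = {}"
        then obtain a b where ab: "a \<noteq> 0" "prism v T \<subseteq> {x. a \<bullet> x = b}" using empty_interior_subset_hyperplane[OF cv(1)] by metis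
        have mem: "s *\<^sub>R n + r *\<^sub>R m + u *\<^sub>R v \<in> prism v T" if "\<bar>s\<bar> \<le> 1" "\<bar>r\<bar> \<le> 1" "0 \<le> u" "u \<le> 1" for s r u
        proof -
          have "s *\<^sub>R n + r *\<^sub>R m \<in> T" using that(1,2) Tmem by blast
          then show ?thesis unfolding prism_alt using that(3,4) by blast
        qed
        have "a \<bullet> (0 *\<^sub>R n + 0 *\<^sub>R m + 0 *\<^sub>R v) = b" "a \<bullet> (1 *\<^sub>R n + 0 *\<^sub>R m + 0 *\<^sub>R v) = b"
          "a \<bullet> (0 *\<^sub>R n + 1 *\<^sub>R m + 0 *\<^sub>R v) = b" "a \<bullet> (0 *\<^sub>R n + 0 *\<^sub>R m + 1 *\<^sub>R v) = b"
          by (intro ab(2)[THEN subsetD, simplified] mem; simp)+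
        then have "a \<bullet> n = 0" "a \<bullet> m = 0" "a \<bullet> v = 0" by simp_all
        then have "a \<in> ?W" by (simp add: perp_def inner_commute)
        then show False using v(3)[of a] \<open>a \<bullet> v = 0\<close> ab(1) by simp
      qed
      then show "convex_body (prism v T)" using cv by (simp add: convex_body_def)
    qed
    \<comment> \<open>A thickened segment is an oblique prism over \<open>T\<close>; its volume is
      the length measured along \<open>v\<close> times a fixed positive factor.\<close>
    have \<mu>: "measure lborel (msum (closed_segment p q) T) = \<bar>v \<bullet> (q - p)\<bar> * measure lborel (prism v T)" for p q
    proof -
      have "msum (closed_segment p q) T = {p + 1 *\<^sub>R z + s *\<^sub>R (q - p) |z s. z \<in> T \<and> 0 \<le> s \<and> s \<le> 1}"
      proof (intro set_eqI iffI)
        fix y assume "y \<in> msum (closed_segment p q) T"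
        then obtain u t where "0 \<le> u" "u \<le> 1" "t \<in> T" "y = (1 - u) *\<^sub>R p + u *\<^sub>R q + t"
          unfolding msum_def closed_segment_def by blast
        moreover from this have "y = p + 1 *\<^sub>R t + u *\<^sub>R (q - p)" by (simp add: algebra_simps)
        ultimately show "y \<in> {p + 1 *\<^sub>R z + s *\<^sub>R (q - p) |z s. z \<in> T \<and> 0 \<le> s \<and> s \<le> 1}" by blast
      next
        fix y assume "y \<in> {p + 1 *\<^sub>R z + s *\<^sub>R (q - p) |z s. z \<in> T \<and> 0 \<le> s \<and> s \<le> 1}"
        then obtain z s where zs: "z \<in> T" "0 \<le> s" "s \<le> 1" "y = p + 1 *\<^sub>R z + s *\<^sub>R (q - p)" by blast
        then have "y = ((1 - s) *\<^sub>R p + s *\<^sub>R q) + z" by (simp add: algebra_simps)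
        moreover have "(1 - s) *\<^sub>R p + s *\<^sub>R q \<in> closed_segment p q" using zs by (auto simp: closed_segment_def)
        ultimately show "y \<in> msum (closed_segment p q) T" unfolding msum_def using zs(1) by blast
      qed
      then show ?thesis using measure_oblique_prism(2)[OF T(1) v(1) Tv, of p 1 "q - p"] by simp
    qed
    have vE: "vpoly ?W (fc m ?F)" "vpoly ?W (fc (-m) ?F)" using vpoly_fc[OF vF(2)[of n], of m] vpoly_fc[OF vF(2)[of n], of "-m"] by simp_all
    obtain p q where pq: "fc m ?F = closed_segment p q"
      using vpoly_dim1_segment[OF W _ vE(1)] dim_edge[OF n0 m] by (metis order_refl)
    obtain p' q' where pq': "fc (-m) ?F = closed_segment p' q'"
      using vpoly_dim1_segment[OF W _ vE(2)] dim_edge[OF n0 m] by (metis order_refl)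
    have F': "fc (-n) A = (\<lambda>x. 2 *\<^sub>R c - x) ` ?F" by (rule fc_reflect[OF c])
    have r1: "fc m (fc (-n) A) = (\<lambda>x. 2 *\<^sub>R c - x) ` closed_segment p' q'" "fc (-m) (fc (-n) A) = (\<lambda>x. 2 *\<^sub>R c - x) ` closed_segment p q"
      unfolding F' fc_reflect_image by (simp_all add: pq pq')
    have mr: "measure lborel (msum ((\<lambda>x. 2 *\<^sub>R c - x) ` closed_segment a b) T) = measure lborel (msum (closed_segment a b) T)" for a b
      unfolding msum_reflect[OF Tneg] using T by (intro measure_reflect compact_msum) auto
    have "(\<Sum>(c,P)\<leftarrow>bdry m (bdry n [(1,A)]). of_int c * measure lborel {p + t |p t. p\<in>P \<and> t\<in>T}) = 0"
      by (rule null_imp_prism_measure[OF W vfam_bdry[OF vF(1)] nullC T(1) TW])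
    then have "measure lborel (msum (closed_segment p q) T) = measure lborel (msum (closed_segment p' q') T)"
      by (simp add: pq pq' r1 mr[unfolded msum_def] msum_def)
    then have len: "\<bar>v \<bullet> (q - p)\<bar> = \<bar>v \<bullet> (q' - p')\<bar>" unfolding \<mu> using \<kappa> by simp
    have "q - p \<in> ?W" "q' - p' \<in> ?W" using vE unfolding pq pq' vpoly_def by auto
    then have e: "q - p = ((q - p) \<bullet> v) *\<^sub>R v" "q' - p' = ((q' - p') \<bullet> v) *\<^sub>R v" using v(3) by blast+
    have "q - p = q' - p' \<or> q - p = p' - q'"
    proof (cases "v \<bullet> (q - p) = v \<bullet> (q' - p')")
      case True then show ?thesis using e by (metis inner_commute)
    next
      case False
      then have "(q - p) \<bullet> v = - ((q' - p') \<bullet> v)" using len by (simp add: inner_commute abs_eq_iff)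
      then have "q - p = - (q' - p')" using e by (metis scaleR_minus_left)
      then show ?thesis by simp
    qed
    then show "\<exists>t. fc (-m) ?F = (+) t ` fc m ?F"
    proof
      assume "q - p = q' - p'"
      then have "p' = (p' - p) + p" "q' = (p' - p) + q" by (auto simp: algebra_simps)
      then have "closed_segment p' q' = (+) (p' - p) ` closed_segment p q" using closed_segment_translation by metis
      then show ?thesis unfolding pq pq' by blast
    next
      assume "q - p = p' - q'"
      then have "q' = (q' - p) + p" "p' = (q' - p) + q" by (auto simp: algebra_simps)
      then have "closed_segment q' p' = (+) (q' - p) ` closed_segment p q" using closed_segment_translation by metis
      then show ?thesis unfolding pq pq' by (metis closed_segment_commute)
    qed
  qed
qed

text \<open>At a good point of \<open>F\<close> the zero translation counts positively, so some
  translate of \<open>F'\<close> must cancel it and lies in the same plane. Likewise a good point of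
  \<open>e\<close> must be covered by a translate of \<open>e'\<close> or \<open>e''\<close>, the
  members with negative sign. For the third condition the boundary is taken once more, down to the
  vertices.\<close>

lemma tiling_imp_frame_conditions:
  assumes A: "polytope A" "interior A \<noteq> {}" and const: "const_on UNIV [(1,A)]"
    and fr: "four_legged_frame A F F' t' t'' e e' e'' e'''"
  shows "\<exists>l'\<in>L. coplanar ((+) l' ` F \<union> F')"
    and "\<exists>l\<in>L. collinear ((+) l ` e \<union> e') \<or> collinear ((+) l ` e \<union> e'')"
    and "edge_vector e v \<Longrightarrow> v \<notin> L \<and> t' \<notin> L \<and> t'' \<notin> L \<Longrightarrow>
          v + t' + t'' \<in> L \<and> v + t' - t'' \<in> L \<and> v - t' + t'' \<in> L \<and> v - t' - t'' \<in> L"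
proof -
  obtain n m where n0: "n \<noteq> 0" and F: "F = fc n A" "F' = fc (-n) A" "irint (hyper n) F \<noteq> {}"
    and m: "m \<in> hyper n" "m \<noteq> 0" and e: "e = fc m F" "e'' = fc (-m) F" "irint (perp (hyper n) m) e \<noteq> {}"
    "e' = fc m F'" "e''' = fc (-m) F'"
    by (rule frame_fc[OF A fr]) (rule that)
  have tr: "F' = (+) t' ` F" "e'' = (+) t'' ` e" "e' = (+) t' ` e" "e''' = (+) (t' + t'') ` e"
    using fr unfolding four_legged_frame_def by auto
  let ?V = "hyper n" let ?W = "perp ?V m"
  have W: "subspace ?W" by (rule subspace_perp[OF subspace_hyper])
  have fam: "vfam UNIV [(1,A)]" using A by (auto simp: vfam_Cons vpoly_def)
  note vF = vfam_facets[OF A]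
  have B: "bdry n [(1,A)] = [(1,F),(-1,F')]" by (simp add: F)
  have C: "bdry m [(1,F),(-1,F')] = [(1,e),(-1,e''),(-1,e'),(1,e''')]" by (simp add: e)
  have nullB: "null_on ?V [(1,F),(-1,F')]"
    using const_imp_null_bdry[OF subspace_UNIV UNIV_I n0 fam const] unfolding B .
  have vB: "vfam ?V [(1,F),(-1,F')]" using vF(1)[of n] unfolding B .
  have nullC: "null_on ?W [(1,e),(-1,e''),(-1,e'),(1,e''')]"
    using const_imp_null_bdry[OF subspace_hyper m vB null_imp_const[OF nullB]] unfolding C .
  have vC: "vfam ?W [(1,e),(-1,e''),(-1,e'),(1,e''')]" using vfam_bdry[OF vB, of m] unfolding C .
  have vbd: "bounded P" if "vpoly U P" for U P :: "(real^3) set" using that by (auto simp: vpoly_def polytope_imp_bounded)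
  show "\<exists>l'\<in>L. coplanar ((+) l' ` F \<union> F')"
  proof -
    obtain x where x: "x \<in> F" "x \<in> good ?V [(1,F),(-1,F')]" using good_point[OF subspace_hyper F(3) vB] by blast
    have "bounded F" using vB vbd by (auto simp: vfam_Cons)
    then have "cnt F x > 0" using cnt_pos[of F 0 x] zero_mem x(1) by simp
    then have "cnt F' x > 0" using nullB x(2) unfolding null_on_def by fastforce
    then obtain l where l: "l \<in> L" "x - l \<in> F'" using cnt_posD by blast
    \<comment> \<open>As \<open>x - l\<close> lies in \<open>F'\<close>, it is the translation by
      \<open>-l\<close> that carries the plane of \<open>F\<close> to that of
      \<open>F'\<close>.\<close>
    have "(+) (-l) ` F \<union> F' \<subseteq> {y. n \<bullet> y = n \<bullet> (x - l)}"
    proof -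
      have "n \<bullet> y = n \<bullet> x" if "y \<in> F" for y using fc_const[of y n A x] that x(1) unfolding F(1) by simp
      moreover have "n \<bullet> y = n \<bullet> (x - l)" if "y \<in> F'" for y using fc_const[of y "-n" A "x - l"] that l(2) unfolding F(2) by simp
      ultimately show ?thesis by (auto simp: inner_add_right inner_diff_right)
    qed
    then have "coplanar ((+) (-l) ` F \<union> F')" by (rule hyperplane_imp_coplanar[OF n0])
    then show ?thesis using uminus_mem[OF l(1)] by blast
  qed
  show "\<exists>l\<in>L. collinear ((+) l ` e \<union> e') \<or> collinear ((+) l ` e \<union> e'')"
  proof -
    obtain x where x: "x \<in> e" "x \<in> good ?W [(1,e),(-1,e''),(-1,e'),(1,e''')]" using good_point[OF W e(3) vC] by blast
    have "bounded e" using vC vbd by (auto simp: vfam_Cons)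
    then have "cnt e x > 0" using cnt_pos[of e 0 x] zero_mem x(1) by simp
    then have "cnt e'' x > 0 \<or> cnt e' x > 0" using nullC x(2) unfolding null_on_def by fastforce
    then obtain l g where l: "l \<in> L" "x - l \<in> g" "g = e' \<or> g = e''" using cnt_posD by blast
    obtain v where v: "\<And>w. w \<in> ?W \<Longrightarrow> w = (w \<bullet> v) *\<^sub>R v" by (rule edge_direction[OF n0 m]) (rule that)
    have vg: "vpoly ?W g" "vpoly ?W e" using vC l(3) by (auto simp: vfam_Cons)
    have base: "y - (x - l) \<in> ?W" if "y \<in> (+) (-l) ` e \<union> g" for y
      using that
    proof
      assume "y \<in> (+) (-l) ` e"
      then obtain z where z: "z \<in> e" "y = - l + z" by auto
      have "z - x \<in> ?W" using vg(2) x(1) z(1) by (simp add: vpoly_def)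
      moreover have "y - (x - l) = z - x" unfolding z(2) by simp
      ultimately show ?thesis by (simp only:)
    next
      assume "y \<in> g"
      then show ?thesis using vg(1) l(2) by (simp add: vpoly_def)
    qed
    have "collinear ((+) (-l) ` e \<union> g)" unfolding collinear_def
    proof (intro exI[of _ v] ballI)
      fix y z assume y: "y \<in> (+) (-l) ` e \<union> g" and z: "z \<in> (+) (-l) ` e \<union> g"
      have "(y - (x - l)) - (z - (x - l)) \<in> ?W" by (rule subspace_diff[OF W base[OF y] base[OF z]])
      then have "y - z \<in> ?W" by simp
      then show "\<exists>c. y - z = c *\<^sub>R v" using v by blast
    qed
    then show ?thesis using uminus_mem[OF l(1)] l(3) by blast
  qed
  assume ev: "edge_vector e v" and nin: "v \<notin> L \<and> t' \<notin> L \<and> t'' \<notin> L"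
  then obtain p q where pq: "e = closed_segment p q" "v = q - p" unfolding edge_vector_def by blast
  have vn: "v \<noteq> 0" using nin zero_mem by auto
  then have pne: "p \<noteq> q" using pq by auto
  have vW: "v \<in> ?W" unfolding pq(2) using vC pq(1) by (auto simp: vfam_Cons vpoly_def)
  have nullD: "null_on (perp ?W v) (bdry v [(1,e),(-1,e''),(-1,e'),(1,e''')])"
    by (rule const_imp_null_bdry[OF W vW vn vC null_imp_const[OF nullC]])
  have D: "bdry v [(1,e),(-1,e''),(-1,e'),(1,e''')] = bdry (1 *\<^sub>R (q - p)) [(1, e), (-1, (+) t'' ` e), (-1, (+) t' ` e), (1, (+) (t' + t'') ` e)]"
    by (simp add: tr pq(2))
  \<comment> \<open>The carrier is now the origin alone, where every point is good and the counts
    just test membership in \<open>L\<close>.\<close>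
  have perp0: "perp ?W v = {0}"
  proof -
    obtain u where u: "norm u = 1" "\<And>w. w \<in> ?W \<Longrightarrow> w = (w \<bullet> u) *\<^sub>R u" by (rule edge_direction[OF n0 m]) (rule that)
    have "w = 0" if "w \<in> perp ?W v" for w
    proof -
      have w: "w = (w \<bullet> u) *\<^sub>R u" "v \<bullet> w = 0" using that u(2) by (auto simp: perp_def)
      have "v = (v \<bullet> u) *\<^sub>R u" by (rule u(2)[OF vW])
      then have "(v \<bullet> u) * (w \<bullet> u) * (u \<bullet> u) = 0" "v \<bullet> u \<noteq> 0" using w vn by (metis inner_scaleR_left inner_scaleR_right mult.assoc mult.left_commute, metis scaleR_zero_left)
      then have "w \<bullet> u = 0" using u(1) by auto
      then show ?thesis using w(1) by simp
    qed
    then show ?thesis using subspace_0[OF subspace_perp[OF W]] by blast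
  qed
  have good0: "good {0} fam = UNIV" for fam by (auto simp: good_def irint_def intro: exI[of _ 1])
  have z: "mult (bdry (1 *\<^sub>R (q - p)) [(1, e), (-1, (+) t'' ` e), (-1, (+) t' ` e), (1, (+) (t' + t'') ` e)]) x = 0" for x
    using nullD unfolding perp0 null_on_def good0 D by blast
  have zz: "(of_bool (a - v \<in> L) :: int) - of_bool (a \<in> L) - of_bool (a - t'' - v \<in> L) + of_bool (a - t'' \<in> L)
     - of_bool (a - t' - v \<in> L) + of_bool (a - t' \<in> L) + of_bool (a - t' - t'' - v \<in> L) - of_bool (a - t' - t'' \<in> L) = 0" for a
    using z[of "a + p"] corner_mult[OF pne zero_less_one, of t'' t' "a + p"] unfolding pq by simp
  show "v + t' + t'' \<in> L \<and> v + t' - t'' \<in> L \<and> v - t' + t'' \<in> L \<and> v - t' - t'' \<in> L"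
    using corner_vanish_iff[OF zz] nin by blast
qed

section \<open>From the frame conditions to constancy\<close>

lemma corner_null:
  assumes fam: "vfam (perp (hyper n) m) [(1,e),(-1,(+) t'' ` e),(-1,(+) t' ` e),(1,(+) (t' + t'') ` e)]"
    and n: "n \<noteq> 0" "m \<in> hyper n" "m \<noteq> 0"
    and e: "irint (perp (hyper n) m) e \<noteq> {}"
    and iii: "\<And>v. edge_vector e v \<Longrightarrow> v \<notin> L \<and> t' \<notin> L \<and> t'' \<notin> L \<longrightarrow>
          v + t' + t'' \<in> L \<and> v + t' - t'' \<in> L \<and> v - t' + t'' \<in> L \<and> v - t' - t'' \<in> L"
  shows "const_on (perp (hyper n) m) [(1,e),(-1,(+) t'' ` e),(-1,(+) t' ` e),(1,(+) (t' + t'') ` e)]"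
proof -
  let ?W = "perp (hyper n) m"
  have W: "subspace ?W" by (rule subspace_perp[OF subspace_hyper])
  obtain v where v: "norm v = 1" "v \<in> ?W" "\<And>w. w \<in> ?W \<Longrightarrow> w = (w \<bullet> v) *\<^sub>R v" by (rule edge_direction[OF n]) (rule that)
  have ve: "vpoly ?W e" using fam by (simp add: vfam_Cons)
  obtain p0 q0 where pq0: "e = closed_segment p0 q0" using vpoly_dim1_segment[OF W _ ve] dim_edge[OF n] by (metis order_refl)
  show ?thesis
  proof (rule null_bdry_imp_const[OF W fam])
    fix u assume u: "u \<in> ?W" "u \<noteq> 0"
    have ne: "p0 \<noteq> q0"
    proof
      assume "p0 = q0"
      then have "e = {p0}" using pq0 by simp
      then obtain z where z: "z \<in> irint ?W e" using e by blast
      have "u = 0" using irint_not_flat[OF W z u(1)] z \<open>e = {p0}\<close> by (auto simp: irint_def)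
      then show False using u by simp
    qed
    \<comment> \<open>Orient the edge along \<open>u\<close>, swapping the end points if necessary.
      The assumption on edge vectors covers both orientations.\<close>
    obtain p q k where pq: "e = closed_segment p q" "p \<noteq> q" "k > 0" "u = k *\<^sub>R (q - p)"
    proof -
      have "q0 - p0 \<in> ?W" using ve unfolding pq0 vpoly_def by auto
      then have qp: "q0 - p0 = ((q0 - p0) \<bullet> v) *\<^sub>R v" by (rule v(3))
      have uv: "u = (u \<bullet> v) *\<^sub>R v" by (rule v(3)[OF u(1)])
      define k where "k = (u \<bullet> v) / ((q0 - p0) \<bullet> v)"
      have nz: "(q0 - p0) \<bullet> v \<noteq> 0" "u \<bullet> v \<noteq> 0" using qp uv ne u(2) by auto
      have uk: "u = k *\<^sub>R (q0 - p0)" using nz unfolding k_def by (subst uv, subst qp) simp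
      have "k \<noteq> 0" using nz by (simp add: k_def)
      then consider "k > 0" | "- k > 0" by linarith
      then show ?thesis
      proof cases
        case 1 then show ?thesis using that[of p0 q0 k] pq0 ne uk by blast
      next
        case 2
        have "u = (-k) *\<^sub>R (p0 - q0)" unfolding uk by (simp add: algebra_simps)
        then show ?thesis using that[of q0 p0 "-k"] 2 pq0 ne closed_segment_commute by metis
      qed
    qed
    have "edge_vector e (q - p)" unfolding edge_vector_def using pq(1) by blast
    note c = corner_vanish[OF iii[OF this]]
    show "null_on (perp ?W u) (bdry u [(1,e),(-1,(+) t'' ` e),(-1,(+) t' ` e),(1,(+) (t' + t'') ` e)])"
      unfolding null_on_def pq(4) pq(1) corner_mult[OF pq(2,3)] using c by blast
  qed
qed

text \<open>The second half of the family is the first moved by \<open>t\<close>, with opposite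
  sign. Counts do not change under \<open>L\<close>, so \<open>t\<close> may be replaced by
  \<open>t - l\<close>, which lies in \<open>V\<close>; the count is then a difference of a bounded
  function along \<open>V\<close>.\<close>

lemma shift_null:
  assumes V: "subspace V" and fam: "vfam V [(1,P),(-1,Q),(-1,(+) t ` P),(1,(+) t ` Q)]"
    and const: "const_on V [(1,P),(-1,Q),(-1,(+) t ` P),(1,(+) t ` Q)]" and l: "l \<in> L" "t - l \<in> V"
  shows "null_on V [(1,P),(-1,Q),(-1,(+) t ` P),(1,(+) t ` Q)]"
proof -
  have b: "bounded P" "bounded Q" using fam by (auto simp: vfam_Cons vpoly_def polytope_imp_bounded)
  obtain N1 N2 where N: "\<And>x. cnt P x \<le> N1" "\<And>x. cnt Q x \<le> N2" using cnt_bound[OF b(1)] cnt_bound[OF b(2)] by blast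
  have sh: "cnt R (x - t) = cnt R (x - (t - l))" for R x
    using cnt_translate_L[OF l(1), of R "x - (t - l)"] by (simp add: algebra_simps)
  show ?thesis
  proof (rule const_diff_imp_null[OF V fam const l(2), where G="\<lambda>x. int (cnt P x) - int (cnt Q x)" and N="int (N1 + N2)"])
    show "mult [(1,P),(-1,Q),(-1,(+) t ` P),(1,(+) t ` Q)] x =
       int (cnt P x) - int (cnt Q x) - (int (cnt P (x - (t - l))) - int (cnt Q (x - (t - l))))" for x
      by (simp add: cnt_translate sh)
    show "\<bar>int (cnt P x) - int (cnt Q x)\<bar> \<le> int (N1 + N2)" for x using N(1)[of x] N(2)[of x] by simp
  qed
qed

text \<open>All directions \<open>n\<close>, and within each plane all directions \<open>m\<close>,
  have to be treated, whether or not they carry a facet or an edge; without one, all members are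
  flat and the counts vanish at good points. Otherwise the centres of \<open>A\<close> and of the
  facet produce a frame, to which the conditions apply.\<close>

lemma conditions_imp_const:
  assumes A: "polytope A" "interior A \<noteq> {}" and c: "(\<lambda>x. 2 *\<^sub>R c - x) ` A = A"
    and Fs: "\<And>F. F facet_of A \<Longrightarrow> \<exists>d. (\<lambda>x. 2 *\<^sub>R d - x) ` F = F"
    and cond: "\<And>F F' t' t'' e e' e'' e'''. four_legged_frame A F F' t' t'' e e' e'' e''' \<Longrightarrow>
       (\<exists>l'\<in>L. coplanar ((+) l' ` F \<union> F')) \<and>
       (\<exists>l\<in>L. collinear ((+) l ` e \<union> e') \<or> collinear ((+) l ` e \<union> e'')) \<and>
       (\<forall>v. edge_vector e v \<longrightarrow> v \<notin> L \<and> t' \<notin> L \<and> t'' \<notin> L \<longrightarrow>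
          v + t' + t'' \<in> L \<and> v + t' - t'' \<in> L \<and> v - t' + t'' \<in> L \<and> v - t' - t'' \<in> L)"
  shows "const_on UNIV [(1,A)]"
proof (rule null_bdry_imp_const[OF subspace_UNIV])
  show "vfam UNIV [(1,A)]" using A by (auto simp: vfam_Cons vpoly_def)
  fix n :: "real^3" assume n0: "n \<noteq> 0"
  let ?V = "hyper n" let ?F = "fc n A" let ?F' = "fc (-n) A"
  note vF = vfam_facets[OF A]
  have B: "bdry n [(1,A)] = [(1,?F),(-1,?F')]" by simp
  have vB: "vfam ?V [(1,?F),(-1,?F')]" using vF(1)[of n] unfolding B .
  have F'r: "?F' = (\<lambda>x. 2 *\<^sub>R c - x) ` ?F" by (rule fc_reflect[OF c])
  show "null_on ?V (bdry n [(1,A)])"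
  proof (cases "irint ?V ?F = {}")
    case True
    \<comment> \<open>The opposite face is a reflection of the first, hence flat as well.\<close>
    have "irint ?V ?F' = {}"
    proof (rule ccontr)
      assume "irint ?V ?F' \<noteq> {}"
      then obtain z where z: "z \<in> irint ?V ?F'" by blast
      obtain m where m: "m \<in> ?V" "m \<noteq> 0" "\<forall>x\<in>?F. \<forall>y\<in>?F. m \<bullet> x = m \<bullet> y"
        using aff_dim_vpoly(4)[OF subspace_hyper vF(2)[of n] True] by blast
      have "m \<bullet> y = m \<bullet> z" if yF: "y \<in> ?F'" for y
      proof -
        have "z \<in> ?F'" using z by (simp add: irint_def)
        then obtain y0 z0 where "y0 \<in> ?F" "y = 2 *\<^sub>R c - y0" "z0 \<in> ?F" "z = 2 *\<^sub>R c - z0" using yF F'r by blast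
        moreover from this have "m \<bullet> y0 = m \<bullet> z0" using m(3) by blast
        ultimately show ?thesis by (simp add: inner_diff_right)
      qed
      then show False using irint_not_flat[OF subspace_hyper z m(1)] m(2) by blast
    qed
    then have "cnt ?F x = 0" "cnt ?F' x = 0" if "x \<in> good ?V [(1,?F),(-1,?F')]" for x
      using cnt_flat[OF that, of 1 ?F] cnt_flat[OF that, of "-1" ?F'] True by auto
    then show ?thesis unfolding B null_on_def by simp
  next
    case iF: False
    have facF: "?F facet_of A" using facet_fc[OF A n0] iF by blast
    obtain d where d: "(\<lambda>x. 2 *\<^sub>R d - x) ` ?F = ?F" using Fs[OF facF] by blast
    \<comment> \<open>The composition of the reflections in the centre of the facet and in the
      centre of \<open>A\<close>.\<close>
    define t' where "t' = 2 *\<^sub>R (c - d)"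
    have F't: "?F' = (+) t' ` ?F" unfolding F'r t'_def by (rule reflect_reflect[OF d])
    have iF': "irint ?V ?F' \<noteq> {}" unfolding F't irint_translation using iF by simp
    have facF': "?F' facet_of A" using facet_fc[OF A, of "-n"] n0 iF' by simp
    have neF: "?F' \<noteq> ?F" using fc_disjoint_opposite[OF A(2) n0] iF by (auto simp: irint_def)
    \<comment> \<open>The vector \<open>2 *\<^sub>R d - (p + q)\<close> composes the reflection of
      the edge in its midpoint with the reflection in the centre \<open>d\<close> of the
      facet.\<close>
    have frame: "four_legged_frame A ?F ?F' t' (2 *\<^sub>R d - (p + q)) (fc m ?F) ((+) t' ` fc m ?F) (fc (-m) ?F) ((+) (t' + (2 *\<^sub>R d - (p + q))) ` fc m ?F)
        \<and> fc (-m) ?F = (+) (2 *\<^sub>R d - (p + q)) ` fc m ?F"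
      if m: "m \<in> ?V" "m \<noteq> 0" and e: "irint (perp ?V m) (fc m ?F) \<noteq> {}" and pq: "fc m ?F = closed_segment p q" for m p q
    proof -
      let ?e = "fc m ?F" let ?t = "2 *\<^sub>R d - (p + q)" let ?W = "perp ?V m"
      have ve: "vpoly ?W ?e" by (rule vpoly_fc[OF vF(2)[of n]])
      have W: "subspace ?W" by (rule subspace_perp[OF subspace_hyper])
      have e2: "fc (-m) ?F = (+) ?t ` ?e"
      proof -
        have "fc (-m) ?F = (\<lambda>x. 2 *\<^sub>R d - x) ` closed_segment p q" using fc_reflect[OF d, of m] pq by simp
        also have "(\<lambda>x. 2 *\<^sub>R d - x) ` closed_segment p q = (+) (2 *\<^sub>R d - 2 *\<^sub>R ((1/2) *\<^sub>R (p + q))) ` closed_segment p q"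
          unfolding scaleR_diff_right[symmetric]
        proof (rule reflect_reflect)
          show "(\<lambda>x. 2 *\<^sub>R ((1/2) *\<^sub>R (p + q)) - x) ` closed_segment p q = closed_segment p q"
          proof -
            have sub: "(p + q) - x \<in> closed_segment p q" if xs: "x \<in> closed_segment p q" for x
            proof -
              obtain u where "0 \<le> u" "u \<le> 1" "x = (1 - u) *\<^sub>R p + u *\<^sub>R q" using xs by (auto simp: closed_segment_def)
              then show ?thesis unfolding closed_segment_def by (intro CollectI exI[of _ "1 - u"]) (auto simp: algebra_simps)
            qed
            have "closed_segment p q \<subseteq> (\<lambda>x. (p + q) - x) ` closed_segment p q"
            proof
              fix x assume "x \<in> closed_segment p q"
              then show "x \<in> (\<lambda>x. (p + q) - x) ` closed_segment p q" using sub by (intro image_eqI[of _ _ "(p + q) - x"]) auto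
            qed
            then show ?thesis using sub by auto
          qed
        qed
        finally show ?thesis using pq by simp
      qed
      have eface: "?e face_of ?F" using vF(2)[of n] by (intro fc_face_of polytope_imp_convex) (simp add: vpoly_def)
      have e2face: "fc (-m) ?F face_of ?F" using vF(2)[of n] by (intro fc_face_of polytope_imp_convex) (simp add: vpoly_def)
      have ad: "aff_dim ?e = 1" using aff_dim_vpoly(3)[OF W ve e] dim_edge[OF n0 m] by simp
      have "irint ?W (fc (-m) ?F) \<noteq> {}" unfolding e2 irint_translation using e by simp
      then have ad2: "aff_dim (fc (-m) ?F) = 1"
        using aff_dim_vpoly(3)[OF W, of "fc (-m) ?F"] vpoly_fc[OF vF(2)[of n], of "-m"] dim_edge[OF n0 m] by simp
      have "?F face_of A" using facF by (simp add: facet_of_def)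
      then have eA: "?e edge_of A" using eface ad face_of_trans unfolding edge_of_def by blast
      have "fc (-m) ?F \<noteq> ?e"
      proof
        assume same: "fc (-m) ?F = ?e"
        obtain z where z: "z \<in> irint ?V ?F" using iF by blast
        obtain x where x: "x \<in> ?e" using ve by (auto simp: vpoly_def)
        have x2: "x \<in> fc (-m) ?F" unfolding same by (rule x)
        have mx: "m \<bullet> y = m \<bullet> x" if y: "y \<in> ?F" for y
        proof (rule antisym)
          show "m \<bullet> y \<le> m \<bullet> x" using x y unfolding fc_def[of m] by blast
          have "(-m) \<bullet> y \<le> (-m) \<bullet> x" using x2 y unfolding fc_def[of "-m"] by blast
          then show "m \<bullet> x \<le> m \<bullet> y" by simp
        qed
        have zF: "z \<in> ?F" using z by (simp add: irint_def)
        have "m \<bullet> y = m \<bullet> z" if "y \<in> ?F" for y using mx[OF that] mx[OF zF] by simp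
        then show False using irint_not_flat[OF subspace_hyper z m(1)] m(2) by blast
      qed
      then show ?thesis unfolding four_legged_frame_def
        using facF facF' neF F't eA eface e2face ad2 e2 face_of_imp_subset unfolding edge_of_def by blast
    qed
    have constB: "const_on ?V [(1,?F),(-1,?F')]"
    proof (rule null_bdry_imp_const[OF subspace_hyper vB])
      fix m assume m: "m \<in> ?V" "m \<noteq> 0"
      let ?W = "perp ?V m" let ?e = "fc m ?F"
      have W: "subspace ?W" by (rule subspace_perp[OF subspace_hyper])
      have ve: "vpoly ?W ?e" by (rule vpoly_fc[OF vF(2)[of n]])
      obtain p q where pq: "?e = closed_segment p q" using vpoly_dim1_segment[OF W _ ve] dim_edge[OF n0 m] by (metis order_refl)
      define t'' where "t'' = 2 *\<^sub>R d - (p + q)"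
      have e2: "fc (-m) ?F = (\<lambda>x. 2 *\<^sub>R d - x) ` ?e" by (rule fc_reflect[OF d])
      have C: "bdry m [(1,?F),(-1,?F')] = [(1,?e),(-1,fc (-m) ?F),(-1,(+) t' ` ?e),(1,(+) t' ` fc (-m) ?F)]"
        by (simp add: F't fc_translation)
      have vC: "vfam ?W [(1,?e),(-1,fc (-m) ?F),(-1,(+) t' ` ?e),(1,(+) t' ` fc (-m) ?F)]"
        using vfam_bdry[OF vB, of m] unfolding C .
      show "null_on ?W (bdry m [(1,?F),(-1,?F')])"
        unfolding C
      proof (cases "irint ?W ?e = {}")
        case True
        have i2: "irint ?W (fc (-m) ?F) = {}"
        proof (rule ccontr)
          assume "irint ?W (fc (-m) ?F) \<noteq> {}"
          then obtain z where z: "z \<in> irint ?W (fc (-m) ?F)" by blast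
          obtain k where k: "k \<in> ?W" "k \<noteq> 0" "\<forall>x\<in>?e. \<forall>y\<in>?e. k \<bullet> x = k \<bullet> y"
            using aff_dim_vpoly(4)[OF W ve True] by blast
          have "k \<bullet> y = k \<bullet> z" if yF: "y \<in> fc (-m) ?F" for y
          proof -
            have "z \<in> fc (-m) ?F" using z by (simp add: irint_def)
            then obtain y0 z0 where "y0 \<in> ?e" "y = 2 *\<^sub>R d - y0" "z0 \<in> ?e" "z = 2 *\<^sub>R d - z0" using yF e2 by blast
            moreover from this have "k \<bullet> y0 = k \<bullet> z0" using k(3) by blast
            ultimately show ?thesis by (simp add: inner_diff_right)
          qed
          then show False using irint_not_flat[OF W z k(1)] k(2) by blast
        qed
        have i34: "irint ?W ((+) t' ` ?e) = {}" "irint ?W ((+) t' ` fc (-m) ?F) = {}"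
          unfolding irint_translation using True i2 by simp_all
        show "null_on ?W [(1,?e),(-1,fc (-m) ?F),(-1,(+) t' ` ?e),(1,(+) t' ` fc (-m) ?F)]"
          unfolding null_on_def
        proof
          fix x assume x: "x \<in> good ?W [(1,?e),(-1,fc (-m) ?F),(-1,(+) t' ` ?e),(1,(+) t' ` fc (-m) ?F)]"
          have "cnt ?e x = 0" "cnt (fc (-m) ?F) x = 0" "cnt ((+) t' ` ?e) x = 0" "cnt ((+) t' ` fc (-m) ?F) x = 0"
            using cnt_flat[OF x, of 1 ?e] cnt_flat[OF x, of "-1" "fc (-m) ?F"] cnt_flat[OF x, of "-1" "(+) t' ` ?e"]
              cnt_flat[OF x, of 1 "(+) t' ` fc (-m) ?F"] True i2 i34 by auto
          then show "mult [(1,?e),(-1,fc (-m) ?F),(-1,(+) t' ` ?e),(1,(+) t' ` fc (-m) ?F)] x = 0" by simp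
        qed
      next
        case False
        note fr = frame[OF m False pq, folded t''_def]
        have tt: "fc (-m) ?F = (+) t'' ` ?e" using fr by blast
        have tt2: "(+) t' ` fc (-m) ?F = (+) (t' + t'') ` ?e" unfolding tt by (simp add: image_image algebra_simps)
        note cd = cond[OF fr[THEN conjunct1]]
        let ?fam = "[(1,?e),(-1,(+) t'' ` ?e),(-1,(+) t' ` ?e),(1,(+) (t' + t'') ` ?e)]"
        have vC': "vfam ?W ?fam" using vC unfolding tt2 unfolding tt .
        have cC: "const_on ?W ?fam" by (rule corner_null[OF vC' n0 m False]) (use cd in blast)
        obtain l where l: "l \<in> L" "collinear ((+) l ` ?e \<union> (+) t' ` ?e) \<or> collinear ((+) l ` ?e \<union> fc (-m) ?F)"
          using cd by blast
        \<comment> \<open>The edge has positive length, so it determines the direction of the common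
          line, and the difference of the two translations is parallel to the edge.\<close>
        have par: "t - l \<in> ?W" if col: "collinear ((+) l ` ?e \<union> (+) t ` ?e)" for t
        proof -
          obtain u where u: "\<And>x y. x \<in> (+) l ` ?e \<union> (+) t ` ?e \<Longrightarrow> y \<in> (+) l ` ?e \<union> (+) t ` ?e \<Longrightarrow> \<exists>k. x - y = k *\<^sub>R u"
            using col unfolding collinear_def by blast
          obtain v where v: "norm v = 1" "v \<in> ?W" "\<And>w. w \<in> ?W \<Longrightarrow> w = (w \<bullet> v) *\<^sub>R v" by (rule edge_direction[OF n0 m]) (rule that)
          obtain z s where z: "z \<in> ?e" "s > 0" "\<And>w. w \<in> ?W \<Longrightarrow> norm w < s \<Longrightarrow> z + w \<in> ?e" using False by (auto simp: irint_def)
          have zw: "z + (s/2) *\<^sub>R v \<in> ?e" using z v W by (intro z(3)) (auto simp: subspace_scale)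
          obtain k where k: "(l + (z + (s/2) *\<^sub>R v)) - (l + z) = k *\<^sub>R u" using u[of "l + (z + (s/2) *\<^sub>R v)" "l + z"] zw z(1) by blast
          obtain k' where k': "(t + z) - (l + z) = k' *\<^sub>R u" using u[of "t + z" "l + z"] z(1) by blast
          have sv: "(s/2) *\<^sub>R v = k *\<^sub>R u" using k by simp
          have "k \<noteq> 0" using sv z(2) v(1) by auto
          then have "u = (1/k) *\<^sub>R ((s/2) *\<^sub>R v)" unfolding sv by simp
          then have "u \<in> ?W" using v(2) W by (metis subspace_scale)
          then have "k' *\<^sub>R u \<in> ?W" using W by (simp add: subspace_scale)
          then show ?thesis using k' by simp
        qed
        \<comment> \<open>The two negative members trade places, so that one cancellation argument
          serves a translation by \<open>t'\<close> as well as one by \<open>t''\<close>.\<close>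
        have swap: "null_on ?W [(1,P),(-1,Q),(-1,R),(1,S)] \<longleftrightarrow> null_on ?W [(1,P),(-1,R),(-1,Q),(1,S)]"
          "const_on ?W [(1,P),(-1,Q),(-1,R),(1,S)] \<longleftrightarrow> const_on ?W [(1,P),(-1,R),(-1,Q),(1,S)]"
          "vfam ?W [(1,P),(-1,Q),(-1,R),(1,S)] \<longleftrightarrow> vfam ?W [(1,P),(-1,R),(-1,Q),(1,S)]" for P Q R S
        proof -
          have g: "good ?W [(1,P),(-1,Q),(-1,R),(1,S)] = good ?W [(1,P),(-1,R),(-1,Q),(1,S)]" by (auto simp: good_Cons)
          have m: "mult [(1,P),(-1,Q),(-1,R),(1,S)] x = mult [(1,P),(-1,R),(-1,Q),(1,S)] x" for x by simp
          show "null_on ?W [(1,P),(-1,Q),(-1,R),(1,S)] \<longleftrightarrow> null_on ?W [(1,P),(-1,R),(-1,Q),(1,S)]"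
            "const_on ?W [(1,P),(-1,Q),(-1,R),(1,S)] \<longleftrightarrow> const_on ?W [(1,P),(-1,R),(-1,Q),(1,S)]"
            unfolding null_on_def const_on_def g m by blast+
          show "vfam ?W [(1,P),(-1,Q),(-1,R),(1,S)] \<longleftrightarrow> vfam ?W [(1,P),(-1,R),(-1,Q),(1,S)]" by (auto simp: vfam_Cons)
        qed
        have S1: "(+) (t' + t'') ` ?e = (+) t' ` (+) t'' ` ?e" "(+) (t' + t'') ` ?e = (+) t'' ` (+) t' ` ?e"
          by (simp_all add: image_image algebra_simps)
        have "null_on ?W ?fam"
          using l(2)
        proof
          assume "collinear ((+) l ` ?e \<union> (+) t' ` ?e)"
          from shift_null[OF W _ _ l(1) par[OF this], of ?e "(+) t'' ` ?e"] show ?thesis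
            using vC' cC unfolding S1(1) by blast
        next
          assume "collinear ((+) l ` ?e \<union> fc (-m) ?F)"
          then have "collinear ((+) l ` ?e \<union> (+) t'' ` ?e)" unfolding tt .
          from shift_null[OF W _ _ l(1) par[OF this], of ?e "(+) t' ` ?e"] show ?thesis
            using vC' cC unfolding S1(2) swap[of ?e "(+) t'' ` ?e"] by blast
        qed
        then show "null_on ?W [(1,?e),(-1,fc (-m) ?F),(-1,(+) t' ` ?e),(1,(+) t' ` fc (-m) ?F)]"
          unfolding tt2 unfolding tt .
      qed
    qed
    \<comment> \<open>The condition on the planes of the facets is stated for frames, so an edge of
      the facet is chosen in order to have one.\<close>
    obtain l' where l': "l' \<in> L" "t' - l' \<in> ?V"
    proof -
      have fv: "vpoly ?V ?F" by (rule vF(2))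
      obtain e where e: "e edge_of ?F"
      proof -
        have ad: "aff_dim ?F = 2" using aff_dim_vpoly(3)[OF subspace_hyper fv iF] dim_hyper[OF n0] by simp
        have pF: "polytope ?F" using fv by (simp add: vpoly_def)
        obtain G where "G facet_of ?F"
          using polytope_facet_exists[OF pF] ad by auto
        then show ?thesis using that ad unfolding facet_of_def edge_of_def by auto
      qed
      then have ef: "e face_of ?F" "aff_dim e = 1" by (auto simp: edge_of_def)
      have ad: "aff_dim ?F = 2" using aff_dim_vpoly(3)[OF subspace_hyper fv iF] dim_hyper[OF n0] by simp
      have "e \<noteq> {}" "e \<noteq> ?F" using ef ad by auto
      then obtain m where m: "m \<in> ?V" "m \<noteq> 0" "e = fc m ?F" using face_imp_fc[OF n0 fv ef(1)] by blast
      let ?W = "perp ?V m"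
      have W: "subspace ?W" by (rule subspace_perp[OF subspace_hyper])
      have ve: "vpoly ?W e" unfolding m(3) by (rule vpoly_fc[OF fv])
      have ie: "irint ?W e \<noteq> {}" using aff_dim_vpoly(2)[OF W ve] ef(2) dim_edge[OF n0 m(1,2)] by simp
      obtain p q where pq: "e = closed_segment p q" using vpoly_dim1_segment[OF W _ ve] dim_edge[OF n0 m(1,2)] by (metis order_refl)
      note fr = frame[OF m(1,2) ie[unfolded m(3)] pq[unfolded m(3)]]
      obtain l' where l': "l' \<in> L" "coplanar ((+) l' ` ?F \<union> ?F')" using cond[OF fr[THEN conjunct1]] by blast
      obtain a b where ab: "a \<noteq> 0" "(+) l' ` ?F \<union> ?F' \<subseteq> {x. a \<bullet> x = b}" by (rule coplanar_imp_hyperplane[OF l'(2)]) (rule that)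
      have a1: "a \<bullet> (l' + x) = b" "a \<bullet> (t' + x) = b" if "x \<in> ?F" for x using ab(2) that unfolding F't by auto
      have "\<exists>k. a = k *\<^sub>R n"
      proof (rule parallel_of_const[OF subspace_UNIV UNIV_I n0 iF UNIV_I])
        show "a \<bullet> x = a \<bullet> y" if "x \<in> ?F" "y \<in> ?F" for x y using a1(1)[OF that(1)] a1(1)[OF that(2)] by (simp add: inner_add_right)
        show "n \<bullet> x = n \<bullet> y" if "x \<in> ?F" "y \<in> ?F" for x y using that by (rule fc_const)
      qed
      then obtain k where k: "a = k *\<^sub>R n" by blast
      obtain x where x: "x \<in> ?F" using iF by (auto simp: irint_def)
      have "a \<bullet> t' = a \<bullet> l'" using a1[OF x] by (simp add: inner_add_right)
      then have "n \<bullet> (t' - l') = 0" using k ab(1) by (auto simp: inner_diff_right)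
      then show ?thesis using that[OF l'(1)] by (simp add: perp_def)
    qed
    have "null_on ?V [(1,?F),(-1,?F')]"
    proof -
      have bF: "bounded ?F" using vF(2)[of n] by (simp add: vpoly_def polytope_imp_bounded)
      obtain N where N: "\<And>x. cnt ?F x \<le> N" using cnt_bound[OF bF] by blast
      show ?thesis
      proof (rule const_diff_imp_null[OF subspace_hyper vB constB l'(2), where G="\<lambda>x. int (cnt ?F x)" and N="int N"])
        fix x
        have "cnt ?F (x - t') = cnt ?F (x - (t' - l'))"
          using cnt_translate_L[OF l'(1), of ?F "x - (t' - l')"] by (simp add: algebra_simps)
        then show "mult [(1,?F),(-1,?F')] x = int (cnt ?F x) - int (cnt ?F (x - (t' - l')))"
          unfolding F't by (simp add: cnt_translate)
        show "\<bar>int (cnt ?F x)\<bar> \<le> int N" using N[of x] by simp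
      qed
    qed
    then show ?thesis unfolding B .
  qed
qed

end

theorem theorem2p4:
  fixes A L :: "(real^3) set"
  assumes "polytope A" and "interior A \<noteq> {}" and "is_lattice L"
  shows "(\<exists>k::nat. k > 0 \<and> tiles_at_level A L k) \<longleftrightarrow>
    centrally_symmetric A \<and>
    (\<forall>F. F facet_of A \<longrightarrow> centrally_symmetric F) \<and>
    (\<forall>F F' \<tau>' \<tau>'' e e' e'' e'''. four_legged_frame A F F' \<tau>' \<tau>'' e e' e'' e''' \<longrightarrow>
       (\<exists>l'\<in>L. coplanar ((+) l' ` F \<union> F')) \<and>
       (\<exists>l\<in>L. collinear ((+) l ` e \<union> e') \<or> collinear ((+) l ` e \<union> e'')) \<and>
       (\<forall>v. edge_vector e v \<longrightarrow> v \<notin> L \<and> \<tau>' \<notin> L \<and> \<tau>'' \<notin> L \<longrightarrow>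
          v + \<tau>' + \<tau>'' \<in> L \<and> v + \<tau>' - \<tau>'' \<in> L \<and>
          v - \<tau>' + \<tau>'' \<in> L \<and> v - \<tau>' - \<tau>'' \<in> L))"
proof -
  interpret lattice3 L
    unfolding lattice3_def by (rule lattice_discrete_subgroup[OF assms(3)])
  note A = assms(1,2)
  show ?thesis
    unfolding tiles_iff_const[OF A]
  proof
    assume const: "const_on UNIV [(1,A)]"
    obtain c where c: "(\<lambda>x. 2 *\<^sub>R c - x) ` A = A" using tiling_imp_symmetric[OF A const] by blast
    have facets: "centrally_symmetric F" if F: "F facet_of A" for F
    proof -
      obtain n where n: "norm n = 1" "F = fc n A" using facet_of_imp_fc[OF A F] by blast
      then show ?thesis
        using tiling_imp_facet_symmetric[OF A const c n(1)] unfolding centrally_symmetric_def by blast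
    qed
    have cA: "centrally_symmetric A" using c unfolding centrally_symmetric_def by blast
    have frames: "(\<exists>l'\<in>L. coplanar ((+) l' ` F \<union> F')) \<and>
       (\<exists>l\<in>L. collinear ((+) l ` e \<union> e') \<or> collinear ((+) l ` e \<union> e'')) \<and>
       (\<forall>v. edge_vector e v \<longrightarrow> v \<notin> L \<and> \<tau>' \<notin> L \<and> \<tau>'' \<notin> L \<longrightarrow>
          v + \<tau>' + \<tau>'' \<in> L \<and> v + \<tau>' - \<tau>'' \<in> L \<and>
          v - \<tau>' + \<tau>'' \<in> L \<and> v - \<tau>' - \<tau>'' \<in> L)"
      if fr: "four_legged_frame A F F' \<tau>' \<tau>'' e e' e'' e'''" for F F' \<tau>' \<tau>'' e e' e'' e'''
    proof -
      note q = tiling_imp_frame_conditions[OF A const fr]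
      show ?thesis using q(1,2) q(3) by blast
    qed
    show "centrally_symmetric A \<and>
    (\<forall>F. F facet_of A \<longrightarrow> centrally_symmetric F) \<and>
    (\<forall>F F' \<tau>' \<tau>'' e e' e'' e'''. four_legged_frame A F F' \<tau>' \<tau>'' e e' e'' e''' \<longrightarrow>
       (\<exists>l'\<in>L. coplanar ((+) l' ` F \<union> F')) \<and>
       (\<exists>l\<in>L. collinear ((+) l ` e \<union> e') \<or> collinear ((+) l ` e \<union> e'')) \<and>
       (\<forall>v. edge_vector e v \<longrightarrow> v \<notin> L \<and> \<tau>' \<notin> L \<and> \<tau>'' \<notin> L \<longrightarrow>
          v + \<tau>' + \<tau>'' \<in> L \<and> v + \<tau>' - \<tau>'' \<in> L \<and>
          v - \<tau>' + \<tau>'' \<in> L \<and> v - \<tau>' - \<tau>'' \<in> L))"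
      proof (rule conjI[OF cA conjI])
      show "\<forall>F. F facet_of A \<longrightarrow> centrally_symmetric F" using facets by blast
    qed (rule allI impI | erule frames)+
  next
    assume R: "centrally_symmetric A \<and>
    (\<forall>F. F facet_of A \<longrightarrow> centrally_symmetric F) \<and>
    (\<forall>F F' \<tau>' \<tau>'' e e' e'' e'''. four_legged_frame A F F' \<tau>' \<tau>'' e e' e'' e''' \<longrightarrow>
       (\<exists>l'\<in>L. coplanar ((+) l' ` F \<union> F')) \<and>
       (\<exists>l\<in>L. collinear ((+) l ` e \<union> e') \<or> collinear ((+) l ` e \<union> e'')) \<and>
       (\<forall>v. edge_vector e v \<longrightarrow> v \<notin> L \<and> \<tau>' \<notin> L \<and> \<tau>'' \<notin> L \<longrightarrow>
          v + \<tau>' + \<tau>'' \<in> L \<and> v + \<tau>' - \<tau>'' \<in> L \<and>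
          v - \<tau>' + \<tau>'' \<in> L \<and> v - \<tau>' - \<tau>'' \<in> L))"
    from R[THEN conjunct1] obtain c where c: "(\<lambda>x. 2 *\<^sub>R c - x) ` A = A" unfolding centrally_symmetric_def by blast
    show "const_on UNIV [(1,A)]"
    proof (rule conditions_imp_const[OF A c])
      show "\<exists>d. (\<lambda>x. 2 *\<^sub>R d - x) ` F = F" if "F facet_of A" for F
        using R[THEN conjunct2, THEN conjunct1, rule_format, OF that] unfolding centrally_symmetric_def .
    qed (rule R[THEN conjunct2, THEN conjunct2, rule_format])
  qed
qed

end
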